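(* Let $\omega\in\mathbb R$ and $\alpha,\beta\ge0$. Let $\mathbf U\in V^h$ satisfy $$a(\mathbf U,\mathbf v)+\iota\omega(\mathcal D\mathbf U,\mathbf v)-\omega^2(\mathbf U,\mathbf v)=b(\mathbf v)\quad\forall\mathbf v\in V^h,$$ let $\mathbf U^{\mathbf m}\in V^{h,\mathbf m}$ satisfy $$a(\mathbf U^{\mathbf m},\mathbf v)+\iota\omega(\mathcal D\mathbf U^{\mathbf m},\mathbf v)-\omega^2(\mathbf U^{\mathbf m},\mathbf v)=b(\mathbf v)\quad\forall\mathbf v\in V^{h,\mathbf m},$$ and put $\mathbf E=\mathbf U-\mathbf U^{\mathbf m}$. Let $\boldsymbol\psi\in V^h$, let $H(\cdot)=(\cdot,\boldsymbol\psi)$, and let $\boldsymbol\Phi\in V^h$ solve the dual problem $$a(\mathbf v,\boldsymbol\Phi)+\iota\omega(\mathbf v,\mathcal D\boldsymbol\Phi)-\omega^2(\mathbf v,\boldsymbol\Phi)=H(\mathbf v)\quad\forall\mathbf v\in V^h.$$ Then $$|H(\mathbf E)|\le\sum_{i=0}^n\bigl|(\mathbf R^h(\mathbf U^{\mathbf m}),\mathcal R_i\boldsymbol\Phi)\bigr|$$ and $$|H(\mathbf E)|\le\sum_{i=0}^n\sum_{j=m_i+1}^{k_i}\frac{\bigl|a(\boldsymbol\Phi,\mathbf Z_{i,j})\,(\mathbf R^h(\mathbf U^{\mathbf m}),\mathbf Z_{i,j})\bigr|}{\Lambda_{i,j}}.$$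
   Context: Setting. $\Omega\subset\mathbb R^d$ ($d=2,3$) is a bounded domain with boundary $\partial\Omega=\Gamma_D\cup\Gamma_N$, $\Gamma_D\cap\Gamma_N=\emptyset$, and $\mathcal T$ is a subdivision of $\Omega$ into elements (e.g. triangles or tetrahedra). $V^h=\{\mathbf v\in[H^1(\Omega)]^d:\mathbf v|_{\Gamma_D}=\mathbf 0,\ \mathbf v|_T\in[\mathcal P_p(T)]^d\ \forall T\in\mathcal T\}$ is the space of continuous piecewise polynomial vector fields of order $p$. $(\cdot,\cdot)$ is the $L^2(\Omega)$ inner product. $a(\mathbf v,\mathbf w)=2(\mu\,\boldsymbol\varepsilon(\mathbf v):\boldsymbol\varepsilon(\mathbf w))+(\kappa\nabla\cdot\mathbf v,\nabla\cdot\mathbf w)$ is the (symmetric) linear elasticity form, where the first term is integrated over $\Omega$, $\boldsymbol\varepsilon$ is the strain tensor and $\boldsymbol\varepsilon(\mathbf v):\boldsymbol\varepsilon(\mathbf w)=\sum_{i,j}\varepsilon_{ij}(\mathbf v)\varepsilon_{ij}(\mathbf w)$; $a$ is assumed bounded and coercive on $V^h$. $b(\mathbf v)=(\mathbf f,\mathbf v)+(\mathbf g_N,\mathbf v)_{\Gamma_N}$ is a bounded load functional. $\iota$ is the imaginary unit; solutions are complex valued, so all spaces are taken over $\mathbb C$, and $a(\cdot,\cdot)$ and $(\cdot,\cdot)$ are extended as Hermitian sesquilinear forms (linear in the first, conjugate-linear in the second argument; $b$ conjugate-linear). Damping. $\mathcal D$ is Rayleigh damping: $(\mathcal D\mathbf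 v,\mathbf w)=(\mathbf v,\mathcal D\mathbf w)=\alpha\,a(\mathbf v,\mathbf w)+\beta(\mathbf v,\mathbf w)$ with $\alpha,\beta\ge0$. Component mode synthesis decomposition. $\Omega$ is partitioned into $n$ connected subdomains $\Omega_1,\dots,\Omega_n$, each a union of elements of $\mathcal T$, with interface $\Gamma$ between the subdomains. For $i=1,\dots,n$, $V_i^h=\{\mathbf v\in V^h:\mathbf v|_{\Omega\setminus\Omega_i}=\mathbf 0\}$, and $V_0^h=\{\mathcal E\boldsymbol\nu:\boldsymbol\nu\in V^h|_\Gamma\}$, where $V^h|_\Gamma$ is the trace space of $V^h$ on $\Gamma$ and $\mathcal E\boldsymbol\nu\in V^h$ is the energy minimizing extension: $a(\mathcal E\boldsymbol\nu,\mathbf v)=0$ for all $\mathbf v\in V_i^h$, $i=1,\dots,n$, and $\mathcal E\boldsymbol\nu|_\Gamma=\boldsymbol\nu$. Then $V^h=\bigoplus_{i=0}^nV_i^h$ is an $a$-orthogonal decomposition. Let $k_i=\dim V_i^h$. For each $i=0,\dots,n$, $(\Lambda_{i,j},\mathbf Z_{i,j})_{j=1}^{k_i}$ are the eigenpairs of: $a(\mathbf Z_{i,j},\mathbf v)=\Lambda_{i,j}(\mathbf Z_{i,j},\mathbf v)$ for all $\mathbf v\in V_i^h$, with $\Lambda_{i,1}\le\cdots\le\Lambda_{i,k_i}$ and $\{\mathbf Z_{i,j}\}_j$ an $L^2$-orthonormal basis of $V_i^h$. For a multi-index $\mathbf m=(m_i)_{i=0}^n$ with $m_i\le k_i$, the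 reduced space is $V^{h,\mathbf m}=\bigoplus_{i=0}^nV_i^{h,m_i}$ with $V_i^{h,m_i}=\mathrm{span}\{\mathbf Z_{i,j}\}_{j=1}^{m_i}$. Ritz projectors. $\mathcal R_i:V^h\to V_i^h$ is defined by $a(\mathbf w-\mathcal R_i\mathbf w,\mathbf v)=0$ for all $\mathbf v\in V_i^h$. Residual. For $\mathbf w\in V^h$, the discrete residual $\mathbf R^h(\mathbf w)\in V^h$ is defined by $(\mathbf R^h(\mathbf w),\mathbf v)=b(\mathbf v)-a(\mathbf w,\mathbf v)-\iota\omega(\mathcal D\mathbf w,\mathbf v)+\omega^2(\mathbf w,\mathbf v)$ for all $\mathbf v\in V^h$. *)

theory Defs
  imports "HOL-Analysis.Analysis" "HOL-Library.Function_Algebras"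
begin

section \<open>Complex vector fields\<close>

type_synonym 'd field = "real ^ 'd \<Rightarrow> complex ^ 'd"

definition fscale :: "complex \<Rightarrow> ('d::finite) field \<Rightarrow> 'd field"
  where "fscale c v = (\<lambda>x. c *s v x)"

text \<open>Provides \<open>fld.span\<close>, \<open>fld.dim\<close>, \<open>fld.subspace\<close>: the linear algebra of
  vector fields over the complex numbers.\<close>

interpretation fld: vector_space "fscale :: complex \<Rightarrow> ('d::finite) field \<Rightarrow> 'd field"
  by unfold_locales
     (simp_all add: fscale_def fun_eq_iff vec_eq_iff algebra_simps)


section \<open>Lebesgue and Sobolev spaces\<close>

definition square_integrable :: "'a measure \<Rightarrow> ('a \<Rightarrow> 'b::euclidean_space) \<Rightarrow> bool"
  where "square_integrable M u \<longleftrightarrow>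
    u \<in> borel_measurable M \<and> integrable M (\<lambda>x. (norm (u x))\<^sup>2)"

definition ess_bounded :: "'a measure \<Rightarrow> ('a \<Rightarrow> real) \<Rightarrow> bool"
  where "ess_bounded M u \<longleftrightarrow>
    u \<in> borel_measurable M \<and> (\<exists>C. AE x in M. \<bar>u x\<bar> \<le> C)"

text \<open>The Hermitian inner product: linear in the first, conjugate-linear in the second argument.
  (The library's \<open>\<bullet>\<close> on \<open>complex ^ 'd\<close> is only its real part.)\<close>

definition l2_inner :: "(real ^ 'd) measure \<Rightarrow> ('d::finite) field \<Rightarrow> 'd field \<Rightarrow> complex"
  where "l2_inner M v w = (\<integral>x. (\<Sum>i\<in>UNIV. v x $ i * cnj (w x $ i)) \<partial>M)"

primrec Ck :: "nat \<Rightarrow> ('a::real_normed_vector \<Rightarrow> real) \<Rightarrow> bool" where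
  "Ck 0 \<phi> = continuous_on UNIV \<phi>"
| "Ck (Suc k) \<phi> = ((\<forall>x. \<phi> differentiable (at x)) \<and>
     (\<forall>h. Ck k (\<lambda>x. frechet_derivative \<phi> (at x) h)))"

definition test_functions :: "'a::real_normed_vector set \<Rightarrow> ('a \<Rightarrow> real) set"
  where "test_functions \<Omega> = {\<phi>. (\<forall>k. Ck k \<phi>) \<and>
     compact (closure {x. \<phi> x \<noteq> 0}) \<and> closure {x. \<phi> x \<noteq> 0} \<subseteq> \<Omega>}"

definition weak_partial ::
    "(real ^ 'd) set \<Rightarrow> 'd::finite \<Rightarrow> (real ^ 'd \<Rightarrow> complex) \<Rightarrow> (real ^ 'd \<Rightarrow> complex) \<Rightarrow> bool"
  where "weak_partial \<Omega> j u g \<longleftrightarrow> (\<forall>\<phi>\<in>test_functions \<Omega>.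
     (\<integral>x. frechet_derivative \<phi> (at x) (axis j 1) *\<^sub>R u x \<partial>lebesgue_on \<Omega>) =
     - (\<integral>x. \<phi> x *\<^sub>R g x \<partial>lebesgue_on \<Omega>))"

definition sobolev_H1 :: "(real ^ 'd) set \<Rightarrow> (('d::finite) field) set"
  where "sobolev_H1 \<Omega> = {v. \<forall>i. square_integrable (lebesgue_on \<Omega>) (\<lambda>x. v x $ i) \<and>
     (\<forall>j. \<exists>g. square_integrable (lebesgue_on \<Omega>) g \<and> weak_partial \<Omega> j (\<lambda>x. v x $ i) g)}"


section \<open>Surface measure\<close>

text \<open>The \<open>s\<close>-dimensional Hausdorff measure, normalised so that it agrees with
  \<open>s\<close>-dimensional Lebesgue measure on flat pieces.  It is countably additive on Borel sets, so
  \<open>measure_of\<close> below does not collapse to the null measure.\<close>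

definition hausdorff_outer :: "nat \<Rightarrow> 'a::euclidean_space set \<Rightarrow> ennreal"
  where "hausdorff_outer s A = (SUP \<delta>\<in>{0<..}.
     INF U\<in>{U :: nat \<Rightarrow> 'a set. A \<subseteq> (\<Union>k. U k) \<and> (\<forall>k. bounded (U k) \<and> diameter (U k) \<le> \<delta>)}.
       \<Sum>k. ennreal (unit_ball_vol (real s) * (diameter (U k) / 2) ^ s))"

definition surface_measure :: "(real ^ 'd::finite) measure"
  where "surface_measure = measure_of UNIV (sets borel) (hausdorff_outer (CARD('d) - 1))"


section \<open>Piecewise polynomials and the elasticity form\<close>

definition polynomial_le :: "nat \<Rightarrow> (real ^ 'd::finite \<Rightarrow> complex) \<Rightarrow> bool"
  where "polynomial_le p q \<longleftrightarrow> (\<exists>c :: ('d \<Rightarrow> nat) \<Rightarrow> complex. \<forall>x.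
     q x = (\<Sum>\<gamma>\<in>{\<gamma>. (\<Sum>i\<in>UNIV. \<gamma> i) \<le> p}. c \<gamma> * of_real (\<Prod>i\<in>UNIV. (x $ i) ^ \<gamma> i)))"

text \<open>The elements are compact regular closed sets with null boundary and disjoint interiors
  (e.g. triangles, tetrahedra).\<close>

definition subdivision_of :: "(real ^ 'd::finite) set set \<Rightarrow> (real ^ 'd) set \<Rightarrow> bool"
  where "subdivision_of \<T> \<Omega> \<longleftrightarrow> finite \<T> \<and> \<Union>\<T> = closure \<Omega> \<and>
     (\<forall>T\<in>\<T>. T \<noteq> {} \<and> compact T \<and> closure (interior T) = T \<and> interior T \<subseteq> \<Omega> \<and>
        negligible (frontier T)) \<and>
     (\<forall>T\<in>\<T>. \<forall>T'\<in>\<T>. T \<noteq> T' \<longrightarrow> interior T \<inter> interior T' = {})"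

text \<open>A member of the finite element space is represented by its continuous version on
  \<open>closure \<Omega>\<close>, extended by zero, so that equality of fields is equality of functions
  and boundary values are pointwise values.\<close>

definition fe_space ::
    "(real ^ 'd) set \<Rightarrow> (real ^ 'd) set \<Rightarrow> (real ^ 'd) set set \<Rightarrow> nat \<Rightarrow> (('d::finite) field) set"
  where "fe_space \<Omega> \<Gamma>D \<T> p = {v. v \<in> sobolev_H1 \<Omega> \<and> continuous_on (closure \<Omega>) v \<and>
     (\<forall>x. x \<notin> closure \<Omega> \<longrightarrow> v x = 0) \<and>
     (\<forall>x\<in>\<Gamma>D. v x = 0) \<and>
     (\<forall>T\<in>\<T>. \<forall>i. \<exists>q. polynomial_le p q \<and> (\<forall>x\<in>T. v x $ i = q x))}"

text \<open>Classical partial derivatives.  A finite element field is a polynomial in the interior of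
  each element, and the element boundaries are null sets, so this is its weak gradient almost
  everywhere.\<close>

definition partial :: "'d \<Rightarrow> ('d::finite) field \<Rightarrow> 'd \<Rightarrow> real ^ 'd \<Rightarrow> complex"
  where "partial j v i x = frechet_derivative v (at x) (axis j 1) $ i"

definition strain :: "('d::finite) field \<Rightarrow> real ^ 'd \<Rightarrow> 'd \<Rightarrow> 'd \<Rightarrow> complex"
  where "strain v x i j = (partial j v i x + partial i v j x) / 2"

definition divergence :: "('d::finite) field \<Rightarrow> real ^ 'd \<Rightarrow> complex"
  where "divergence v x = (\<Sum>i\<in>UNIV. partial i v i x)"

definition elasticity_form :: "(real ^ 'd) set \<Rightarrow> (real ^ 'd \<Rightarrow> real) \<Rightarrow> (real ^ 'd \<Rightarrow> real) \<Rightarrow>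
    ('d::finite) field \<Rightarrow> 'd field \<Rightarrow> complex"
  where "elasticity_form \<Omega> \<mu> \<kappa> v w =
     2 * (\<integral>x. of_real (\<mu> x) * (\<Sum>i\<in>UNIV. \<Sum>j\<in>UNIV. strain v x i j * cnj (strain w x i j))
            \<partial>lebesgue_on \<Omega>)
     + (\<integral>x. of_real (\<kappa> x) * divergence v x * cnj (divergence w x) \<partial>lebesgue_on \<Omega>)"

definition h1_norm :: "(real ^ 'd) set \<Rightarrow> ('d::finite) field \<Rightarrow> real"
  where "h1_norm \<Omega> v = sqrt (\<integral>x. (norm (v x))\<^sup>2 +
     (\<Sum>i\<in>UNIV. \<Sum>j\<in>UNIV. (norm (partial j v i x))\<^sup>2) \<partial>lebesgue_on \<Omega>)"


section \<open>The component mode synthesis setting\<close>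

text \<open>\<open>nsub\<close> is the number of subdomains; \<open>part i\<close> is the set of elements making up the
  \<open>i\<close>-th subdomain, \<open>1 \<le> i \<le> nsub\<close>.\<close>

record ('d::finite) elasticity_problem =
  Om   :: "(real ^ 'd) set"
  GamD :: "(real ^ 'd) set"
  GamN :: "(real ^ 'd) set"
  mesh :: "(real ^ 'd) set set"
  deg  :: nat
  mu   :: "real ^ 'd \<Rightarrow> real"
  kap  :: "real ^ 'd \<Rightarrow> real"
  load :: "'d field"
  trac :: "'d field"
  nsub :: nat
  part :: "nat \<Rightarrow> (real ^ 'd) set set"

definition Vh :: "('d::finite) elasticity_problem \<Rightarrow> ('d field) set"
  where "Vh P = fe_space (Om P) (GamD P) (mesh P) (deg P)"

definition ip :: "('d::finite) elasticity_problem \<Rightarrow> 'd field \<Rightarrow> 'd field \<Rightarrow> complex"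
  where "ip P = l2_inner (lebesgue_on (Om P))"

definition a_form :: "('d::finite) elasticity_problem \<Rightarrow> 'd field \<Rightarrow> 'd field \<Rightarrow> complex"
  where "a_form P = elasticity_form (Om P) (mu P) (kap P)"

definition b_fun :: "('d::finite) elasticity_problem \<Rightarrow> 'd field \<Rightarrow> complex"
  where "b_fun P v = ip P (load P) v +
     l2_inner (restrict_space surface_measure (GamN P)) (trac P) v"

definition subdomain :: "('d::finite) elasticity_problem \<Rightarrow> nat \<Rightarrow> (real ^ 'd) set"
  where "subdomain P i = Om P \<inter> interior (\<Union>(part P i))"

definition interface :: "('d::finite) elasticity_problem \<Rightarrow> (real ^ 'd) set"
  where "interface P = (\<Union>i\<in>{1..nsub P}. \<Union>j\<in>{1..nsub P} - {i}.
     closure (subdomain P i) \<inter> closure (subdomain P j))"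

definition elasticity_setting :: "('d::finite) elasticity_problem \<Rightarrow> bool"
  where "elasticity_setting P \<longleftrightarrow>
     CARD('d) \<in> {2, 3} \<and>
     open (Om P) \<and> connected (Om P) \<and> bounded (Om P) \<and> Om P \<noteq> {} \<and>
     frontier (Om P) = GamD P \<union> GamN P \<and> GamD P \<inter> GamN P = {} \<and>
     GamD P \<in> sets borel \<and> GamN P \<in> sets borel \<and>
     emeasure surface_measure (frontier (Om P)) < \<infinity> \<and>
     subdivision_of (mesh P) (Om P) \<and>
     ess_bounded (lebesgue_on (Om P)) (mu P) \<and> ess_bounded (lebesgue_on (Om P)) (kap P) \<and>
     square_integrable (lebesgue_on (Om P)) (load P) \<and>
     square_integrable (restrict_space surface_measure (GamN P)) (trac P)"

definition form_bounded_coercive :: "('d::finite) elasticity_problem \<Rightarrow> bool"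
  where "form_bounded_coercive P \<longleftrightarrow>
     (\<exists>C. \<forall>v\<in>Vh P. \<forall>w\<in>Vh P. cmod (a_form P v w) \<le> C * h1_norm (Om P) v * h1_norm (Om P) w) \<and>
     (\<exists>c>0. \<forall>v\<in>Vh P. Re (a_form P v v) \<ge> c * (h1_norm (Om P) v)\<^sup>2)"

definition load_bounded :: "('d::finite) elasticity_problem \<Rightarrow> bool"
  where "load_bounded P \<longleftrightarrow> (\<exists>C. \<forall>v\<in>Vh P. cmod (b_fun P v) \<le> C * h1_norm (Om P) v)"

definition subdomain_partition :: "('d::finite) elasticity_problem \<Rightarrow> bool"
  where "subdomain_partition P \<longleftrightarrow>
     (\<Union>i\<in>{1..nsub P}. part P i) = mesh P \<and>
     (\<forall>i\<in>{1..nsub P}. part P i \<noteq> {} \<and> connected (subdomain P i)) \<and>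
     (\<forall>i\<in>{1..nsub P}. \<forall>j\<in>{1..nsub P}. i \<noteq> j \<longrightarrow> part P i \<inter> part P j = {})"

definition interior_space :: "('d::finite) elasticity_problem \<Rightarrow> nat \<Rightarrow> ('d field) set"
  where "interior_space P i = {v\<in>Vh P. \<forall>x\<in>Om P - subdomain P i. v x = 0}"

definition trace_space :: "('d::finite) elasticity_problem \<Rightarrow> ('d field) set"
  where "trace_space P = (\<lambda>v. restrict v (interface P)) ` Vh P"

definition energy_extension :: "('d::finite) elasticity_problem \<Rightarrow> 'd field \<Rightarrow> 'd field"
  where "energy_extension P \<nu> = (THE w. w \<in> Vh P \<and>
     (\<forall>i\<in>{1..nsub P}. \<forall>v\<in>interior_space P i. a_form P w v = 0) \<and>
     restrict w (interface P) = \<nu>)"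

definition comp_space :: "('d::finite) elasticity_problem \<Rightarrow> nat \<Rightarrow> ('d field) set"
  where "comp_space P i =
     (if i = 0 then energy_extension P ` trace_space P else interior_space P i)"

definition comp_dim :: "('d::finite) elasticity_problem \<Rightarrow> nat \<Rightarrow> nat"
  where "comp_dim P i = fld.dim (comp_space P i)"

definition component_eigenpairs ::
    "('d::finite) elasticity_problem \<Rightarrow> (nat \<Rightarrow> nat \<Rightarrow> real) \<Rightarrow> (nat \<Rightarrow> nat \<Rightarrow> 'd field) \<Rightarrow> bool"
  where "component_eigenpairs P \<Lambda> Z \<longleftrightarrow> (\<forall>i\<in>{0..nsub P}.
     (\<forall>j\<in>{1..comp_dim P i}. Z i j \<in> comp_space P i \<and>
        (\<forall>v\<in>comp_space P i. a_form P (Z i j) v = of_real (\<Lambda> i j) * ip P (Z i j) v)) \<and>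
     (\<forall>j\<in>{1..comp_dim P i}. \<forall>l\<in>{1..comp_dim P i}. j \<le> l \<longrightarrow> \<Lambda> i j \<le> \<Lambda> i l) \<and>
     (\<forall>j\<in>{1..comp_dim P i}. \<forall>l\<in>{1..comp_dim P i}.
        ip P (Z i j) (Z i l) = (if j = l then 1 else 0)) \<and>
     fld.span (Z i ` {1..comp_dim P i}) = comp_space P i)"

definition reduced_space ::
    "('d::finite) elasticity_problem \<Rightarrow> (nat \<Rightarrow> nat \<Rightarrow> 'd field) \<Rightarrow> (nat \<Rightarrow> nat) \<Rightarrow> ('d field) set"
  where "reduced_space P Z m =
     {\<Sum>i=0..nsub P. w i | w. \<forall>i\<in>{0..nsub P}. w i \<in> fld.span (Z i ` {1..m i})}"

definition ritz :: "('d::finite) elasticity_problem \<Rightarrow> nat \<Rightarrow> 'd field \<Rightarrow> 'd field"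
  where "ritz P i w =
     (THE r. r \<in> comp_space P i \<and> (\<forall>v\<in>comp_space P i. a_form P (w - r) v = 0))"

text \<open>The damping operator is given weakly, through the discrete space.\<close>

definition rayleigh_damping ::
    "('d::finite) elasticity_problem \<Rightarrow> real \<Rightarrow> real \<Rightarrow> ('d field \<Rightarrow> 'd field) \<Rightarrow> bool"
  where "rayleigh_damping P \<alpha> \<beta> D \<longleftrightarrow> (\<forall>v\<in>Vh P. D v \<in> Vh P) \<and>
     (\<forall>v\<in>Vh P. \<forall>w\<in>Vh P.
        ip P (D v) w = of_real \<alpha> * a_form P v w + of_real \<beta> * ip P v w \<and>
        ip P v (D w) = of_real \<alpha> * a_form P v w + of_real \<beta> * ip P v w)"

definition residual ::
    "('d::finite) elasticity_problem \<Rightarrow> real \<Rightarrow> ('d field \<Rightarrow> 'd field) \<Rightarrow> 'd field \<Rightarrow> 'd field"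
  where "residual P \<omega> D w = (THE r. r \<in> Vh P \<and> (\<forall>v\<in>Vh P.
     ip P r v = b_fun P v - a_form P w v - \<i> * of_real \<omega> * ip P (D w) v
                + of_real (\<omega>\<^sup>2) * ip P w v))"

end

theory Submission
  imports Defs
begin

text \<open>The error representation is \<open>H E = (R, \<Phi>)\<close> with \<open>R\<close> the residual of \<open>Um\<close>; splitting
  \<open>\<Phi>\<close> along the \<open>a\<close>-orthogonal sum of the component spaces into its Ritz projections gives the
  first bound, and expanding these in the eigenmodes, with Galerkin orthogonality to the retained
  ones, the second.

  The analytic difficulty is the decomposition itself: the energy extension is unique only if a
  member of \<open>Vh P\<close> that vanishes on the interface splits into members of the interior spaces, that
  is, if cutting it off to one subdomain preserves membership in \<open>H1\<close>.  For continuous piecewise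
  polynomials, having square integrable weak derivatives is equivalent to being Lipschitz along
  axis-parallel segments inside the domain, and the latter property clearly survives the cut-off,
  for arbitrary element shapes.\<close>

section \<open>Smooth functions and bumps\<close>

text \<open>Element boundaries are only required to be null sets, so Green's formula on a single
  element is not at hand; this is what makes segments the right test. The obstacle on the way from
  \<open>sobolev_H1\<close> to segments is that a weak derivative comes with an L2 bound only. Its
  boundedness is due to its being, almost everywhere, the classical partial derivative, which in
  each of the finitely many compact elements is that of a polynomial; this identification is the
  task of the fundamental lemma.

  The energy extension, the Ritz projections and the residual are definite descriptions, so each of
  them needs existence and uniqueness. Existence rests on the eigenmodes: finitely many of them span
  each component space by hypothesis, and, through the decomposition, all of \<open>Vh P\<close>.
  Uniqueness rests on definiteness, of the energy form by coercivity and of the L2 product by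
  continuity of the fields. The damping operator is known only weakly, so it is always traded for
  \<alpha> times the energy form plus \<beta> times the L2 product.\<close>

lemma Ck_Suc_intro:
  assumes "\<And>x. (f has_derivative f' x) (at x)" and "\<And>h. Ck k (\<lambda>x. f' x h)"
  shows "Ck (Suc k) f"
proof -
  have "frechet_derivative f (at x) = f' x" for x
    using assms(1) by (metis frechet_derivative_at)
  then show ?thesis
    using assms by (auto simp: differentiable_def)
qed

lemma Ck_Suc_has_derivative:
  assumes "Ck (Suc k) f"
  shows "(f has_derivative frechet_derivative f (at x)) (at x)"
  using assms frechet_derivative_works by auto

lemma Ck_continuous: "Ck k f \<Longrightarrow> continuous_on UNIV f"
  by (cases k) (auto intro!: continuous_at_imp_continuous_on differentiable_imp_continuous_within)

lemma Ck_Suc_imp: "Ck (Suc k) f \<Longrightarrow> Ck k f"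
proof (induction k arbitrary: f)
  case 0
  then show ?case using Ck_continuous by fastforce
next
  case (Suc k)
  then show ?case by auto
qed

lemma Ck_const: "Ck k (\<lambda>x. c)"
  by (induction k arbitrary: c) auto

lemma Ck_add: "Ck k f \<Longrightarrow> Ck k g \<Longrightarrow> Ck k (\<lambda>x. f x + g x)"
proof (induction k arbitrary: f g)
  case 0
  then show ?case by (auto intro: continuous_intros)
next
  case (Suc k)
  show ?case
  proof (rule Ck_Suc_intro)
    show "((\<lambda>x. f x + g x) has_derivative
        (\<lambda>h. frechet_derivative f (at x) h + frechet_derivative g (at x) h)) (at x)" for x
      by (intro has_derivative_add Ck_Suc_has_derivative[of k] Suc.prems)
  qed (use Suc in auto)
qed

lemma Ck_mult: "Ck k f \<Longrightarrow> Ck k g \<Longrightarrow> Ck k (\<lambda>x. f x * g x)"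
proof (induction k arbitrary: f g)
  case 0
  then show ?case by (auto intro: continuous_intros)
next
  case (Suc k)
  show ?case
  proof (rule Ck_Suc_intro)
    show "((\<lambda>x. f x * g x) has_derivative
        (\<lambda>h. f x * frechet_derivative g (at x) h + frechet_derivative f (at x) h * g x)) (at x)" for x
      by (intro has_derivative_mult Ck_Suc_has_derivative[of k] Suc.prems)
  next
    fix h
    show "Ck k (\<lambda>x. f x * frechet_derivative g (at x) h + frechet_derivative f (at x) h * g x)"
      using Suc.prems by (intro Ck_add Suc.IH) (auto intro: Ck_Suc_imp)
  qed
qed

lemma Ck_prod: "(\<And>i. i \<in> I \<Longrightarrow> Ck k (f i)) \<Longrightarrow> Ck k (\<lambda>x. \<Prod>i\<in>I. f i x)"
  by (induction I rule: infinite_finite_induct) (auto intro: Ck_const Ck_mult)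

lemma Ck_vec_nth: "Ck k (\<lambda>x::real^'n. x $ i)"
proof (cases k)
  case (Suc l)
  have "((\<lambda>x::real^'n. x $ i) has_derivative (\<lambda>h. h $ i)) (at x)" for x
    by (rule bounded_linear_imp_has_derivative[OF bounded_linear_vec_nth])
  then show ?thesis
    unfolding Suc by (rule Ck_Suc_intro) (rule Ck_const)
qed (auto intro: continuous_intros)

lemma Ck_power: "Ck k f \<Longrightarrow> Ck k (\<lambda>x. f x ^ n)"
  by (induction n) (auto intro: Ck_const Ck_mult)

section \<open>Smooth bumps on boxes, built from exp(-1/t)\<close>

definition exp_recip :: "nat \<Rightarrow> real \<Rightarrow> real" where
  "exp_recip n t = (if t > 0 then (1 / t) ^ n * exp (- 1 / t) else 0)"

text \<open>With s = 1/t this is the decay of s^n / exp s at infinity; to the left of 0 the function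
  is zero.\<close>

lemma exp_recip_tendsto_0: "(exp_recip n \<longlongrightarrow> 0) (at 0)"
proof -
  have "((\<lambda>t. (1 / t) ^ n / exp (1 / t)) \<longlongrightarrow> (0::real)) (at_right 0)"
    using filterlim_compose[OF tendsto_power_div_exp_0 filterlim_inverse_at_top_right]
    by (simp add: inverse_eq_divide)
  then have "(exp_recip n \<longlongrightarrow> 0) (at_right 0)"
    by (rule Lim_transform_eventually)
       (auto simp: exp_recip_def eventually_at_filter exp_minus field_simps)
  moreover have "(exp_recip n \<longlongrightarrow> 0) (at_left 0)"
    by (rule tendsto_eventually) (auto simp: exp_recip_def eventually_at_filter)
  ultimately show ?thesis by (simp add: filterlim_split_at)
qed

text \<open>Differentiation maps the functions t^(-n) exp(-1/t) to linear combinations of functions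
  of the same family, which is what lets an induction reach all derivatives. Only the point 0 needs
  a limit.\<close>

lemma exp_recip_deriv:
  "(exp_recip n has_real_derivative exp_recip (n + 2) t - n * exp_recip (n + 1) t) (at t)"
proof (cases t "0::real" rule: linorder_cases)
  case less
  have "(exp_recip n has_real_derivative 0) (at t)"
    by (rule has_field_derivative_transform_within_open[where S="{..<0}" and f="\<lambda>_. 0"])
       (use less in \<open>auto simp: exp_recip_def\<close>)
  then show ?thesis using less by (simp add: exp_recip_def)
next
  case equal
  \<comment> \<open>Dividing by h raises the exponent by one, so the difference quotient at 0 is
    again a member of the family.\<close>
  have "((\<lambda>h. (exp_recip n (0 + h) - exp_recip n 0) / h) \<longlongrightarrow> 0) (at 0)"
  proof (rule Lim_transform_eventually[OF exp_recip_tendsto_0[of "Suc n"]])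
    show "\<forall>\<^sub>F h in at 0. exp_recip (Suc n) h = (exp_recip n (0 + h) - exp_recip n 0) / h"
      by (auto simp: exp_recip_def eventually_at_filter)
  qed
  then show ?thesis
    using equal by (simp add: DERIV_def exp_recip_def)
next
  case greater
  have "((\<lambda>t. (1 / t) ^ n * exp (- 1 / t)) has_real_derivative
      exp_recip (n + 2) t - n * exp_recip (n + 1) t) (at t)"
  proof (cases n)
    case 0
    then show ?thesis using greater
      by (auto intro!: derivative_eq_intros simp: exp_recip_def power2_eq_square field_simps)
  next
    case (Suc k)
    have r: "((\<lambda>t. 1 / t) has_real_derivative - (1 / t) * (1 / t)) (at t)"
      using greater by (auto intro!: derivative_eq_intros)
    have "((\<lambda>t. exp (- 1 / t)) has_real_derivative exp (- 1 / t) * ((1 / t) * (1 / t))) (at t)"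
      using greater by (auto intro!: derivative_eq_intros)
    from DERIV_mult[OF DERIV_power_Suc[OF r, of k] this]
    show ?thesis using greater unfolding Suc
      by (simp add: exp_recip_def algebra_simps)
  qed
  then show ?thesis
    by (rule has_field_derivative_transform_within_open[where S="{0<..}"])
       (use greater in \<open>auto simp: exp_recip_def\<close>)
qed

text \<open>The induction hypothesis is used at n + 1 and n + 2, so n stays arbitrary. The affine
  argument covers both kinds of factors of a box bump, rising from a and falling towards b.\<close>

lemma Ck_exp_recip: "Ck k (\<lambda>x::real^'n. exp_recip n (c * x $ i + d))"
proof (induction k arbitrary: n)
  case 0
  have "continuous_on UNIV (exp_recip n)"
    by (intro continuous_at_imp_continuous_on ballI DERIV_isCont[OF exp_recip_deriv])
  then show ?case
    by (auto intro!: continuous_intros continuous_on_compose2[of UNIV "exp_recip n"])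
next
  case (Suc k)
  let ?e = "\<lambda>n x. exp_recip n (c * x $ i + d)"
  show ?case
  proof (rule Ck_Suc_intro)
    fix x :: "real^'n"
    have "((\<lambda>x::real^'n. c * x $ i + d) has_derivative (\<lambda>h. c * h $ i)) (at x)"
      by (auto intro!: derivative_eq_intros bounded_linear_imp_has_derivative
          bounded_linear_vec_nth)
    from DERIV_compose_FDERIV[OF exp_recip_deriv[of n "c * x $ i + d"] this]
    show "(?e n has_derivative (\<lambda>h. (c * h $ i) * (?e (n + 2) x + (- n) * ?e (n + 1) x))) (at x)"
      by simp
  next
    fix h :: "real^'n"
    show "Ck k (\<lambda>x. (c * h $ i) * (?e (n + 2) x + (- n) * ?e (n + 1) x))"
      by (intro Ck_add Ck_mult Ck_const Suc)
  qed
qed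

text \<open>Since \<open>exp_recip 0 (k t) = exp (- 1 / t) powr (1 / k)\<close> for positive \<open>t\<close>, these smooth
  functions increase to the indicator function of the open box as \<open>k\<close> tends to infinity.\<close>

definition box_bump :: "real^'n \<Rightarrow> real^'n \<Rightarrow> nat \<Rightarrow> real^'n \<Rightarrow> real" where
  "box_bump a b k x =
     (\<Prod>i\<in>UNIV. exp_recip 0 (real k * (x $ i - a $ i)) * exp_recip 0 (real k * (b $ i - x $ i)))"

lemma Ck_box_bump: "Ck l (box_bump a b k)"
proof -
  have "Ck l (\<lambda>x. exp_recip 0 (real k * (x $ i - a $ i)) * exp_recip 0 (real k * (b $ i - x $ i)))" for i
    using Ck_mult[OF Ck_exp_recip[of l 0 "real k" i "- real k * a $ i"]
        Ck_exp_recip[of l 0 "- real k" i "real k * b $ i"]]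
    by (simp add: algebra_simps)
  then show ?thesis
    unfolding box_bump_def by (intro Ck_prod)
qed

lemma exp_recip_bounds: "0 \<le> exp_recip 0 t" "exp_recip 0 t \<le> 1"
  by (auto simp: exp_recip_def)

lemma box_bump_bounds: "0 \<le> box_bump a b k x" "box_bump a b k x \<le> 1"
  unfolding box_bump_def
  by (auto intro!: prod_nonneg prod_le_1 mult_nonneg_nonneg mult_le_one simp: exp_recip_bounds)

lemma box_bump_pos: "k > 0 \<Longrightarrow> box_bump a b k x > 0 \<longleftrightarrow> x \<in> box a b"
proof
  assume k: "k > 0"
  show "x \<in> box a b" if "box_bump a b k x > 0"
  proof -
    have "box_bump a b k x \<noteq> 0" using that by simp
    then have "real k * (x $ i - a $ i) > 0 \<and> real k * (b $ i - x $ i) > 0" for i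
      unfolding box_bump_def by (auto simp: exp_recip_def split: if_splits)
    then show ?thesis using k by (auto simp: mem_box_cart zero_less_mult_iff)
  qed
  show "box_bump a b k x > 0" if "x \<in> box a b"
    unfolding box_bump_def using that k by (auto intro!: prod_pos simp: exp_recip_def mem_box_cart)
qed

lemma box_bump_support: "{x. box_bump a b k x \<noteq> 0} \<subseteq> cbox a b"
proof (cases "k = 0")
  case False
  show ?thesis
  proof safe
    fix x assume "box_bump a b k x \<noteq> 0"
    then have "box_bump a b k x > 0"
      using box_bump_bounds(1)[of a b k x] by linarith
    then show "x \<in> cbox a b"
      using False box_bump_pos[of k a b x] box_subset_cbox[of a b] by blast
  qed
\<comment> \<open>At k = 0 every factor is \<open>exp_recip 0 0\<close>, which is 0.\<close>
qed (auto simp: box_bump_def exp_recip_def)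

lemma test_functions_box_bump:
  assumes "cbox a b \<subseteq> \<Omega>"
  shows "box_bump a b k \<in> test_functions \<Omega>"
proof -
  have "closure {x. box_bump a b k x \<noteq> 0} \<subseteq> cbox a b"
    by (rule closure_minimal[OF box_bump_support closed_cbox])
  moreover have "compact (closure {x. box_bump a b k x \<noteq> 0})"
    using bounded_subset[OF bounded_cbox box_bump_support] compact_closure by blast
  ultimately show ?thesis
    using assms by (auto simp: test_functions_def Ck_box_bump)
qed

lemma box_bump_tendsto: "(\<lambda>k. box_bump a b k x) \<longlonglongrightarrow> indicator (box a b) x"
proof (cases "x \<in> box a b")
  case True
  have *: "(\<lambda>k. exp_recip 0 (real k * t)) \<longlonglongrightarrow> 1" if "t > 0" for t
  proof (rule Lim_transform_eventually)
    have "(\<lambda>k. exp (- (1 / t) * (1 / real k))) \<longlonglongrightarrow> exp (- (1 / t) * 0)"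
      by (intro tendsto_intros lim_1_over_n)
    then show "(\<lambda>k. exp (- (1 / t) * (1 / real k))) \<longlonglongrightarrow> 1" by simp
    show "\<forall>\<^sub>F k in sequentially. exp (- (1 / t) * (1 / real k)) = exp_recip 0 (real k * t)"
      by (rule eventually_mono[OF eventually_gt_at_top[of 0]])
         (use that in \<open>auto simp: exp_recip_def field_simps\<close>)
  qed
  have "(\<lambda>k. box_bump a b k x) \<longlonglongrightarrow> (\<Prod>i\<in>(UNIV::'a set). 1 * 1)"
    unfolding box_bump_def using True
    by (intro tendsto_prod tendsto_mult *) (auto simp: mem_box_cart)
  then show ?thesis using True by simp
next
  case False
  have "\<forall>\<^sub>F k in sequentially. box_bump a b k x = 0"
    using eventually_gt_at_top[of 0]
    by eventually_elim (use False box_bump_pos box_bump_bounds(1) less_eq_real_def in metis)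
  then show ?thesis using False by (auto intro: tendsto_eventually)
qed

section \<open>Weak partial derivatives\<close>

lemma continuous_zero_outside_compact_bounded:
  fixes f :: "'a::topological_space \<Rightarrow> 'b::real_normed_vector"
  assumes "continuous_on K f" "compact K" "\<And>x. x \<notin> K \<Longrightarrow> f x = 0"
  obtains C where "C \<ge> 0" "\<And>x. norm (f x) \<le> C"
proof -
  have "bounded (f ` K)"
    using assms compact_continuous_image compact_imp_bounded by blast
  then obtain C where C: "\<And>x. x \<in> K \<Longrightarrow> norm (f x) \<le> C"
    by (auto simp: bounded_iff)
  have "norm (f x) \<le> max C 0" for x
    using C[of x] assms(3)[of x] by (cases "x \<in> K") auto
  then show ?thesis by (intro that[of "max C 0"]) auto
qed

section \<open>Test functions: supports, derivatives, bounds\<close>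

lemma test_function_zero: "\<phi> \<in> test_functions \<Omega> \<Longrightarrow> x \<notin> \<Omega> \<Longrightarrow> \<phi> x = 0"
  using closure_subset[of "{x. \<phi> x \<noteq> 0}"] by (auto simp: test_functions_def)

lemma test_function_mono: "\<phi> \<in> test_functions \<Omega> \<Longrightarrow> \<Omega> \<subseteq> \<Omega>' \<Longrightarrow> \<phi> \<in> test_functions \<Omega>'"
  by (auto simp: test_functions_def)

lemma test_function_has_derivative:
  "\<phi> \<in> test_functions \<Omega> \<Longrightarrow> (\<phi> has_derivative frechet_derivative \<phi> (at x)) (at x)"
  by (rule Ck_Suc_has_derivative[of 0]) (unfold test_functions_def, blast)

lemma test_function_continuous: "\<phi> \<in> test_functions \<Omega> \<Longrightarrow> continuous_on UNIV \<phi>"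
  using Ck_continuous by (auto simp: test_functions_def)

lemma test_function_derivative_continuous:
  "\<phi> \<in> test_functions \<Omega> \<Longrightarrow> continuous_on UNIV (\<lambda>x. frechet_derivative \<phi> (at x) h)"
proof -
  assume "\<phi> \<in> test_functions \<Omega>"
  then have "Ck (Suc 0) \<phi>" unfolding test_functions_def by blast
  then show ?thesis by simp
qed

lemma test_function_derivative_zero:
  assumes "\<phi> \<in> test_functions \<Omega>" "x \<notin> closure {x. \<phi> x \<noteq> 0}"
  shows "frechet_derivative \<phi> (at x) = (\<lambda>h. 0)"
proof -
  have "(\<phi> has_derivative (\<lambda>h. 0)) (at x)"
  proof (rule has_derivative_transform_within_open)
    show "((\<lambda>x. 0) has_derivative (\<lambda>h. 0)) (at x)" by simp
    show "open (- closure {x. \<phi> x \<noteq> 0})" by auto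
    show "0 = \<phi> y" if "y \<in> - closure {x. \<phi> x \<noteq> 0}" for y
      using that closure_subset[of "{x. \<phi> x \<noteq> 0}"] by auto
  qed (use assms in auto)
  then show ?thesis by (metis frechet_derivative_at)
qed

lemma test_function_derivative_zero':
  assumes "\<phi> \<in> test_functions \<Omega>" "x \<notin> \<Omega>"
  shows "frechet_derivative \<phi> (at x) h = 0"
proof -
  have "x \<notin> closure {x. \<phi> x \<noteq> 0}"
    using assms unfolding test_functions_def by blast
  then show ?thesis using test_function_derivative_zero[OF assms(1)] by simp
qed

lemma test_function_bounded:
  assumes "\<phi> \<in> test_functions \<Omega>"
  obtains C where "C \<ge> 0" "\<And>x. \<bar>\<phi> x\<bar> \<le> C" "\<And>x. \<bar>frechet_derivative \<phi> (at x) h\<bar> \<le> C"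
proof -
  let ?K = "closure {x. \<phi> x \<noteq> 0}"
  have K: "compact ?K" using assms by (auto simp: test_functions_def)
  obtain C where C: "C \<ge> 0" "\<And>x. norm (\<phi> x) \<le> C"
    using continuous_zero_outside_compact_bounded[OF _ K, of \<phi>]
      continuous_on_subset[OF test_function_continuous[OF assms] subset_UNIV]
      closure_subset[of "{x. \<phi> x \<noteq> 0}"] by blast
  obtain D where D: "D \<ge> 0" "\<And>x. norm (frechet_derivative \<phi> (at x) h) \<le> D"
    using continuous_zero_outside_compact_bounded[OF _ K, of "\<lambda>x. frechet_derivative \<phi> (at x) h"]
      continuous_on_subset[OF test_function_derivative_continuous[OF assms] subset_UNIV]
      test_function_derivative_zero[OF assms] by metis
  show ?thesis
    using C D by (intro that[of "max C D"]) (auto simp: le_max_iff_disj)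
qed

section \<open>Limits of integrated difference quotients\<close>

lemma borel_measurable_continuous_lebesgue:
  "continuous_on UNIV f \<Longrightarrow> f \<in> borel_measurable lebesgue"
  by (simp add: borel_measurable_continuous_onI measurable_completion)

text \<open>Translations do not preserve a subset, so integrals are moved to the whole space; the
  factor coming from a test function makes the integrand vanish off \<open>S\<close>.\<close>

lemma lebesgue_on_integral:
  fixes f :: "'a::euclidean_space \<Rightarrow> 'b::{banach, second_countable_topology}"
  assumes "S \<in> sets lebesgue" "\<And>x. x \<notin> S \<Longrightarrow> f x = 0"
  shows "integral\<^sup>L (lebesgue_on S) f = integral\<^sup>L lebesgue f"
    and "integrable (lebesgue_on S) f \<longleftrightarrow> integrable lebesgue f"
proof -
  have "(\<lambda>x. indicator S x *\<^sub>R f x) = f"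
    using assms(2) by (auto simp: fun_eq_iff indicator_def)
  then show "integral\<^sup>L (lebesgue_on S) f = integral\<^sup>L lebesgue f"
    and "integrable (lebesgue_on S) f \<longleftrightarrow> integrable lebesgue f"
    using integral_restrict_space[of S lebesgue f] integrable_restrict_space[of S lebesgue f] assms(1)
    by auto
qed

text \<open>Limits at 0 are characterised by sequences, which reduces this to the sequential
  theorem. The majorant is asked for near 0 only, because shifts have to stay small enough to remain
  inside the domain.\<close>

lemma integral_dominated_convergence_at_0:
  fixes s :: "real \<Rightarrow> 'a \<Rightarrow> 'b::{banach, second_countable_topology}" and w :: "'a \<Rightarrow> real"
  assumes "f \<in> borel_measurable M" "\<And>t. s t \<in> borel_measurable M" "integrable M w"
    and lim: "AE x in M. ((\<lambda>t. s t x) \<longlongrightarrow> f x) (at 0)"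
    and bound: "r > 0" "\<And>t x. \<bar>t\<bar> < r \<Longrightarrow> t \<noteq> 0 \<Longrightarrow> x \<in> space M \<Longrightarrow> norm (s t x) \<le> w x"
  shows "((\<lambda>t. integral\<^sup>L M (s t)) \<longlongrightarrow> integral\<^sup>L M f) (at 0)"
  unfolding tendsto_at_iff_sequentially
proof safe
  fix X :: "nat \<Rightarrow> real" assume X: "\<forall>i. X i \<in> UNIV - {0}" "X \<longlonglongrightarrow> 0"
  \<comment> \<open>From N on the sequence stays within the radius where the majorant is valid, so
    the theorem is applied to the shifted sequence.\<close>
  obtain N where N: "\<And>n. n \<ge> N \<Longrightarrow> \<bar>X n\<bar> < r"
    using LIMSEQ_D[OF X(2) bound(1)] by auto
  have "(\<lambda>n. integral\<^sup>L M (s (X (n + N)))) \<longlonglongrightarrow> integral\<^sup>L M f"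
  proof (rule integral_dominated_convergence)
    show "AE x in M. (\<lambda>n. s (X (n + N)) x) \<longlonglongrightarrow> f x"
      using lim
    proof eventually_elim
      case (elim x)
      then have "((\<lambda>t. s t x) \<circ> X) \<longlonglongrightarrow> f x"
        using X unfolding tendsto_at_iff_sequentially by blast
      then show ?case using LIMSEQ_ignore_initial_segment by (fastforce simp: o_def)
    qed
    show "AE x in M. norm (s (X (n + N)) x) \<le> w x" for n
      using X N bound(2) by (intro AE_I2) auto
  qed (use assms in auto)
  then show "((\<lambda>t. integral\<^sup>L M (s t)) \<circ> X) \<longlonglongrightarrow> integral\<^sup>L M f"
    using LIMSEQ_offset by (fastforce simp: o_def)
qed

text \<open>Mean value inequality on a line. The bound concerns the derivative in direction
  \<open>e\<close> alone, so that control of a single partial derivative is enough.\<close>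

lemma directional_lipschitz:
  fixes f :: "'a::real_normed_vector \<Rightarrow> 'b::real_normed_vector"
  assumes "\<And>y. y \<in> closed_segment x (x + h *\<^sub>R e) \<Longrightarrow> (f has_derivative f' y) (at y)"
    and "\<And>y. y \<in> closed_segment x (x + h *\<^sub>R e) \<Longrightarrow> norm (f' y e) \<le> M"
  shows "norm (f (x + h *\<^sub>R e) - f x) \<le> M * \<bar>h\<bar>"
proof -
  let ?g = "\<lambda>t. x + t *\<^sub>R e"
  have in_seg: "?g t \<in> closed_segment x (x + h *\<^sub>R e)" if t: "t \<in> closed_segment 0 h" for t
  proof -
    obtain u where "t = u * h" "0 \<le> u" "u \<le> 1"
      using t by (force simp: in_segment)
    then show ?thesis unfolding in_segment by (intro exI[of _ u]) (auto simp: algebra_simps)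
  qed
  have "norm ((f \<circ> ?g) h - (f \<circ> ?g) 0) \<le> M * norm (h - 0)"
  proof (rule differentiable_bound)
    fix t assume t: "t \<in> closed_segment 0 h"
    have "((f \<circ> ?g) has_derivative (f' (?g t) \<circ> (\<lambda>s. s *\<^sub>R e))) (at t)"
      by (rule diff_chain_at) (use assms(1)[OF in_seg[OF t]] in \<open>auto intro!: derivative_eq_intros\<close>)
    then show "((f \<circ> ?g) has_derivative (\<lambda>s. s *\<^sub>R f' (?g t) e)) (at t within closed_segment 0 h)"
      using linear_scale[OF has_derivative_linear[OF assms(1)[OF in_seg[OF t]]]]
      by (auto simp: o_def intro: has_derivative_at_withinI)
    show "onorm (\<lambda>s. s *\<^sub>R f' (?g t) e) \<le> M"
      using assms(2)[OF in_seg[OF t]] 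
      by (intro onorm_le) (simp add: mult.commute[of M] mult_left_mono)
  qed (auto intro: convex_closed_segment)
  then show ?thesis by simp
qed

lemma has_vector_derivative_difference_quotient:
  fixes f :: "real \<Rightarrow> 'b::real_normed_vector"
  shows "(f has_vector_derivative D) (at t) \<longleftrightarrow>
    ((\<lambda>h. (f (t + h) - f t) /\<^sub>R h) \<longlongrightarrow> D) (at 0)"
proof -
  have "norm (f (t + h) - f t - h *\<^sub>R D) / \<bar>h\<bar> = norm ((f (t + h) - f t) /\<^sub>R h - D)"
    if "h \<noteq> 0" for h
  proof -
    have "(f (t + h) - f t) /\<^sub>R h - D = (f (t + h) - f t - h *\<^sub>R D) /\<^sub>R h"
      using that by (simp add: algebra_simps)
    then show ?thesis by (simp add: divide_inverse mult.commute)
  qed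
  then have "((\<lambda>h. norm (f (t + h) - f t - h *\<^sub>R D) / \<bar>h\<bar>) \<longlongrightarrow> 0) (at 0) \<longleftrightarrow>
    ((\<lambda>h. norm ((f (t + h) - f t) /\<^sub>R h - D)) \<longlongrightarrow> 0) (at 0)"
    by (intro tendsto_cong) (auto simp: eventually_at_filter)
  also have "\<dots> \<longleftrightarrow> ((\<lambda>h. (f (t + h) - f t) /\<^sub>R h) \<longlongrightarrow> D) (at 0)"
    unfolding tendsto_norm_zero_iff by (rule Lim_null[symmetric])
  finally show ?thesis
    unfolding has_vector_derivative_def has_derivative_at real_norm_def diff_diff_eq
    using bounded_linear_scaleR_left by blast
qed

lemma has_derivative_directional:
  assumes "(f has_derivative f') (at x)"
  shows "((\<lambda>h. (f (x + h *\<^sub>R e) - f x) /\<^sub>R h) \<longlongrightarrow> f' e) (at 0)"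
proof -
  have "((f \<circ> (\<lambda>t. x + t *\<^sub>R e)) has_derivative (f' \<circ> (\<lambda>s. s *\<^sub>R e))) (at 0)"
    by (rule diff_chain_at) (use assms in \<open>auto intro!: derivative_eq_intros\<close>)
  then have "((\<lambda>t. f (x + t *\<^sub>R e)) has_vector_derivative f' e) (at 0)"
    using linear_scale[OF has_derivative_linear[OF assms]]
    by (simp add: has_vector_derivative_def o_def)
  then show ?thesis
    unfolding has_vector_derivative_difference_quotient by simp
qed

text \<open>The mean value inequality bounds all difference quotients of \<phi> by the supremum C of
  its directional derivative, so C |u| is a majorant. It serves twice: in integration by parts, and
  when a mollification is differentiated with respect to its centre.\<close>

lemma difference_quotient_integral_tendsto:
  fixes u :: "real^'d \<Rightarrow> complex"
  assumes \<phi>: "\<phi> \<in> test_functions \<Omega>" and u: "integrable lebesgue u"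
  shows "((\<lambda>h. \<integral>x. ((\<phi> (x + h *\<^sub>R e) - \<phi> x) / h) *\<^sub>R u x \<partial>lebesgue) \<longlongrightarrow>
    (\<integral>x. frechet_derivative \<phi> (at x) e *\<^sub>R u x \<partial>lebesgue)) (at 0)"
proof -
  obtain C where C: "C \<ge> 0" "\<And>x. \<bar>frechet_derivative \<phi> (at x) e\<bar> \<le> C"
    using test_function_bounded[OF \<phi>] by metis
  have meas: "u \<in> borel_measurable lebesgue" using u by auto
  show ?thesis
  proof (rule integral_dominated_convergence_at_0)
    show "(\<lambda>x. frechet_derivative \<phi> (at x) e *\<^sub>R u x) \<in> borel_measurable lebesgue"
      by (intro borel_measurable_scaleR meas borel_measurable_continuous_lebesgue
          test_function_derivative_continuous[OF \<phi>])
    have "continuous_on UNIV (\<lambda>x. (\<phi> (x + t *\<^sub>R e) - \<phi> x) / t)" for t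
    proof (cases "t = 0")
      case False
      then show ?thesis
        by (intro continuous_intros continuous_on_compose2[OF test_function_continuous[OF \<phi>]]) auto
    qed simp
    then show "(\<lambda>x. ((\<phi> (x + t *\<^sub>R e) - \<phi> x) / t) *\<^sub>R u x) \<in> borel_measurable lebesgue" for t
      by (intro borel_measurable_scaleR meas borel_measurable_continuous_lebesgue)
    show "integrable lebesgue (\<lambda>x. C * norm (u x))" using u by auto
    show "AE x in lebesgue. ((\<lambda>t. ((\<phi> (x + t *\<^sub>R e) - \<phi> x) / t) *\<^sub>R u x) \<longlongrightarrow>
        frechet_derivative \<phi> (at x) e *\<^sub>R u x) (at 0)"
      using has_derivative_directional[OF test_function_has_derivative[OF \<phi>]]
      by (intro AE_I2 tendsto_intros) (simp add: field_simps)
    show "(0::real) < 1" by simp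
    show "norm (((\<phi> (x + t *\<^sub>R e) - \<phi> x) / t) *\<^sub>R u x) \<le> C * norm (u x)" if "t \<noteq> 0" for t x
    proof -
      have "norm (\<phi> (x + t *\<^sub>R e) - \<phi> x) \<le> C * \<bar>t\<bar>"
        using test_function_has_derivative[OF \<phi>] C(2) by (intro directional_lipschitz) auto
      then have "\<bar>(\<phi> (x + t *\<^sub>R e) - \<phi> x) / t\<bar> \<le> C"
        using that by (simp add: divide_le_eq)
      then have "\<bar>(\<phi> (x + t *\<^sub>R e) - \<phi> x) / t\<bar> * norm (u x) \<le> C * norm (u x)"
        by (rule mult_right_mono) simp
      then show ?thesis by (simp only: norm_scaleR)
    qed
  qed
qed

text \<open>Borel measurability permits the passage from the completed measure to
  \<open>lborel\<close>, where translation invariance is applied.\<close>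

lemma integral_lebesgue_translate:
  fixes f :: "'a::euclidean_space \<Rightarrow> 'b::{banach, second_countable_topology}"
  assumes "f \<in> borel_measurable borel"
  shows "(\<integral>x. f (x + c) \<partial>lebesgue) = (\<integral>x. f x \<partial>lebesgue)"
    and "integrable lebesgue (\<lambda>x. f (x + c)) \<longleftrightarrow> integrable lebesgue f"
proof -
  have [measurable]: "f \<in> borel_measurable lborel" using assms by simp
  have "integral\<^sup>L lborel f = (\<integral>x. f (c + x) \<partial>lborel)"
    by (subst lborel_distr_plus[symmetric, of c]) (simp add: integral_distr)
  moreover have "integrable lborel f \<longleftrightarrow> integrable lborel (\<lambda>x. f (c + x))"
    by (subst lborel_distr_plus[symmetric, of c]) (simp add: integrable_distr_eq)
  ultimately show "(\<integral>x. f (x + c) \<partial>lebesgue) = (\<integral>x. f x \<partial>lebesgue)"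
    and "integrable lebesgue (\<lambda>x. f (x + c)) \<longleftrightarrow> integrable lebesgue f"
    by (simp_all add: integral_completion integrable_completion add.commute)
qed

text \<open>Integration by parts for Lipschitz functions: shift the difference quotient from the test
  function to \<open>v\<close> and pass to the limit on both sides by dominated convergence.\<close>

lemma weak_partial_lipschitz:
  fixes v :: "real^'d \<Rightarrow> complex"
  assumes \<Omega>: "open \<Omega>" and v: "v \<in> borel_measurable borel" "integrable lebesgue v"
    and lip: "\<And>x h. closed_segment x (x + h *\<^sub>R axis j 1) \<subseteq> \<Omega> \<Longrightarrow>
      norm (v (x + h *\<^sub>R axis j 1) - v x) \<le> M * \<bar>h\<bar>"
    and G: "G \<in> borel_measurable (lebesgue_on \<Omega>)"
    and der: "AE x in lebesgue_on \<Omega>.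
      ((\<lambda>h. (v (x + h *\<^sub>R axis j 1) - v x) /\<^sub>R h) \<longlongrightarrow> G x) (at 0)"
  shows "weak_partial \<Omega> j v G"
  unfolding weak_partial_def
proof
  fix \<phi> assume \<phi>: "\<phi> \<in> test_functions \<Omega>"
  let ?e = "axis j 1 :: real^'d"
  let ?K = "closure {x. \<phi> x \<noteq> 0}"
  have \<Omega>_sets: "\<Omega> \<in> sets lebesgue" using \<Omega> by auto
  have v_meas: "v \<in> borel_measurable lebesgue" using v by auto
  have \<phi>_meas: "\<phi> \<in> borel_measurable borel"
    using borel_measurable_continuous_onI[OF test_function_continuous[OF \<phi>]] .
  \<comment> \<open>The margin r keeps every segment of length below r that starts in the support
    inside \<Omega>, which is what \<open>lip\<close> asks for.\<close>
  obtain r where r: "r > 0" "(\<Union>x\<in>?K. cball x r) \<subseteq> \<Omega>"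
    using compact_subset_open_imp_cball_epsilon_subset[of ?K \<Omega>] \<phi> \<Omega>
    by (auto simp: test_functions_def)
  have int_K: "integrable lebesgue (indicator ?K :: real^'d \<Rightarrow> real)"
  proof -
    have "?K \<in> lmeasurable" using \<phi> by (auto simp: test_functions_def intro: lmeasurable_compact)
    then show ?thesis by (simp add: fmeasurable_def integrable_indicator_iff)
  qed
  obtain C where C: "C \<ge> 0" "\<And>x. \<bar>\<phi> x\<bar> \<le> C"
    using test_function_bounded[OF \<phi>] by metis
  have 1: "((\<lambda>h. \<integral>x. ((\<phi> (x + h *\<^sub>R ?e) - \<phi> x) / h) *\<^sub>R v x \<partial>lebesgue) \<longlongrightarrow>
    (\<integral>x. frechet_derivative \<phi> (at x) ?e *\<^sub>R v x \<partial>lebesgue)) (at 0)"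
    by (rule difference_quotient_integral_tendsto[OF \<phi> v(2)])
  \<comment> \<open>Extension by zero makes the limit integrand Lebesgue measurable on the whole
    space.\<close>
  define G' where "G' x = (if x \<in> \<Omega> then G x else 0)" for x
  have G'_meas: "G' \<in> borel_measurable lebesgue"
    unfolding G'_def using G borel_measurable_if[OF \<Omega>_sets] by blast
  have 2: "((\<lambda>h. \<integral>x. \<phi> x *\<^sub>R ((v (x + h *\<^sub>R ?e) - v x) /\<^sub>R h) \<partial>lebesgue) \<longlongrightarrow>
    (\<integral>x. \<phi> x *\<^sub>R G' x \<partial>lebesgue)) (at 0)"
  proof (rule integral_dominated_convergence_at_0)
    show "(\<lambda>x. \<phi> x *\<^sub>R G' x) \<in> borel_measurable lebesgue"
      by (intro borel_measurable_scaleR G'_meas borel_measurable_continuous_lebesgue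
          test_function_continuous[OF \<phi>])
    have "(\<lambda>x. \<phi> x *\<^sub>R ((v (x + t *\<^sub>R ?e) - v x) /\<^sub>R t)) \<in> borel_measurable borel" for t
      using v(1) \<phi>_meas by measurable
    then show "(\<lambda>x. \<phi> x *\<^sub>R ((v (x + t *\<^sub>R ?e) - v x) /\<^sub>R t)) \<in> borel_measurable lebesgue" for t
      by (simp add: measurable_completion)
    show "integrable lebesgue (\<lambda>x. C * (M * indicator ?K x))" using int_K by auto
    have "AE x in lebesgue. x \<in> \<Omega> \<longrightarrow>
        ((\<lambda>h. (v (x + h *\<^sub>R axis j 1) - v x) /\<^sub>R h) \<longlongrightarrow> G x) (at 0)"
      using der \<Omega>_sets by (simp add: AE_restrict_space_iff)
    then show "AE x in lebesgue. ((\<lambda>t. \<phi> x *\<^sub>R ((v (x + t *\<^sub>R ?e) - v x) /\<^sub>R t)) \<longlongrightarrow> \<phi> x *\<^sub>R G' x) (at 0)"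
    proof eventually_elim
      case (elim x)
      then show ?case
        using test_function_zero[OF \<phi>, of x] tendsto_scaleR[OF tendsto_const[of "\<phi> x"], of _ "G x"]
        by (cases "x \<in> \<Omega>") (simp_all add: G'_def del: scaleR_scaleR)
    qed
    show "0 < r" by fact
    show "norm (\<phi> x *\<^sub>R ((v (x + t *\<^sub>R ?e) - v x) /\<^sub>R t)) \<le> C * (M * indicator ?K x)"
      if t: "\<bar>t\<bar> < r" "t \<noteq> 0" for t x
    proof (cases "x \<in> ?K")
      case True
      have "closed_segment x (x + t *\<^sub>R ?e) \<subseteq> cball x r"
        using t r(1) by (intro closed_segment_subset convex_cball) (auto simp: dist_norm)
      then have "closed_segment x (x + t *\<^sub>R ?e) \<subseteq> \<Omega>" using r(2) True by blast
      from lip[OF this] have "norm ((v (x + t *\<^sub>R ?e) - v x) /\<^sub>R t) \<le> M"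
        using t
        by (simp add: divide_inverse[symmetric] pos_divide_le_eq mult.commute[of "inverse _"])
      then have "\<bar>\<phi> x\<bar> * norm ((v (x + t *\<^sub>R ?e) - v x) /\<^sub>R t) \<le> C * M"
        by (intro mult_mono C) auto
      then show ?thesis using True by (simp only: norm_scaleR[of "\<phi> x"] indicator_simps mult_1_right)
    next
      case False
      have "\<phi> x = 0" using False closure_subset[of "{x. \<phi> x \<noteq> 0}"] by blast
      then show ?thesis using False by simp
    qed
  qed
  \<comment> \<open>Discrete integration by parts: translating the first summand by h moves the
    quotient from \<phi> to v, which turns the step - h into h and produces the sign.\<close>
  have 3: "(\<integral>x. ((\<phi> (x + (- h) *\<^sub>R ?e) - \<phi> x) / (- h)) *\<^sub>R v x \<partial>lebesgue)
      = - (\<integral>x. \<phi> x *\<^sub>R ((v (x + h *\<^sub>R ?e) - v x) /\<^sub>R h) \<partial>lebesgue)" if h: "h \<noteq> 0" for h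
  proof -
    have i1: "integrable lebesgue (\<lambda>x. \<phi> x *\<^sub>R v x)"
    proof (rule Bochner_Integration.integrable_bound[of _ "\<lambda>x. C * norm (v x)"])
      show "AE x in lebesgue. norm (\<phi> x *\<^sub>R v x) \<le> norm (C * norm (v x))"
        using C by (intro AE_I2) (auto intro!: mult_right_mono)
      show "(\<lambda>x. \<phi> x *\<^sub>R v x) \<in> borel_measurable lebesgue"
        by (intro borel_measurable_scaleR v_meas borel_measurable_continuous_lebesgue
            test_function_continuous[OF \<phi>])
    qed (use v in auto)
    have B: "(\<lambda>x. \<phi> x *\<^sub>R v (x + h *\<^sub>R ?e)) \<in> borel_measurable borel"
      using \<phi>_meas v(1) by measurable
    have i2: "integrable lebesgue (\<lambda>x. \<phi> x *\<^sub>R v (x + h *\<^sub>R ?e))"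
    proof (rule Bochner_Integration.integrable_bound[of _ "\<lambda>x. C * norm (v (x + h *\<^sub>R ?e))"])
      show "AE x in lebesgue. norm (\<phi> x *\<^sub>R v (x + h *\<^sub>R ?e)) \<le> norm (C * norm (v (x + h *\<^sub>R ?e)))"
        using C by (intro AE_I2) (auto intro!: mult_right_mono)
      show "integrable lebesgue (\<lambda>x. C * norm (v (x + h *\<^sub>R ?e)))"
        using v integral_lebesgue_translate(2)[of v] by auto
    qed (use B in \<open>simp add: measurable_completion\<close>)
    have i3: "integrable lebesgue (\<lambda>x. \<phi> (x + (- h) *\<^sub>R ?e) *\<^sub>R v x)"
      using integral_lebesgue_translate(2)[OF B, of "(- h) *\<^sub>R ?e"] i2 by simp
    have "(\<integral>x. ((\<phi> (x + (- h) *\<^sub>R ?e) - \<phi> x) / (- h)) *\<^sub>R v x \<partial>lebesgue)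
        = (\<integral>x. (1 / (- h)) *\<^sub>R (\<phi> (x + (- h) *\<^sub>R ?e) *\<^sub>R v x - \<phi> x *\<^sub>R v x) \<partial>lebesgue)"
      by (intro Bochner_Integration.integral_cong) (auto simp: algebra_simps diff_divide_distrib)
    also have "\<dots> = (1 / (- h)) *\<^sub>R ((\<integral>x. \<phi> (x + (- h) *\<^sub>R ?e) *\<^sub>R v x \<partial>lebesgue) - (\<integral>x. \<phi> x *\<^sub>R v x \<partial>lebesgue))"
      using i1 i3 by simp
    also have "(\<integral>x. \<phi> (x + (- h) *\<^sub>R ?e) *\<^sub>R v x \<partial>lebesgue) = (\<integral>x. \<phi> x *\<^sub>R v (x + h *\<^sub>R ?e) \<partial>lebesgue)"
      using integral_lebesgue_translate(1)[OF B, of "(- h) *\<^sub>R ?e"] by simp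
    also have "(1 / (- h)) *\<^sub>R (\<dots> - (\<integral>x. \<phi> x *\<^sub>R v x \<partial>lebesgue))
        = - (\<integral>x. (1 / h) *\<^sub>R (\<phi> x *\<^sub>R v (x + h *\<^sub>R ?e) - \<phi> x *\<^sub>R v x) \<partial>lebesgue)"
      using i1 i2 by simp
    also have "\<dots> = - (\<integral>x. \<phi> x *\<^sub>R ((v (x + h *\<^sub>R ?e) - v x) /\<^sub>R h) \<partial>lebesgue)"
      by (intro arg_cong[of _ _ uminus] Bochner_Integration.integral_cong)
         (auto simp: algebra_simps divide_inverse)
    finally show ?thesis .
  qed
  have "((\<lambda>h. - (\<integral>x. \<phi> x *\<^sub>R ((v (x + h *\<^sub>R ?e) - v x) /\<^sub>R h) \<partial>lebesgue)) \<longlongrightarrow>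
    (\<integral>x. frechet_derivative \<phi> (at x) ?e *\<^sub>R v x \<partial>lebesgue)) (at 0)"
  proof (rule Lim_transform_eventually)
    show "((\<lambda>h. \<integral>x. ((\<phi> (x + (- h) *\<^sub>R ?e) - \<phi> x) / (- h)) *\<^sub>R v x \<partial>lebesgue) \<longlongrightarrow>
      (\<integral>x. frechet_derivative \<phi> (at x) ?e *\<^sub>R v x \<partial>lebesgue)) (at 0)"
      by (rule filterlim_compose[OF 1]) (auto simp: filterlim_at eventually_at_filter intro!: tendsto_eq_intros)
  qed (use 3 in \<open>auto simp: eventually_at_filter\<close>)
  from tendsto_unique[OF _ this tendsto_minus[OF 2]]
  have "(\<integral>x. frechet_derivative \<phi> (at x) ?e *\<^sub>R v x \<partial>lebesgue) = - (\<integral>x. \<phi> x *\<^sub>R G' x \<partial>lebesgue)"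
    by simp
  moreover have "(\<integral>x. \<phi> x *\<^sub>R G x \<partial>lebesgue_on \<Omega>) = (\<integral>x. \<phi> x *\<^sub>R G' x \<partial>lebesgue_on \<Omega>)"
    by (intro Bochner_Integration.integral_cong) (auto simp: G'_def)
  ultimately show "(\<integral>x. frechet_derivative \<phi> (at x) ?e *\<^sub>R v x \<partial>lebesgue_on \<Omega>)
      = - (\<integral>x. \<phi> x *\<^sub>R G x \<partial>lebesgue_on \<Omega>)"
    using lebesgue_on_integral(1)[OF \<Omega>_sets, of "\<lambda>x. \<phi> x *\<^sub>R G' x"]
      lebesgue_on_integral(1)[OF \<Omega>_sets, of "\<lambda>x. frechet_derivative \<phi> (at x) ?e *\<^sub>R v x"]
      test_function_zero[OF \<phi>] test_function_derivative_zero'[OF \<phi>] by simp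
qed

text \<open>Bumps converging to the indicator of a box show that f has integral zero over every
  closed box inside \<Omega>; Lebesgue differentiation over shrinking cubes then forces f x = 0 at
  almost every x.\<close>

lemma fundamental_lemma:
  fixes f :: "real^'d \<Rightarrow> complex"
  assumes \<Omega>: "open \<Omega>" and f: "integrable (lebesgue_on \<Omega>) f"
    and zero: "\<And>\<phi>. \<phi> \<in> test_functions \<Omega> \<Longrightarrow> (\<integral>x. \<phi> x *\<^sub>R f x \<partial>lebesgue_on \<Omega>) = 0"
  shows "AE x in lebesgue_on \<Omega>. f x = 0"
proof -
  have \<Omega>_sets: "\<Omega> \<in> sets lebesgue" using \<Omega> by auto
  define F where "F x = indicator \<Omega> x *\<^sub>R f x" for x
  have F: "integrable lebesgue F"
    unfolding F_def using f integrable_restrict_space[of \<Omega> lebesgue f] \<Omega>_sets by simp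
  have F_on: "F integrable_on S" if "S \<in> sets lebesgue" for S
  proof -
    have "integrable (lebesgue_on S) F"
      using integrable_restrict_space[of S lebesgue F] F that
      by (simp add: integrable_mult_indicator)
    then show ?thesis using that by (rule integrable_on_lebesgue_on)
  qed
  have box0: "integral (cbox a b) F = 0" if ab: "cbox a b \<subseteq> \<Omega>" for a b
  proof -
    have "(\<lambda>k. \<integral>x. box_bump a b k x *\<^sub>R F x \<partial>lebesgue) \<longlonglongrightarrow> (\<integral>x. indicator (box a b) x *\<^sub>R F x \<partial>lebesgue)"
    proof (rule integral_dominated_convergence)
      show "integrable lebesgue (\<lambda>x. norm (F x))" using F by auto
      show "(\<lambda>x. box_bump a b k x *\<^sub>R F x) \<in> borel_measurable lebesgue" for k
        using F by (intro borel_measurable_scaleR borel_measurable_continuous_lebesgue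
            Ck_continuous[OF Ck_box_bump] borel_measurable_integrable)
      show "(\<lambda>x. indicator (box a b) x *\<^sub>R F x) \<in> borel_measurable lebesgue"
        using F by (intro borel_measurable_scaleR borel_measurable_indicator) auto
      show "AE x in lebesgue. (\<lambda>k. box_bump a b k x *\<^sub>R F x) \<longlonglongrightarrow> indicator (box a b) x *\<^sub>R F x"
        by (intro AE_I2 tendsto_scaleR box_bump_tendsto tendsto_const)
      show "AE x in lebesgue. norm (box_bump a b k x *\<^sub>R F x) \<le> norm (F x)" for k
        by (intro AE_I2) (simp add: box_bump_bounds mult_left_le_one_le)
    qed
    moreover have "(\<integral>x. box_bump a b k x *\<^sub>R F x \<partial>lebesgue) = 0" for k
    proof -
      have "(\<integral>x. box_bump a b k x *\<^sub>R F x \<partial>lebesgue)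
          = (\<integral>x. indicator \<Omega> x *\<^sub>R (box_bump a b k x *\<^sub>R f x) \<partial>lebesgue)"
        by (simp add: F_def mult.commute)
      also have "\<dots> = (\<integral>x. box_bump a b k x *\<^sub>R f x \<partial>lebesgue_on \<Omega>)"
        using integral_restrict_space[of \<Omega> lebesgue "\<lambda>x. box_bump a b k x *\<^sub>R f x"] \<Omega>_sets by simp
      also have "\<dots> = 0" by (rule zero[OF test_functions_box_bump[OF ab]])
      finally show ?thesis .
    qed
    ultimately have "(\<integral>x. indicator (box a b) x *\<^sub>R F x \<partial>lebesgue) = 0"
      using LIMSEQ_unique[OF _ tendsto_const] by simp
    then have "integral\<^sup>L (lebesgue_on (box a b)) F = 0"
      using integral_restrict_space[of "box a b" lebesgue F] by simp
    moreover have "integrable (lebesgue_on (box a b)) F"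
      using integrable_restrict_space[of "box a b" lebesgue F] F by (simp add: integrable_mult_indicator)
    ultimately have "integral (box a b) F = 0"
      using lebesgue_integral_eq_integral[of "box a b" F] by simp
    then show ?thesis by (simp add: integral_open_interval)
  qed
  \<comment> \<open>Lebesgue differentiation along cubes that have x as their lower corner.\<close>
  obtain N where N: "negligible N" "\<And>x e. x \<notin> N \<Longrightarrow> 0 < e \<Longrightarrow> \<exists>d>0. \<forall>h. 0 < h \<and> h < d \<longrightarrow>
      norm (integral (cbox x (x + h *\<^sub>R One)) F /\<^sub>R h ^ DIM(real^'d) - F x) < e"
    using integrable_ccontinuous_explicit[of F] F_on by (metis lmeasurable_cbox fmeasurableD)
  have "F x = 0" if x: "x \<in> \<Omega>" "x \<notin> N" for x
  proof (rule ccontr)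
    assume "F x \<noteq> 0"
    \<comment> \<open>The tolerance |F x| suffices: once the cube integral is zero, the estimate
      reads |F x| < |F x|.\<close>
    then obtain d where d: "d > 0" "\<And>h. 0 < h \<and> h < d \<Longrightarrow>
      norm (integral (cbox x (x + h *\<^sub>R One)) F /\<^sub>R h ^ DIM(real^'d) - F x) < norm (F x)"
      using N(2)[OF x(2), of "norm (F x)"] by auto
    obtain r where r: "r > 0" "ball x r \<subseteq> \<Omega>" using x \<Omega> open_contains_ball by blast
    \<comment> \<open>Halving makes both inequalities strict: h stays below d, and the cube, whose
      diagonal is h times the norm of \<open>One\<close>, stays inside the ball of radius r.\<close>
    define h where "h = min (d / 2) (r / 2 / (norm (One :: real^'d)))"
    have n1: "norm (One :: real^'d) > 0" by (simp add: norm_Basis)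
    have h: "0 < h" "h < d" "h * norm (One :: real^'d) < r"
    proof -
      show "0 < h" "h < d" using d r n1 by (auto simp: h_def)
      have "h \<le> r / 2 / norm (One :: real^'d)" by (simp add: h_def)
      then have "h * norm (One :: real^'d) \<le> r / 2" using n1 by (simp add: field_simps)
      then show "h * norm (One :: real^'d) < r" using r by simp
    qed
    have "cbox x (x + h *\<^sub>R One) \<subseteq> ball x r"
    proof
      fix y assume "y \<in> cbox x (x + h *\<^sub>R One)"
      then have y: "\<And>i. i \<in> Basis \<Longrightarrow> x \<bullet> i \<le> y \<bullet> i \<and> y \<bullet> i \<le> x \<bullet> i + h"
        by (auto simp: mem_box inner_add_left)
      have "norm (y - x) \<le> norm (h *\<^sub>R (One :: real^'d))"
      proof (rule norm_le_componentwise)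
        fix i :: "real^'d" assume i: "i \<in> Basis"
        show "\<bar>(y - x) \<bullet> i\<bar> \<le> \<bar>h *\<^sub>R One \<bullet> i\<bar>"
          using y[OF i] i h(1) by (simp add: inner_diff_left)
      qed
      also have "\<dots> < r" using h by simp
      finally show "y \<in> ball x r" by (simp add: dist_norm norm_minus_commute)
    qed
    then have "integral (cbox x (x + h *\<^sub>R One)) F = 0" using r box0 by blast
    then show False using d(2)[of h] h by simp
  qed
  then have "\<And>x. x \<in> \<Omega> \<Longrightarrow> x \<notin> N \<Longrightarrow> f x = 0" by (auto simp: F_def)
  moreover have "AE x in lebesgue. x \<notin> N"
    using N(1) by (simp add: negligible_iff_null_sets AE_not_in)
  ultimately show ?thesis
    using \<Omega>_sets by (auto simp: AE_restrict_space_iff elim!: eventually_mono)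
qed

section \<open>Mollification along a segment\<close>

lemma test_function_translate:
  assumes "\<phi> \<in> test_functions \<Omega>" "\<And>x. \<phi> x \<noteq> 0 \<Longrightarrow> x - c \<in> K" "compact K" "K \<subseteq> \<Omega>'"
  shows "(\<lambda>x. \<phi> (x + c)) \<in> test_functions \<Omega>'"
proof -
  have "Ck k \<psi> \<Longrightarrow> Ck k (\<lambda>x. \<psi> (x + c))" for k and \<psi> :: "'a \<Rightarrow> real"
  proof (induction k arbitrary: \<psi>)
    case 0
    then show ?case by (auto intro!: continuous_intros continuous_on_compose2[of UNIV \<psi>])
  next
    case (Suc k)
    show ?case
    proof (rule Ck_Suc_intro)
      have "((\<psi> \<circ> (\<lambda>x. x + c)) has_derivative (frechet_derivative \<psi> (at (x + c)) \<circ> (\<lambda>h. h))) (at x)" for x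
        by (rule diff_chain_at) (use Ck_Suc_has_derivative[OF Suc.prems] in \<open>auto intro!: derivative_eq_intros\<close>)
      then show "((\<lambda>x. \<psi> (x + c)) has_derivative frechet_derivative \<psi> (at (x + c))) (at x)" for x
        by (simp add: o_def)
    qed (use Suc in auto)
  qed
  moreover have "closure {x. \<phi> (x + c) \<noteq> 0} \<subseteq> K"
    using assms(2)[of "x + c" for x] assms(3) by (intro closure_minimal) (auto intro: compact_imp_closed)
  moreover from this have "compact (closure {x. \<phi> (x + c) \<noteq> 0})"
    using compact_Int_closed[OF assms(3) closed_closure] by (metis inf.absorb2)
  ultimately show ?thesis
    using assms unfolding test_functions_def by blast
qed

text \<open>The mollification of \<open>u\<close> along the segment has the mollified weak derivative as its
  derivative, so it satisfies the bound by the mean value inequality; shrinking the support of the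
  mollifier transfers the bound to the continuous function \<open>u\<close>.\<close>

lemma lipschitz_of_bounded_weak_partial:
  fixes u :: "real^'d \<Rightarrow> complex"
  assumes \<Omega>: "open \<Omega>" and u: "u \<in> borel_measurable borel" "integrable lebesgue u" "continuous_on \<Omega> u"
    and weak: "weak_partial \<Omega> j u g"
    and g: "integrable (lebesgue_on \<Omega>) g" "AE x in lebesgue_on \<Omega>. norm (g x) \<le> M"
    and seg: "closed_segment x (x + h *\<^sub>R axis j 1) \<subseteq> \<Omega>"
  shows "norm (u (x + h *\<^sub>R axis j 1) - u x) \<le> M * \<bar>h\<bar>"
proof (rule field_le_epsilon)
  fix \<epsilon> :: real assume "\<epsilon> > 0"
  let ?e = "axis j 1 :: real^'d"
  let ?S = "closed_segment x (x + h *\<^sub>R ?e)"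
  have \<Omega>_sets: "\<Omega> \<in> sets lebesgue" using \<Omega> by auto
  obtain r where r: "r > 0" "(\<Union>y\<in>?S. cball y r) \<subseteq> \<Omega>"
    using compact_subset_open_imp_cball_epsilon_subset[OF compact_segment \<Omega> seg] by blast
  have ends: "x \<in> ?S" "x + h *\<^sub>R ?e \<in> ?S" by auto
  have "\<exists>d>0. \<forall>z. norm z < d \<longrightarrow> norm (u (y + z) - u y) < \<epsilon> / 2" if "y \<in> ?S" for y
  proof -
    have "isCont u y" using u(3) \<Omega> that seg continuous_on_eq_continuous_at by blast
    then obtain d where "d > 0" "\<And>y'. dist y' y < d \<Longrightarrow> dist (u y') (u y) < \<epsilon> / 2"
      using \<open>\<epsilon> > 0\<close> unfolding continuous_at_eps_delta by (metis half_gt_zero)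
    then show ?thesis by (intro exI[of _ d]) (auto simp: dist_norm)
  qed
  then obtain d1 d2 where d: "d1 > 0" "d2 > 0"
    "\<And>z. norm z < d1 \<Longrightarrow> norm (u (x + z) - u x) < \<epsilon> / 2"
    "\<And>z. norm z < d2 \<Longrightarrow> norm (u (x + h *\<^sub>R ?e + z) - u (x + h *\<^sub>R ?e)) < \<epsilon> / 2"
    using ends by metis
  \<comment> \<open>Below r, a mollifier centred on the segment is supported inside \<Omega>; below
    d1 and d2, u varies by less than \<epsilon>/2 over its support at the two ends.\<close>
  define \<delta> where "\<delta> = Min {r, d1, d2} / 2"
  have \<delta>: "\<delta> > 0" "\<delta> < r" "\<delta> < d1" "\<delta> < d2" using r d by (auto simp: \<delta>_def)
  obtain a b :: "real^'d" where ab: "0 \<in> box a b" "cbox a b \<subseteq> cball 0 \<delta>"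
  proof -
    obtain a b :: "real^'d" where ab: "0 \<in> box a b" "box a b \<subseteq> ball 0 \<delta>"
      using rational_boxes[OF \<delta>(1), of "0::real^'d"] by blast
    then have "closure (box a b) \<subseteq> cball 0 \<delta>"
      by (intro closure_minimal) (auto intro: order_trans ball_subset_cball)
    then show ?thesis using that ab closure_box[of a b] by (metis empty_iff)
  qed
  \<comment> \<open>Not normalised: the positive integral of \<rho> is carried along as a common
    factor and cancelled in the last step.\<close>
  define \<rho> where "\<rho> = box_bump a b 1"
  have \<rho>_test: "\<rho> \<in> test_functions UNIV"
    unfolding \<rho>_def by (rule test_functions_box_bump) simp
  have \<rho>_supp: "norm z \<le> \<delta>" if "\<rho> z \<noteq> 0" for z
    using that box_bump_support[of a b 1] ab(2) by (auto simp: \<rho>_def)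
  have \<rho>_nn: "\<rho> z \<ge> 0" "\<rho> z \<le> 1" for z by (simp_all add: \<rho>_def box_bump_bounds)
  have \<rho>_cont: "continuous_on UNIV \<rho>" by (rule test_function_continuous[OF \<rho>_test])
  have \<rho>_meas: "\<rho> \<in> borel_measurable borel" by (rule borel_measurable_continuous_onI[OF \<rho>_cont])
  have \<rho>_int: "integrable lebesgue \<rho>"
  proof (rule Bochner_Integration.integrable_bound[of _ "indicator (cbox a b)"])
    show "integrable lebesgue (indicator (cbox a b) :: real^'d \<Rightarrow> real)"
      by (simp add: integrable_indicator_iff emeasure_lborel_cbox_eq)
    show "AE z in lebesgue. norm (\<rho> z) \<le> norm (indicator (cbox a b) z :: real)"
    proof (intro AE_I2)
      fix z
      show "norm (\<rho> z) \<le> norm (indicator (cbox a b) z :: real)"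
        using box_bump_support[of a b 1] \<rho>_nn[of z] by (cases "\<rho> z = 0") (auto simp: \<rho>_def)
    qed
  qed (rule borel_measurable_continuous_lebesgue[OF \<rho>_cont])
  have \<rho>_pos: "(\<integral>z. \<rho> z \<partial>lebesgue) > 0"
  proof -
    have "(\<integral>z. \<rho> z \<partial>lebesgue) \<noteq> 0"
    proof
      assume "(\<integral>z. \<rho> z \<partial>lebesgue) = 0"
      then have "AE z in lebesgue. \<rho> z = 0"
        using integral_nonneg_eq_0_iff_AE[OF \<rho>_int] \<rho>_nn by auto
      \<comment> \<open>A closed set containing almost all of an open set contains all of it. With
        the empty set as the closed set, the point 0 of the box gives the contradiction.\<close>
      then have "AE z in lebesgue. z \<in> box a b \<longrightarrow> z \<in> {}"
        
      proof eventually_elim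
        case (elim z)
        then show ?case using box_bump_pos[of 1 a b z] by (simp add: \<rho>_def)
      qed
      then have "0 \<in> ({} :: (real^'d) set)"
        by (rule mem_closed_if_AE_lebesgue_open[rotated 2]) (use ab in auto)
      then show False by simp
    qed
    moreover have "(\<integral>z. \<rho> z \<partial>lebesgue) \<ge> 0" using \<rho>_nn by (intro Bochner_Integration.integral_nonneg) auto
    ultimately show ?thesis by linarith
  qed
  \<comment> \<open>The index t is the position of the centre on the line, so f is a function of one
    real variable and f' its expected derivative.\<close>
  define \<rho>t where "\<rho>t t y = \<rho> (y - (x + t *\<^sub>R ?e))" for t y
  define f where "f t = (\<integral>y. \<rho>t t y *\<^sub>R u y \<partial>lebesgue)" for t
  define f' where "f' t = (\<integral>y. \<rho>t t y *\<^sub>R g y \<partial>lebesgue_on \<Omega>)" for t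
  have on_seg: "x + t *\<^sub>R ?e \<in> ?S" if t: "t \<in> closed_segment 0 h" for t
  proof -
    obtain c where "t = c * h" "0 \<le> c" "c \<le> 1" using t by (force simp: in_segment)
    then show ?thesis unfolding in_segment by (intro exI[of _ c]) (auto simp: algebra_simps)
  qed
  have \<rho>t_test: "\<rho>t t \<in> test_functions \<Omega>" if t: "t \<in> closed_segment 0 h" for t
  proof -
    have "(\<lambda>y. \<rho> (y + - (x + t *\<^sub>R ?e))) \<in> test_functions \<Omega>"
    proof (rule test_function_translate[OF \<rho>_test])
      show "z - - (x + t *\<^sub>R ?e) \<in> cball (x + t *\<^sub>R ?e) \<delta>" if "\<rho> z \<noteq> 0" for z
        using \<rho>_supp[OF that] by (simp add: dist_norm)
      have "cball (x + t *\<^sub>R ?e) \<delta> \<subseteq> cball (x + t *\<^sub>R ?e) r" using \<delta> by auto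
      then show "cball (x + t *\<^sub>R ?e) \<delta> \<subseteq> \<Omega>" using r on_seg[OF t] by blast
    qed simp
    then show ?thesis by (simp only: \<rho>t_def[abs_def] add_uminus_conv_diff)
  qed
  have f_deriv: "(f has_vector_derivative f' t) (at t)" if t: "t \<in> closed_segment 0 h" for t
  proof -
    \<comment> \<open>Moving the centre by s e amounts to shifting the argument by - s e, which
      gives one minus sign; the definition of the weak derivative gives the other.\<close>
    have "((\<lambda>s. \<integral>y. ((\<rho>t t (y + s *\<^sub>R ?e) - \<rho>t t y) / s) *\<^sub>R u y \<partial>lebesgue) \<longlongrightarrow>
      (\<integral>y. frechet_derivative (\<rho>t t) (at y) ?e *\<^sub>R u y \<partial>lebesgue)) (at 0)"
      by (rule difference_quotient_integral_tendsto[OF \<rho>t_test[OF t] u(2)])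
    moreover have "(\<integral>y. frechet_derivative (\<rho>t t) (at y) ?e *\<^sub>R u y \<partial>lebesgue) = - f' t"
      using weak \<rho>t_test[OF t] lebesgue_on_integral(1)[OF \<Omega>_sets,
          of "\<lambda>y. frechet_derivative (\<rho>t t) (at y) ?e *\<^sub>R u y"]
        test_function_derivative_zero'[OF \<rho>t_test[OF t]]
      unfolding weak_partial_def f'_def by simp
    ultimately have "((\<lambda>s. \<integral>y. ((\<rho>t t (y + s *\<^sub>R ?e) - \<rho>t t y) / s) *\<^sub>R u y \<partial>lebesgue) \<longlongrightarrow> - f' t) (at 0)"
      by simp
    then have "((\<lambda>s. \<integral>y. ((\<rho>t t (y + (- s) *\<^sub>R ?e) - \<rho>t t y) / (- s)) *\<^sub>R u y \<partial>lebesgue) \<longlongrightarrow> - f' t) (at 0)"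
      by (rule filterlim_compose) (auto simp: filterlim_at eventually_at_filter intro!: tendsto_eq_intros)
    then have *: "((\<lambda>s. - (\<integral>y. ((\<rho>t t (y + (- s) *\<^sub>R ?e) - \<rho>t t y) / (- s)) *\<^sub>R u y \<partial>lebesgue)) \<longlongrightarrow> f' t) (at 0)"
      using tendsto_minus by fastforce
    have int: "integrable lebesgue (\<lambda>y. \<rho>t s y *\<^sub>R u y)" for s
    proof (rule Bochner_Integration.integrable_bound[of _ u])
      show "AE y in lebesgue. norm (\<rho>t s y *\<^sub>R u y) \<le> norm (u y)"
        by (intro AE_I2) (simp add: \<rho>t_def \<rho>_nn mult_left_le_one_le)
      have "continuous_on UNIV (\<rho>t s)"
        unfolding \<rho>t_def by (intro continuous_on_compose2[OF \<rho>_cont] continuous_intros) auto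
      then show "(\<lambda>y. \<rho>t s y *\<^sub>R u y) \<in> borel_measurable lebesgue"
        by (intro borel_measurable_scaleR borel_measurable_continuous_lebesgue
            borel_measurable_integrable[OF u(2)])
    qed (rule u(2))
    have "- (\<integral>y. ((\<rho>t t (y + (- s) *\<^sub>R ?e) - \<rho>t t y) / (- s)) *\<^sub>R u y \<partial>lebesgue) = (f (t + s) - f t) /\<^sub>R s"
      for s
    proof -
      have "(f (t + s) - f t) /\<^sub>R s = (1 / s) *\<^sub>R (\<integral>y. \<rho>t (t + s) y *\<^sub>R u y - \<rho>t t y *\<^sub>R u y \<partial>lebesgue)"
        unfolding f_def using int by (simp add: divide_inverse)
      also have "\<dots> = (\<integral>y. (1 / s) *\<^sub>R (\<rho>t (t + s) y *\<^sub>R u y - \<rho>t t y *\<^sub>R u y) \<partial>lebesgue)" by simp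
      also have "\<dots> = (\<integral>y. - (((\<rho>t t (y + (- s) *\<^sub>R ?e) - \<rho>t t y) / (- s)) *\<^sub>R u y) \<partial>lebesgue)"
        by (intro Bochner_Integration.integral_cong)
           (auto simp: \<rho>t_def algebra_simps diff_divide_distrib)
      finally show ?thesis by simp
    qed
    then have "((\<lambda>s. (f (t + s) - f t) /\<^sub>R s) \<longlongrightarrow> f' t) (at 0)" using * by simp
    then show ?thesis
      by (simp add: has_vector_derivative_difference_quotient)
  qed
  have f'_bound: "norm (f' t) \<le> M * (\<integral>z. \<rho> z \<partial>lebesgue)" if t: "t \<in> closed_segment 0 h" for t
  proof -
    have int: "integrable lebesgue (\<rho>t t)"
      using integral_lebesgue_translate(2)[OF \<rho>_meas, of "- (x + t *\<^sub>R ?e)",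
          unfolded add_uminus_conv_diff] \<rho>_int
      by (simp add: \<rho>t_def[abs_def])
    have int_on: "integrable (lebesgue_on \<Omega>) (\<rho>t t)"
      using lebesgue_on_integral(2)[OF \<Omega>_sets] test_function_zero[OF \<rho>t_test[OF t]] int by metis
    have ae: "AE y in lebesgue_on \<Omega>. norm (\<rho>t t y *\<^sub>R g y) \<le> M * \<rho>t t y"
      using g(2)
    proof eventually_elim
      case (elim y)
      then show ?case
        using mult_left_mono[OF elim, of "\<rho>t t y"] by (simp add: \<rho>t_def \<rho>_nn mult.commute[of M])
    qed
    have "norm (f' t) \<le> (\<integral>y. norm (\<rho>t t y *\<^sub>R g y) \<partial>lebesgue_on \<Omega>)"
      unfolding f'_def by (rule integral_norm_bound)
    also have "\<dots> \<le> (\<integral>y. M * \<rho>t t y \<partial>lebesgue_on \<Omega>)"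
    proof (rule integral_mono_AE'[OF _ ae])
      show "AE y in lebesgue_on \<Omega>. 0 \<le> M * \<rho>t t y"
        using ae by eventually_elim (rule order_trans[OF norm_ge_zero])
    qed (use int_on in auto)
    also have "\<dots> = M * (\<integral>y. \<rho>t t y \<partial>lebesgue)"
      using lebesgue_on_integral(1)[OF \<Omega>_sets, of "\<rho>t t"] test_function_zero[OF \<rho>t_test[OF t]] by simp
    also have "(\<integral>y. \<rho>t t y \<partial>lebesgue) = (\<integral>z. \<rho> z \<partial>lebesgue)"
      using integral_lebesgue_translate(1)[OF \<rho>_meas, of "- (x + t *\<^sub>R ?e)",
          unfolded add_uminus_conv_diff]
      by (simp add: \<rho>t_def[abs_def])
    finally show ?thesis .
  qed
  have mv: "norm (f h - f 0) \<le> M * (\<integral>z. \<rho> z \<partial>lebesgue) * \<bar>h\<bar>"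
  proof -
    have "norm (f (0 + h *\<^sub>R 1) - f 0) \<le> M * (\<integral>z. \<rho> z \<partial>lebesgue) * \<bar>h\<bar>"
      using f_deriv f'_bound
      by (intro directional_lipschitz[where f' = "\<lambda>t s. s *\<^sub>R f' t"])
         (auto simp: has_vector_derivative_def)
    then show ?thesis by simp
  qed
  have close: "norm (f t - (\<integral>z. \<rho> z \<partial>lebesgue) *\<^sub>R u y) \<le> \<epsilon> / 2 * (\<integral>z. \<rho> z \<partial>lebesgue)"
    if y: "y = x + t *\<^sub>R ?e" and near: "\<And>z. norm z \<le> \<delta> \<Longrightarrow> norm (u (y + z) - u y) < \<epsilon> / 2" for t y
  proof -
    have B: "(\<lambda>z. \<rho> (z - y) *\<^sub>R u z) \<in> borel_measurable borel" using \<rho>_meas u(1) by measurable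
    have "f t = (\<integral>z. \<rho> (z - y) *\<^sub>R u z \<partial>lebesgue)" by (simp add: f_def \<rho>t_def y)
    also have "\<dots> = (\<integral>z. \<rho> z *\<^sub>R u (z + y) \<partial>lebesgue)"
      using integral_lebesgue_translate(1)[OF B, of y] by simp
    finally have ft: "f t = (\<integral>z. \<rho> z *\<^sub>R u (z + y) \<partial>lebesgue)" .
    have ci: "integrable lebesgue (\<lambda>z. \<rho> z *\<^sub>R u y)" using \<rho>_int by simp
    have tm: "(\<lambda>z. u (z + y)) \<in> borel_measurable lebesgue"
      using measurable_compose[of "\<lambda>z. z + y" borel borel u borel] u(1) by (simp add: measurable_completion)
    have ui: "integrable lebesgue (\<lambda>z. \<rho> z *\<^sub>R u (z + y))"
    proof (rule Bochner_Integration.integrable_bound[of _ "\<lambda>z. u (z + y)"])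
      show "integrable lebesgue (\<lambda>z. u (z + y))" using integral_lebesgue_translate(2)[OF u(1)] u(2) by simp
      show "AE z in lebesgue. norm (\<rho> z *\<^sub>R u (z + y)) \<le> norm (u (z + y))"
        by (intro AE_I2) (simp add: \<rho>_nn mult_left_le_one_le)
    qed (intro borel_measurable_scaleR borel_measurable_continuous_lebesgue[OF \<rho>_cont] tm)
    have "f t - (\<integral>z. \<rho> z \<partial>lebesgue) *\<^sub>R u y = (\<integral>z. \<rho> z *\<^sub>R u (z + y) - \<rho> z *\<^sub>R u y \<partial>lebesgue)"
      unfolding ft using ci ui \<rho>_int by (subst Bochner_Integration.integral_diff) auto
    also have "norm \<dots> \<le> (\<integral>z. \<epsilon> / 2 * \<rho> z \<partial>lebesgue)"
    proof (rule Bochner_Integration.integral_norm_bound_integral)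
      show "norm (\<rho> z *\<^sub>R u (z + y) - \<rho> z *\<^sub>R u y) \<le> \<epsilon> / 2 * \<rho> z" for z
      proof (cases "\<rho> z = 0")
        case False
        have "norm (\<rho> z *\<^sub>R u (z + y) - \<rho> z *\<^sub>R u y) = \<rho> z * norm (u (y + z) - u y)"
          by (simp add: scaleR_diff_right[symmetric] \<rho>_nn add.commute)
        also have "\<dots> \<le> \<rho> z * (\<epsilon> / 2)"
          using near[OF \<rho>_supp[OF False]] \<rho>_nn by (intro mult_left_mono) auto
        finally show ?thesis by (simp add: mult.commute)
      qed simp
    qed (use ci ui \<rho>_int in auto)
    finally show ?thesis by simp
  qed
  let ?I = "\<integral>z. \<rho> z \<partial>lebesgue"
  have "?I * norm (u (x + h *\<^sub>R ?e) - u x) = norm (?I *\<^sub>R (u (x + h *\<^sub>R ?e) - u x))"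
    using \<rho>_pos by simp
  also have "\<dots> = norm ((f h - f 0) - (f h - ?I *\<^sub>R u (x + h *\<^sub>R ?e)) + (f 0 - ?I *\<^sub>R u x))"
    by (simp add: algebra_simps)
  also have "\<dots> \<le> norm (f h - f 0) + norm (f h - ?I *\<^sub>R u (x + h *\<^sub>R ?e)) + norm (f 0 - ?I *\<^sub>R u x)"
    by (meson norm_triangle_ineq norm_triangle_ineq4 add_right_mono order_trans)
  also have "\<dots> \<le> M * ?I * \<bar>h\<bar> + \<epsilon> / 2 * ?I + \<epsilon> / 2 * ?I"
    using \<delta> d by (intro add_mono mv close) auto
  also have "\<dots> = ?I * (M * \<bar>h\<bar> + \<epsilon>)" by (simp add: algebra_simps)
  finally have "?I * norm (u (x + h *\<^sub>R ?e) - u x) \<le> ?I * (M * \<bar>h\<bar> + \<epsilon>)" .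
  then show "norm (u (x + h *\<^sub>R ?e) - u x) \<le> M * \<bar>h\<bar> + \<epsilon>"
    using \<rho>_pos by simp
qed

section \<open>Piecewise polynomial fields\<close>

lemma polynomial_le_C1:
  assumes "polynomial_le p q"
  obtains q' where "\<And>x. (q has_derivative q' x) (at x)" "\<And>h. continuous_on UNIV (\<lambda>x. q' x h)"
proof -
  let ?S = "{\<gamma>. (\<Sum>i\<in>(UNIV::'a set). \<gamma> i) \<le> p}"
  obtain c where q: "\<And>x. q x = (\<Sum>\<gamma>\<in>?S. c \<gamma> * of_real (\<Prod>i\<in>UNIV. (x $ i) ^ \<gamma> i))"
    using assms unfolding polynomial_le_def by blast
  define mon :: "('a \<Rightarrow> nat) \<Rightarrow> real^'a \<Rightarrow> real" where "mon \<gamma> x = (\<Prod>i\<in>UNIV. (x $ i) ^ \<gamma> i)" for \<gamma> x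
  have mon: "Ck (Suc 0) (mon \<gamma>)" for \<gamma>
    unfolding mon_def[abs_def] by (intro Ck_prod Ck_power Ck_vec_nth)
  define q' where "q' x h = (\<Sum>\<gamma>\<in>?S. c \<gamma> * of_real (frechet_derivative (mon \<gamma>) (at x) h))" for x h
  have "(q has_derivative q' x) (at x)" for x
  proof -
    have "((\<lambda>x. \<Sum>\<gamma>\<in>?S. c \<gamma> * of_real (mon \<gamma> x)) has_derivative q' x) (at x)"
      unfolding q'_def[abs_def]
      by (intro has_derivative_sum has_derivative_mult_right has_derivative_of_real
          Ck_Suc_has_derivative[OF mon])
    then show ?thesis by (simp add: q[abs_def] mon_def)
  qed
  moreover have "continuous_on UNIV (\<lambda>x. q' x h)" for h
    unfolding q'_def using mon by (intro continuous_intros) simp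
  ultimately show ?thesis by (rule that)
qed

lemma polynomial_le_zero: "polynomial_le p (\<lambda>x. 0)"
  unfolding polynomial_le_def by (intro exI[of _ "\<lambda>_. 0"]) simp

lemma polynomial_le_add:
  assumes "polynomial_le p q" "polynomial_le p r"
  shows "polynomial_le p (\<lambda>x. q x + r x)"
proof -
  obtain c d where "\<And>x. q x = (\<Sum>\<gamma>\<in>{\<gamma>. (\<Sum>i\<in>UNIV. \<gamma> i) \<le> p}. c \<gamma> * of_real (\<Prod>i\<in>UNIV. (x $ i) ^ \<gamma> i))"
    "\<And>x. r x = (\<Sum>\<gamma>\<in>{\<gamma>. (\<Sum>i\<in>UNIV. \<gamma> i) \<le> p}. d \<gamma> * of_real (\<Prod>i\<in>UNIV. (x $ i) ^ \<gamma> i))"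
    using assms unfolding polynomial_le_def by blast
  then show ?thesis
    unfolding polynomial_le_def
    by (intro exI[of _ "\<lambda>\<gamma>. c \<gamma> + d \<gamma>"]) (simp add: sum.distrib ring_distribs)
qed

lemma polynomial_le_cmult:
  assumes "polynomial_le p q"
  shows "polynomial_le p (\<lambda>x. a * q x)"
proof -
  obtain c where "\<And>x. q x = (\<Sum>\<gamma>\<in>{\<gamma>. (\<Sum>i\<in>UNIV. \<gamma> i) \<le> p}. c \<gamma> * of_real (\<Prod>i\<in>UNIV. (x $ i) ^ \<gamma> i))"
    using assms unfolding polynomial_le_def by blast
  then show ?thesis
    unfolding polynomial_le_def
    by (intro exI[of _ "\<lambda>\<gamma>. a * c \<gamma>"]) (simp add: sum_distrib_left mult.assoc)
qed

lemma has_derivative_vec_components: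
  fixes f :: "'a::real_normed_vector \<Rightarrow> complex^'n"
  assumes "\<And>i. ((\<lambda>x. f x $ i) has_derivative f' i) (at x)"
  shows "(f has_derivative (\<lambda>h. \<chi> i. f' i h)) (at x)"
proof (subst has_derivative_componentwise_within, safe)
  fix b :: "complex^'n" assume "b \<in> Basis"
  then obtain i u where b: "b = axis i u" by (auto simp: Basis_vec_def)
  show "((\<lambda>x. f x \<bullet> b) has_derivative (\<lambda>h. (\<chi> i. f' i h) \<bullet> b)) (at x)"
    unfolding b inner_axis vec_lambda_beta by (rule has_derivative_inner_left[OF assms])
qed

definition pw_polynomial :: "(real^'d) set set \<Rightarrow> nat \<Rightarrow> ('d::finite) field \<Rightarrow> bool" where
  "pw_polynomial \<T> p v \<longleftrightarrow> (\<forall>T\<in>\<T>. \<forall>i. \<exists>q. polynomial_le p q \<and> (\<forall>x\<in>T. v x $ i = q x))"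

text \<open>An open set on which piecewise polynomial fields are classically differentiable. It
  fills the domain up to a null set, so integrands need to be known only here.\<close>

definition mesh_interior :: "(real^'d) set set \<Rightarrow> (real^'d) set" where
  "mesh_interior \<T> = (\<Union>T\<in>\<T>. interior T)"

text \<open>The polynomials live on the whole space, so inside an element the gradient is the
  restriction of a function that is continuous up to the element boundary. Boundedness of the
  partial derivatives has its origin here.\<close>

lemma pw_polynomial_extension:
  fixes v :: "('d::finite) field"
  assumes "pw_polynomial \<T> p v" "T \<in> \<T>"
  obtains Q Q' where "\<And>x. x \<in> T \<Longrightarrow> v x = Q x" "\<And>x. (Q has_derivative Q' x) (at x)"
    "\<And>h. continuous_on UNIV (\<lambda>x. Q' x h)"
proof -
  have "\<exists>q q'. (\<forall>x\<in>T. v x $ i = q x) \<and> (\<forall>x. (q has_derivative q' x) (at x)) \<and>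
      (\<forall>h. continuous_on UNIV (\<lambda>x. q' x h))" for i
  proof -
    obtain q where q: "polynomial_le p q" "\<forall>x\<in>T. v x $ i = q x"
      using assms unfolding pw_polynomial_def by blast
    then show ?thesis by (metis polynomial_le_C1)
  qed
  then obtain q q' where q: "\<And>i x. x \<in> T \<Longrightarrow> v x $ i = q i x"
    "\<And>i x. (q i has_derivative q' i x) (at x)" "\<And>i h. continuous_on UNIV (\<lambda>x. q' i x h)"
    by metis
  show ?thesis
  proof (rule that)
    show "v x = (\<chi> i. q i x)" if "x \<in> T" for x using q(1)[OF that] by (simp add: vec_eq_iff)
    show "((\<lambda>x. \<chi> i. q i x) has_derivative (\<lambda>h. \<chi> i. q' i x h)) (at x)" for x
      by (rule has_derivative_vec_components) (simp add: q)
    show "continuous_on UNIV (\<lambda>x. \<chi> i. q' i x h)" for h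
      by (intro continuous_on_vec_lambda q)
  qed
qed

lemma pw_polynomial_has_derivative:
  assumes "pw_polynomial \<T> p v" "x \<in> mesh_interior \<T>"
  shows "(v has_derivative frechet_derivative v (at x)) (at x)"
proof -
  obtain T where T: "T \<in> \<T>" "x \<in> interior T" using assms by (auto simp: mesh_interior_def)
  obtain Q Q' where Q: "\<And>x. x \<in> T \<Longrightarrow> v x = Q x" "\<And>x. (Q has_derivative Q' x) (at x)"
    using pw_polynomial_extension[OF assms(1) T(1)] by metis
  have "(v has_derivative Q' x) (at x)"
    using interior_subset
    by (intro has_derivative_transform_within_open[OF Q(2) open_interior T(2)] Q(1)[symmetric]) auto
  then show ?thesis by (simp add: frechet_derivative_at[symmetric])
qed

lemma pw_polynomial_partial:
  assumes "pw_polynomial \<T> p v" "T \<in> \<T>"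
  obtains G where "continuous_on UNIV G" "\<And>x. x \<in> interior T \<Longrightarrow> partial j v i x = G x"
proof -
  obtain Q Q' where Q: "\<And>x. x \<in> T \<Longrightarrow> v x = Q x" "\<And>x. (Q has_derivative Q' x) (at x)"
    "\<And>h. continuous_on UNIV (\<lambda>x. Q' x h)"
    using pw_polynomial_extension[OF assms] by metis
  have "partial j v i x = Q' x (axis j 1) $ i" if x: "x \<in> interior T" for x
  proof -
    have "(v has_derivative Q' x) (at x)"
      using interior_subset
      by (intro has_derivative_transform_within_open[OF Q(2) open_interior x] Q(1)[symmetric]) auto
    then show ?thesis unfolding partial_def by (simp add: frechet_derivative_at[symmetric])
  qed
  moreover have "continuous_on UNIV (\<lambda>x. Q' x (axis j 1) $ i)"
    using Q(3) by (intro continuous_intros)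
  ultimately show ?thesis by (rule that[rotated])
qed

lemma partial_component_derivative:
  fixes v :: "('d::finite) field"
  assumes "(v has_derivative v') (at x)"
  shows "((\<lambda>y. v y $ i) has_derivative (\<lambda>h. v' h $ i)) (at x)"
  by (rule bounded_linear.has_derivative[OF bounded_linear_vec_nth assms])

section \<open>Null sets, measurability and integrability on a meshed domain\<close>

locale meshed_domain =
  fixes \<Omega> :: "(real^'d::finite) set" and \<T> :: "(real^'d) set set"
  assumes \<Omega>: "open \<Omega>" "bounded \<Omega>" and \<T>: "subdivision_of \<T> \<Omega>"
begin

lemma mesh_interior_subset: "mesh_interior \<T> \<subseteq> \<Omega>"
  using \<T> by (auto simp: subdivision_of_def mesh_interior_def)

lemma open_mesh_interior: "open (mesh_interior \<T>)"
  by (auto simp: mesh_interior_def)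

lemma \<Omega>_sets: "\<Omega> \<in> sets lebesgue"
  using \<Omega> by auto

text \<open>Elements are closed and cover the domain, so a point in no element interior lies on the
  frontier of an element, and these are finitely many null sets.\<close>

lemma mesh_interior_AE: "AE x in lebesgue_on \<Omega>. x \<in> mesh_interior \<T>"
proof -
  have "negligible (\<Union>T\<in>\<T>. frontier T)"
    using \<T> by (intro negligible_Union) (auto simp: subdivision_of_def)
  moreover have "x \<in> mesh_interior \<T>" if "x \<in> \<Omega>" "x \<notin> (\<Union>T\<in>\<T>. frontier T)" for x
  proof -
    have "x \<in> \<Union>\<T>" using \<T> that(1) closure_subset by (auto simp: subdivision_of_def)
    then obtain T where T: "T \<in> \<T>" "x \<in> T" by blast
    then have "x \<notin> frontier T" "closed T"
      using that \<T> by (auto simp: subdivision_of_def compact_imp_closed)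
    then show ?thesis using T by (auto simp: mesh_interior_def frontier_def)
  qed
  ultimately show ?thesis
    using \<Omega>_sets AE_not_in[of "\<Union>T\<in>\<T>. frontier T" lebesgue]
    by (auto simp: AE_restrict_space_iff negligible_iff_null_sets elim!: eventually_mono)
qed

lemma partial_bounded:
  assumes "pw_polynomial \<T> p v"
  obtains M where "\<And>x. x \<in> mesh_interior \<T> \<Longrightarrow> norm (partial j v i x) \<le> M"
proof -
  have "bounded (partial j v i ` interior T)" if T: "T \<in> \<T>" for T
  proof -
    obtain G where G: "continuous_on UNIV G" "\<And>x. x \<in> interior T \<Longrightarrow> partial j v i x = G x"
      using pw_polynomial_partial[OF assms T] by metis
    have "compact T" using \<T> T by (auto simp: subdivision_of_def)
    then have "bounded (G ` T)"
      using G(1) by (meson compact_continuous_image compact_imp_bounded continuous_on_subset subset_UNIV)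
    moreover have "partial j v i ` interior T \<subseteq> G ` T"
      using G(2) interior_subset by fastforce
    ultimately show ?thesis by (rule bounded_subset)
  qed
  then have "bounded (\<Union>T\<in>\<T>. partial j v i ` interior T)"
    using \<T> by (auto simp: subdivision_of_def)
  then show ?thesis
    using that unfolding bounded_iff mesh_interior_def by blast
qed

text \<open>Off the mesh interior the field may fail to be differentiable and the value of
  \<open>partial\<close> is then unspecified. The function is continuous on an open set of full
  measure, and completeness of Lebesgue measure does the rest.\<close>

lemma partial_measurable:
  assumes "pw_polynomial \<T> p v"
  shows "partial j v i \<in> borel_measurable (lebesgue_on \<Omega>)"
proof -
  let ?W = "mesh_interior \<T>"
  have "continuous_on (interior T) (partial j v i)" if T: "T \<in> \<T>" for T
  proof -
    obtain G where G: "continuous_on UNIV G" "\<And>x. x \<in> interior T \<Longrightarrow> partial j v i x = G x"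
      using pw_polynomial_partial[OF assms T] by metis
    then show ?thesis
      using continuous_on_cong[of "interior T" _ "partial j v i" G] continuous_on_subset by blast
  qed
  then have "continuous_on ?W (partial j v i)"
    unfolding mesh_interior_def by (intro continuous_on_open_UN) auto
  then have "partial j v i \<in> borel_measurable (lebesgue_on ?W)"
    using open_mesh_interior by (intro continuous_imp_measurable_on_sets_lebesgue) auto
  then have 1: "(\<lambda>x. if x \<in> ?W then partial j v i x else 0) \<in> borel_measurable lebesgue"
    using borel_measurable_if[of ?W] open_mesh_interior by auto
  have "AE x in lebesgue. x \<in> \<Omega> \<longrightarrow> x \<in> ?W"
    using mesh_interior_AE \<Omega>_sets by (simp add: AE_restrict_space_iff)
  then have "AE x in lebesgue. (if x \<in> ?W then partial j v i x else 0) = (if x \<in> \<Omega> then partial j v i x else 0)"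
    by eventually_elim (use mesh_interior_subset in auto)
  from borel_measurable_AE[OF 1 this] show ?thesis
    using borel_measurable_if[OF \<Omega>_sets] by blast
qed

lemma finite_measure_\<Omega>: "finite_measure (lebesgue_on \<Omega>)"
proof
  have "\<Omega> \<in> lmeasurable"
    using \<Omega>(2) \<Omega>_sets by (rule bounded_set_imp_lmeasurable)
  then show "emeasure (lebesgue_on \<Omega>) (space (lebesgue_on \<Omega>)) \<noteq> \<infinity>"
    using \<Omega>_sets by (auto simp: emeasure_restrict_space fmeasurable_def)
qed

lemma integrable_bounded:
  fixes f :: "real^'d \<Rightarrow> 'b::{banach, second_countable_topology}"
  assumes "f \<in> borel_measurable (lebesgue_on \<Omega>)" "AE x in lebesgue_on \<Omega>. norm (f x) \<le> M"
  shows "integrable (lebesgue_on \<Omega>) f"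
  using finite_measure.integrable_const_bound[OF finite_measure_\<Omega> assms(2,1)] .

lemma square_integrable_bounded:
  fixes f :: "real^'d \<Rightarrow> 'b::euclidean_space"
  assumes "f \<in> borel_measurable (lebesgue_on \<Omega>)" "AE x in lebesgue_on \<Omega>. norm (f x) \<le> M"
  shows "square_integrable (lebesgue_on \<Omega>) f"
proof -
  have "integrable (lebesgue_on \<Omega>) (\<lambda>x. (norm (f x))\<^sup>2)"
  proof (rule integrable_bounded)
    show "AE x in lebesgue_on \<Omega>. norm ((norm (f x))\<^sup>2) \<le> M\<^sup>2"
      using assms(2) by eventually_elim (auto intro: power_mono)
  qed (use assms(1) in measurable)
  then show ?thesis using assms(1) by (simp add: square_integrable_def)
qed

lemma square_integrable_imp_integrable:
  fixes f :: "real^'d \<Rightarrow> 'b::euclidean_space"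
  assumes "square_integrable (lebesgue_on \<Omega>) f"
  shows "integrable (lebesgue_on \<Omega>) f"
proof (rule Bochner_Integration.integrable_bound[of _ "\<lambda>x. 1 + (norm (f x))\<^sup>2"])
  show "integrable (lebesgue_on \<Omega>) (\<lambda>x. 1 + (norm (f x))\<^sup>2)"
    using assms finite_measure.integrable_const[OF finite_measure_\<Omega>]
    by (intro Bochner_Integration.integrable_add) (auto simp: square_integrable_def)
  show "AE x in lebesgue_on \<Omega>. norm (f x) \<le> norm (1 + (norm (f x))\<^sup>2)"
  proof (rule AE_I2)
    fix x
    \<comment> \<open>With t for the norm, the square expands to t \<le> t^2 + 1/4.\<close>
    have "0 \<le> (norm (f x) - 1 / 2)\<^sup>2" by simp
    then show "norm (f x) \<le> norm (1 + (norm (f x))\<^sup>2)" by (simp add: power2_eq_square algebra_simps)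
  qed
qed (use assms in \<open>auto simp: square_integrable_def\<close>)

end

text \<open>Only segments inside the domain are tested, so no convexity enters, and each coordinate
  direction has its own constant, in accordance with the weak derivative in that direction.\<close>

definition seg_lipschitz :: "(real^'d) set \<Rightarrow> 'd::finite \<Rightarrow> (real^'d \<Rightarrow> complex) \<Rightarrow> bool" where
  "seg_lipschitz \<Omega> j u \<longleftrightarrow> (\<exists>M. \<forall>x h. closed_segment x (x + h *\<^sub>R axis j 1) \<subseteq> \<Omega> \<longrightarrow>
     norm (u (x + h *\<^sub>R axis j 1) - u x) \<le> M * \<bar>h\<bar>)"

lemma seg_lipschitz_add:
  assumes "seg_lipschitz \<Omega> j u" "seg_lipschitz \<Omega> j v"
  shows "seg_lipschitz \<Omega> j (\<lambda>x. u x + v x)"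
proof -
  obtain M N where
    "\<And>x h. closed_segment x (x + h *\<^sub>R axis j 1) \<subseteq> \<Omega> \<Longrightarrow> norm (u (x + h *\<^sub>R axis j 1) - u x) \<le> M * \<bar>h\<bar>"
    "\<And>x h. closed_segment x (x + h *\<^sub>R axis j 1) \<subseteq> \<Omega> \<Longrightarrow> norm (v (x + h *\<^sub>R axis j 1) - v x) \<le> N * \<bar>h\<bar>"
    using assms unfolding seg_lipschitz_def by blast
  then have "norm (u (x + h *\<^sub>R axis j 1) - u x + (v (x + h *\<^sub>R axis j 1) - v x)) \<le> M * \<bar>h\<bar> + N * \<bar>h\<bar>"
    if "closed_segment x (x + h *\<^sub>R axis j 1) \<subseteq> \<Omega>" for x h
    using that by (intro norm_triangle_mono) auto
  then show ?thesis
    unfolding seg_lipschitz_def by (intro exI[of _ "M + N"]) (simp add: algebra_simps)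
qed

lemma seg_lipschitz_cmult:
  assumes "seg_lipschitz \<Omega> j u"
  shows "seg_lipschitz \<Omega> j (\<lambda>x. c * u x)"
proof -
  obtain M where
    "\<And>x h. closed_segment x (x + h *\<^sub>R axis j 1) \<subseteq> \<Omega> \<Longrightarrow> norm (u (x + h *\<^sub>R axis j 1) - u x) \<le> M * \<bar>h\<bar>"
    using assms unfolding seg_lipschitz_def by blast
  then have "norm (c * u (x + h *\<^sub>R axis j 1) - c * u x) \<le> (norm c * M) * \<bar>h\<bar>"
    if "closed_segment x (x + h *\<^sub>R axis j 1) \<subseteq> \<Omega>" for x h
    using that by (simp add: right_diff_distrib[symmetric] norm_mult mult.assoc mult_left_mono)
  then show ?thesis unfolding seg_lipschitz_def by blast
qed

lemma test_function_scaleR_integrable: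
  fixes g :: "real^'d \<Rightarrow> complex"
  assumes "\<phi> \<in> test_functions \<Omega>'" "integrable (lebesgue_on S) g"
  shows "integrable (lebesgue_on S) (\<lambda>x. \<phi> x *\<^sub>R g x)"
proof -
  obtain C where C: "C \<ge> 0" "\<And>x. \<bar>\<phi> x\<bar> \<le> C"
    using test_function_bounded[OF assms(1)] by metis
  show ?thesis
  proof (rule Bochner_Integration.integrable_bound[of _ "\<lambda>x. C * norm (g x)"])
    show "AE x in lebesgue_on S. norm (\<phi> x *\<^sub>R g x) \<le> norm (C * norm (g x))"
      using C by (intro AE_I2) (auto intro!: mult_right_mono)
    have "\<phi> \<in> borel_measurable (lebesgue_on S)"
      using borel_measurable_continuous_lebesgue[OF test_function_continuous[OF assms(1)]]
      by (rule measurable_restrict_space1)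
    then show "(\<lambda>x. \<phi> x *\<^sub>R g x) \<in> borel_measurable (lebesgue_on S)"
      by (intro borel_measurable_scaleR borel_measurable_integrable[OF assms(2)])
  qed (use assms(2) in auto)
qed

text \<open>A test function on the smaller set is also one on the larger, and both integrands vanish
  off the smaller set. This localises weak derivatives to the interior of a single element.\<close>

lemma weak_partial_subset:
  assumes "weak_partial \<Omega> j u g" "\<Omega>' \<subseteq> \<Omega>" "\<Omega> \<in> sets lebesgue" "\<Omega>' \<in> sets lebesgue"
  shows "weak_partial \<Omega>' j u g"
  unfolding weak_partial_def
proof
  fix \<phi> assume \<phi>: "\<phi> \<in> test_functions \<Omega>'"
  then have "\<phi> \<in> test_functions \<Omega>" using assms(2) by (rule test_function_mono)
  with assms(1) have "(\<integral>x. frechet_derivative \<phi> (at x) (axis j 1) *\<^sub>R u x \<partial>lebesgue_on \<Omega>) =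
     - (\<integral>x. \<phi> x *\<^sub>R g x \<partial>lebesgue_on \<Omega>)" by (simp add: weak_partial_def)
  moreover have "integral\<^sup>L (lebesgue_on \<Omega>) f = integral\<^sup>L (lebesgue_on \<Omega>') f"
    if "\<And>x. x \<notin> \<Omega>' \<Longrightarrow> f x = 0" for f :: "real^'a \<Rightarrow> complex"
    using that assms lebesgue_on_integral(1)[of _ f] by (metis subsetD)
  ultimately show "(\<integral>x. frechet_derivative \<phi> (at x) (axis j 1) *\<^sub>R u x \<partial>lebesgue_on \<Omega>') =
     - (\<integral>x. \<phi> x *\<^sub>R g x \<partial>lebesgue_on \<Omega>')"
    using test_function_zero[OF \<phi>] test_function_derivative_zero'[OF \<phi>] by simp
qed

section \<open>The finite element space characterised on segments\<close>

context meshed_domain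
begin

text \<open>The conditions of \<open>fe_space\<close> other than Sobolev regularity and Dirichlet
  data; they already give measurability, integrability and essentially bounded partial
  derivatives.\<close>

definition cont_pw :: "nat \<Rightarrow> 'd field \<Rightarrow> bool" where
  "cont_pw p v \<longleftrightarrow> continuous_on (closure \<Omega>) v \<and> (\<forall>x. x \<notin> closure \<Omega> \<longrightarrow> v x = 0) \<and>
     pw_polynomial \<T> p v"

lemma compact_closure_\<Omega>: "compact (closure \<Omega>)"
  using \<Omega> by (simp add: compact_closure)

lemma cont_pw_bounded:
  assumes "cont_pw p v"
  obtains C where "C \<ge> 0" "\<And>x. norm (v x) \<le> C"
  using continuous_zero_outside_compact_bounded[of "closure \<Omega>" v] assms compact_closure_\<Omega>
  unfolding cont_pw_def by metis

lemma cont_pw_borel: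
  assumes "cont_pw p v"
  shows "v \<in> borel_measurable borel"
proof -
  have "(\<lambda>x. indicator (closure \<Omega>) x *\<^sub>R v x) \<in> borel_measurable borel"
    using assms by (intro borel_measurable_continuous_on_indicator) (auto simp: cont_pw_def)
  also have "(\<lambda>x. indicator (closure \<Omega>) x *\<^sub>R v x) = v"
    using assms by (auto simp: cont_pw_def fun_eq_iff indicator_def)
  finally show ?thesis .
qed

lemma cont_pw_component_borel:
  "cont_pw p v \<Longrightarrow> (\<lambda>x. v x $ i) \<in> borel_measurable borel"
  by (rule measurable_compose[OF cont_pw_borel], assumption)
     (intro borel_measurable_continuous_onI continuous_intros)

lemma cont_pw_component_lebesgue_on:
  "cont_pw p v \<Longrightarrow> (\<lambda>x. v x $ i) \<in> borel_measurable (lebesgue_on S)"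
  by (intro measurable_restrict_space1) (simp add: measurable_completion cont_pw_component_borel)

lemma cont_pw_component_integrable:
  assumes "cont_pw p v"
  shows "integrable lebesgue (\<lambda>x. v x $ i)"
proof -
  obtain C where C: "C \<ge> 0" "\<And>x. norm (v x) \<le> C" using cont_pw_bounded[OF assms] by metis
  show ?thesis
  proof (rule Bochner_Integration.integrable_bound[of _ "\<lambda>x. C * indicator (closure \<Omega>) x"])
    have "closure \<Omega> \<in> lmeasurable" using compact_closure_\<Omega> by (rule lmeasurable_compact)
    then show "integrable lebesgue (\<lambda>x. C * indicator (closure \<Omega>) x :: real)"
      by (intro Bochner_Integration.integrable_mult_right) (simp add: fmeasurable_def integrable_indicator_iff)
    show "AE x in lebesgue. norm (v x $ i) \<le> norm (C * indicator (closure \<Omega>) x)"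
    proof (rule AE_I2)
      fix x
      show "norm (v x $ i) \<le> norm (C * indicator (closure \<Omega>) x)"
        using order_trans[OF Finite_Cartesian_Product.norm_nth_le C(2), of x i] assms C(1)
        by (cases "x \<in> closure \<Omega>") (auto simp: cont_pw_def)
    qed
  qed (simp add: measurable_completion cont_pw_component_borel[OF assms])
qed

lemma cont_pw_component_square_integrable:
  assumes "cont_pw p v"
  shows "square_integrable (lebesgue_on \<Omega>) (\<lambda>x. v x $ i)"
proof -
  obtain C where C: "\<And>x. norm (v x) \<le> C" using cont_pw_bounded[OF assms] by metis
  show ?thesis
    by (intro square_integrable_bounded[of _ C] AE_I2 cont_pw_component_lebesgue_on[OF assms]
        order_trans[OF Finite_Cartesian_Product.norm_nth_le C])
qed

lemma partial_directional_tendsto: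
  assumes "pw_polynomial \<T> p v" "x \<in> mesh_interior \<T>"
  shows "((\<lambda>h. (v (x + h *\<^sub>R axis j 1) $ i - v x $ i) /\<^sub>R h) \<longlongrightarrow> partial j v i x) (at 0)"
  unfolding partial_def
  by (rule has_derivative_directional[OF partial_component_derivative[OF
        pw_polynomial_has_derivative[OF assms]]])

lemma partial_AE_bounded:
  assumes "pw_polynomial \<T> p v"
  obtains M where "AE x in lebesgue_on \<Omega>. norm (partial j v i x) \<le> M"
proof -
  obtain M where "\<And>x. x \<in> mesh_interior \<T> \<Longrightarrow> norm (partial j v i x) \<le> M"
    using partial_bounded[OF assms] by metis
  then show ?thesis by (intro that[of M] eventually_mono[OF mesh_interior_AE])
qed

lemma partial_square_integrable:
  assumes "pw_polynomial \<T> p v"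
  shows "square_integrable (lebesgue_on \<Omega>) (partial j v i)"
proof -
  obtain M where "AE x in lebesgue_on \<Omega>. norm (partial j v i x) \<le> M"
    using partial_AE_bounded[OF assms] .
  then show ?thesis by (rule square_integrable_bounded[OF partial_measurable[OF assms]])
qed

lemma seg_lipschitz_imp_weak_partial:
  assumes v: "cont_pw p v" and lip: "seg_lipschitz \<Omega> j (\<lambda>x. v x $ i)"
  shows "weak_partial \<Omega> j (\<lambda>x. v x $ i) (partial j v i)"
proof -
  have pw: "pw_polynomial \<T> p v" using v by (simp add: cont_pw_def)
  obtain M where M: "\<And>x h. closed_segment x (x + h *\<^sub>R axis j 1) \<subseteq> \<Omega> \<Longrightarrow>
      norm (v (x + h *\<^sub>R axis j 1) $ i - v x $ i) \<le> M * \<bar>h\<bar>"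
    using lip unfolding seg_lipschitz_def by blast
  show ?thesis
    by (rule weak_partial_lipschitz[OF \<Omega>(1) cont_pw_component_borel[OF v]
          cont_pw_component_integrable[OF v] M partial_measurable[OF pw]], assumption)
       (rule eventually_mono[OF mesh_interior_AE partial_directional_tendsto[OF pw]])
qed

text \<open>Inside one element the partial derivative is bounded, so integration by parts shows it
  to be a weak derivative as well, and the fundamental lemma identifies it with \<open>g\<close>
  there. The finitely many element interiors fill the domain up to a null set.\<close>

lemma weak_partial_eq_partial_AE:
  assumes v: "cont_pw p v" and weak: "weak_partial \<Omega> j (\<lambda>x. v x $ i) g"
    and g: "square_integrable (lebesgue_on \<Omega>) g"
  shows "AE x in lebesgue_on \<Omega>. g x = partial j v i x"
proof -
  have pw: "pw_polynomial \<T> p v" using v by (simp add: cont_pw_def)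
  obtain M where M: "\<And>x. x \<in> mesh_interior \<T> \<Longrightarrow> norm (partial j v i x) \<le> M"
    using partial_bounded[OF pw] by metis
  have "AE x in lebesgue. x \<in> interior T \<longrightarrow> g x = partial j v i x" if T: "T \<in> \<T>" for T
  proof -
    have T\<Omega>: "interior T \<subseteq> \<Omega>" and TW: "interior T \<subseteq> mesh_interior \<T>"
      using T \<T> by (auto simp: subdivision_of_def mesh_interior_def)
    have T_sets: "interior T \<in> sets lebesgue" by auto
    have sub: "integrable (lebesgue_on (interior T)) f" if f: "integrable (lebesgue_on \<Omega>) f"
      for f :: "real^'d \<Rightarrow> complex"
    proof -
      have "set_integrable lebesgue \<Omega> f"
        using f \<Omega>_sets by (simp add: set_integrable_def integrable_restrict_space)
      then have "set_integrable lebesgue (interior T) f"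
        by (rule set_integrable_subset[OF _ T_sets T\<Omega>])
      then show ?thesis
        using T_sets by (simp add: set_integrable_def integrable_restrict_space)
    qed
    have 1: "weak_partial (interior T) j (\<lambda>x. v x $ i) (partial j v i)"
    proof (rule weak_partial_lipschitz[OF open_interior cont_pw_component_borel[OF v]
          cont_pw_component_integrable[OF v]])
      show "norm (v (x + h *\<^sub>R axis j 1) $ i - v x $ i) \<le> M * \<bar>h\<bar>"
        if "closed_segment x (x + h *\<^sub>R axis j 1) \<subseteq> interior T" for x h
      proof (rule directional_lipschitz[where f = "\<lambda>x. v x $ i"
            and f' = "\<lambda>y k. frechet_derivative v (at y) k $ i"])
        fix y assume "y \<in> closed_segment x (x + h *\<^sub>R axis j 1)"
        then have y: "y \<in> mesh_interior \<T>" using that TW by blast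
        show "((\<lambda>x. v x $ i) has_derivative (\<lambda>k. frechet_derivative v (at y) k $ i)) (at y)"
          by (rule partial_component_derivative[OF pw_polynomial_has_derivative[OF pw y]])
        show "norm (frechet_derivative v (at y) (axis j 1) $ i) \<le> M"
          using M[OF y] by (simp add: partial_def)
      qed
      show "partial j v i \<in> borel_measurable (lebesgue_on (interior T))"
        by (rule measurable_restrict_mono[OF partial_measurable[OF pw] T\<Omega>])
      show "AE x in lebesgue_on (interior T).
          ((\<lambda>h. (v (x + h *\<^sub>R axis j 1) $ i - v x $ i) /\<^sub>R h) \<longlongrightarrow> partial j v i x) (at 0)"
        using TW by (intro AE_I2 partial_directional_tendsto[OF pw]) auto
    qed
    have 2: "weak_partial (interior T) j (\<lambda>x. v x $ i) g"
      by (rule weak_partial_subset[OF weak T\<Omega> \<Omega>_sets T_sets])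
    have ig: "integrable (lebesgue_on (interior T)) g"
      by (rule sub[OF square_integrable_imp_integrable[OF g]])
    have ip: "integrable (lebesgue_on (interior T)) (partial j v i)"
      by (rule sub[OF square_integrable_imp_integrable[OF partial_square_integrable[OF pw]]])
    have "AE x in lebesgue_on (interior T). g x - partial j v i x = 0"
    proof (rule fundamental_lemma[OF open_interior])
      show "integrable (lebesgue_on (interior T)) (\<lambda>x. g x - partial j v i x)"
        using ig ip by auto
      show "(\<integral>x. \<phi> x *\<^sub>R (g x - partial j v i x) \<partial>lebesgue_on (interior T)) = 0"
        if \<phi>: "\<phi> \<in> test_functions (interior T)" for \<phi>
        using 1 2 \<phi> test_function_scaleR_integrable[OF \<phi> ig] test_function_scaleR_integrable[OF \<phi> ip]
        by (simp add: weak_partial_def scaleR_diff_right)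
    qed
    then show ?thesis using T_sets by (simp add: AE_restrict_space_iff)
  qed
  then have "AE x in lebesgue. \<forall>T\<in>\<T>. x \<in> interior T \<longrightarrow> g x = partial j v i x"
    using \<T> by (intro AE_finite_allI) (auto simp: subdivision_of_def)
  moreover have "AE x in lebesgue. x \<in> \<Omega> \<longrightarrow> x \<in> mesh_interior \<T>"
    using mesh_interior_AE \<Omega>_sets by (simp add: AE_restrict_space_iff)
  ultimately have "AE x in lebesgue. x \<in> \<Omega> \<longrightarrow> g x = partial j v i x"
    by eventually_elim (auto simp: mesh_interior_def)
  then show ?thesis using \<Omega>_sets by (simp add: AE_restrict_space_iff)
qed

text \<open>\<open>g\<close> agrees almost everywhere with a bounded classical partial derivative.
  This upgrades square integrability to the essential bound that the mollification argument
  consumes.\<close>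

lemma weak_partial_imp_seg_lipschitz:
  assumes v: "cont_pw p v" and weak: "weak_partial \<Omega> j (\<lambda>x. v x $ i) g"
    and g: "square_integrable (lebesgue_on \<Omega>) g"
  shows "seg_lipschitz \<Omega> j (\<lambda>x. v x $ i)"
proof -
  have pw: "pw_polynomial \<T> p v" using v by (simp add: cont_pw_def)
  obtain M where "AE x in lebesgue_on \<Omega>. norm (partial j v i x) \<le> M"
    using partial_AE_bounded[OF pw] by metis
  then have M: "AE x in lebesgue_on \<Omega>. norm (g x) \<le> M"
    using weak_partial_eq_partial_AE[OF v weak g] by eventually_elim simp
  have "continuous_on \<Omega> v"
    using v continuous_on_subset[OF _ closure_subset] by (auto simp: cont_pw_def)
  then have cont: "continuous_on \<Omega> (\<lambda>x. v x $ i)" by (intro continuous_intros)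
  show ?thesis
    unfolding seg_lipschitz_def
    by (intro exI[of _ M] allI impI lipschitz_of_bounded_weak_partial[OF \<Omega>(1)
        cont_pw_component_borel[OF v] cont_pw_component_integrable[OF v] cont weak
        square_integrable_imp_integrable[OF g] M])
qed

text \<open>From here on weak derivatives are out of sight: sums, multiples and cut-offs are checked
  on segments. For membership in \<open>sobolev_H1\<close> the witness is the classical partial
  derivative.\<close>

lemma fe_space_iff:
  "v \<in> fe_space \<Omega> \<Gamma>D \<T> p \<longleftrightarrow>
    cont_pw p v \<and> (\<forall>x\<in>\<Gamma>D. v x = 0) \<and> (\<forall>i j. seg_lipschitz \<Omega> j (\<lambda>x. v x $ i))"
proof -
  have "v \<in> sobolev_H1 \<Omega> \<longleftrightarrow> (\<forall>i j. seg_lipschitz \<Omega> j (\<lambda>x. v x $ i))" if v: "cont_pw p v"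
  proof
    show "\<forall>i j. seg_lipschitz \<Omega> j (\<lambda>x. v x $ i)" if "v \<in> sobolev_H1 \<Omega>"
      using that weak_partial_imp_seg_lipschitz[OF v] unfolding sobolev_H1_def by blast
    show "v \<in> sobolev_H1 \<Omega>" if "\<forall>i j. seg_lipschitz \<Omega> j (\<lambda>x. v x $ i)"
      unfolding sobolev_H1_def
      using that cont_pw_component_square_integrable[OF v] seg_lipschitz_imp_weak_partial[OF v]
        partial_square_integrable v unfolding cont_pw_def by blast
  qed
  then show ?thesis
    by (auto simp: fe_space_def cont_pw_def pw_polynomial_def)
qed

lemma fe_space_zero: "0 \<in> fe_space \<Omega> \<Gamma>D \<T> p"
  unfolding fe_space_iff cont_pw_def pw_polynomial_def seg_lipschitz_def
  using polynomial_le_zero by (auto simp: zero_fun_def intro!: exI[of _ 0] exI[of _ "\<lambda>x. 0"])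

lemma fe_space_add:
  assumes "v \<in> fe_space \<Omega> \<Gamma>D \<T> p" "w \<in> fe_space \<Omega> \<Gamma>D \<T> p"
  shows "v + w \<in> fe_space \<Omega> \<Gamma>D \<T> p"
proof -
  have "pw_polynomial \<T> p (v + w)"
    unfolding pw_polynomial_def
  proof (intro ballI allI)
    fix T i assume "T \<in> \<T>"
    then obtain q r where "polynomial_le p q" "\<forall>x\<in>T. v x $ i = q x"
      "polynomial_le p r" "\<forall>x\<in>T. w x $ i = r x"
      using assms unfolding fe_space_iff cont_pw_def pw_polynomial_def by meson
    then show "\<exists>q. polynomial_le p q \<and> (\<forall>x\<in>T. (v + w) x $ i = q x)"
      by (intro exI[of _ "\<lambda>x. q x + r x"]) (auto intro: polynomial_le_add)
  qed
  then show ?thesis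
    using assms unfolding fe_space_iff cont_pw_def
    by (auto simp: plus_fun_def intro!: continuous_intros seg_lipschitz_add)
qed

lemma fe_space_scale:
  assumes "v \<in> fe_space \<Omega> \<Gamma>D \<T> p"
  shows "fscale c v \<in> fe_space \<Omega> \<Gamma>D \<T> p"
proof -
  have "pw_polynomial \<T> p (fscale c v)"
    unfolding pw_polynomial_def
  proof (intro ballI allI)
    fix T i assume "T \<in> \<T>"
    then obtain q where "polynomial_le p q" "\<forall>x\<in>T. v x $ i = q x"
      using assms unfolding fe_space_iff cont_pw_def pw_polynomial_def by meson
    then show "\<exists>q. polynomial_le p q \<and> (\<forall>x\<in>T. fscale c v x $ i = q x)"
      by (intro exI[of _ "\<lambda>x. c * q x"]) (auto intro: polynomial_le_cmult simp: fscale_def)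
  qed
  moreover have "continuous_on (closure \<Omega>) (fscale c v)"
    using assms unfolding fe_space_iff cont_pw_def fscale_def vector_scalar_mult_def
    by (intro continuous_on_vec_lambda continuous_intros) auto
  ultimately show ?thesis
    using assms unfolding fe_space_iff cont_pw_def
    by (auto simp: fscale_def intro!: seg_lipschitz_cmult)
qed

lemma subspace_fe_space: "fld.subspace (fe_space \<Omega> \<Gamma>D \<T> p)"
  by (auto simp: fld.subspace_def fe_space_zero fe_space_add fe_space_scale)

end

section \<open>Subdomains and the interface\<close>

text \<open>A segment is connected, so two closed sets that cover it and both meet it must meet each
  other on it.\<close>

lemma closed_segment_crosses:
  fixes x y :: "'a::real_normed_vector"
  assumes "closed A" "closed B" "closed_segment x y \<subseteq> A \<union> B" "x \<in> A" "y \<notin> A"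
  obtains z where "z \<in> closed_segment x y" "z \<in> A" "z \<in> B"
proof -
  have "x \<in> A \<inter> closed_segment x y" "y \<in> B \<inter> closed_segment x y"
    using assms by auto
  then have "A \<inter> B \<inter> closed_segment x y \<noteq> {}"
    using connected_segment(1)[of x y] assms(1-3) unfolding connected_closed by blast
  then show ?thesis using that by blast
qed

locale partitioned_problem =
  fixes P :: "('d::finite) elasticity_problem"
  assumes setting: "elasticity_setting P" and partition: "subdomain_partition P"

sublocale partitioned_problem \<subseteq> meshed_domain "Om P" "mesh P"
  using setting by unfold_locales (auto simp: elasticity_setting_def)

context partitioned_problem
begin

abbreviation "subs \<equiv> {1..nsub P}"

lemma part_subset_mesh: "i \<in> subs \<Longrightarrow> part P i \<subseteq> mesh P"
  using partition by (auto simp: subdomain_partition_def)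

lemma element:
  assumes "T \<in> mesh P"
  shows "closure (interior T) = T" "interior T \<subseteq> Om P"
  using \<T> assms by (auto simp: subdivision_of_def)

lemma mesh_cover: "x \<in> closure (Om P) \<Longrightarrow> \<exists>T\<in>mesh P. x \<in> T"
  using \<T> unfolding subdivision_of_def by blast

lemma mesh_disjoint:
  "T \<in> mesh P \<Longrightarrow> T' \<in> mesh P \<Longrightarrow> T \<noteq> T' \<Longrightarrow> interior T \<inter> interior T' = {}"
  using \<T> unfolding subdivision_of_def by simp

lemma interior_subset_subdomain:
  assumes "i \<in> subs" "T \<in> part P i"
  shows "interior T \<subseteq> subdomain P i"
  using element[of T] part_subset_mesh[of i] assms interior_mono[of T "\<Union>(part P i)"]
  unfolding subdomain_def by blast

lemma element_subset_closure_subdomain: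
  assumes "i \<in> subs" "T \<in> part P i"
  shows "T \<subseteq> closure (subdomain P i)"
  using closure_mono[OF interior_subset_subdomain[OF assms]] element[of T] part_subset_mesh assms
  by blast

lemma mesh_cases:
  assumes "T \<in> mesh P"
  obtains i where "i \<in> subs" "T \<in> part P i"
  using assms partition unfolding subdomain_partition_def by blast

lemma open_subdomain: "open (subdomain P i)"
  using \<Omega> by (auto simp: subdomain_def)

lemma subdomain_subset: "subdomain P i \<subseteq> Om P"
  by (auto simp: subdomain_def)

lemma closure_Om_subset: "closure (Om P) \<subseteq> (\<Union>i\<in>subs. closure (subdomain P i))"
proof
  fix x assume "x \<in> closure (Om P)"
  then obtain T where T: "T \<in> mesh P" "x \<in> T" using mesh_cover by blast
  then obtain i where "i \<in> subs" "T \<in> part P i" using mesh_cases by metis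
  then show "x \<in> (\<Union>i\<in>subs. closure (subdomain P i))"
    using element_subset_closure_subdomain T by blast
qed

text \<open>An element is the closure of its interior. This allows a point to be moved off the
  element boundaries without leaving a given open set.\<close>

lemma element_meets_open:
  assumes "T \<in> mesh P" "x \<in> T" "open O'" "x \<in> O'"
  shows "O' \<inter> interior T \<noteq> {}"
  using assms element(1)[of T] by (metis disjoint_iff open_Int_closure_eq_empty)

text \<open>A common point may lie on element boundaries, so it is moved into the interior of an
  element of part i, and from there into the interior of an element of part j; two distinct elements
  would then have overlapping interiors.\<close>

lemma subdomain_disjoint:
  assumes ij: "i \<in> subs" "j \<in> subs" "i \<noteq> j"
  shows "subdomain P i \<inter> subdomain P j = {}"
proof (rule ccontr)
  assume "subdomain P i \<inter> subdomain P j \<noteq> {}"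
  then obtain x where x: "x \<in> subdomain P i \<inter> subdomain P j" by blast
  let ?O = "subdomain P i \<inter> subdomain P j"
  have O: "open ?O" using open_subdomain by auto
  obtain T where T: "T \<in> part P i" "x \<in> T"
    using x interior_subset[of "\<Union>(part P i)"] by (auto simp: subdomain_def)
  then have "?O \<inter> interior T \<noteq> {}"
    using element_meets_open[of T x ?O] part_subset_mesh ij O x by blast
  then obtain y where y: "y \<in> ?O \<inter> interior T" by blast
  obtain T' where T': "T' \<in> part P j" "y \<in> T'"
    using y interior_subset[of "\<Union>(part P j)"] by (auto simp: subdomain_def)
  have "(?O \<inter> interior T) \<inter> interior T' \<noteq> {}"
    using element_meets_open[of T' y "?O \<inter> interior T"] part_subset_mesh ij O y T' by blast
  moreover have "T \<noteq> T'"
    using T T' ij partition unfolding subdomain_partition_def by blast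
  ultimately show False
    using mesh_disjoint[of T T'] part_subset_mesh[OF ij(1)] part_subset_mesh[OF ij(2)] T T' by blast
qed

text \<open>If x avoided the closures of all other subdomains, a whole neighbourhood would be
  covered by elements of part i, and x would be in the interior that defines the subdomain.\<close>

lemma closure_subdomain_other:
  assumes i: "i \<in> subs" and x: "x \<in> Om P" "x \<notin> subdomain P i"
  obtains j where "j \<in> subs - {i}" "x \<in> closure (subdomain P j)"
proof -
  have "\<exists>j\<in>subs - {i}. x \<in> closure (subdomain P j)"
  proof (rule ccontr)
    assume none: "\<not> ?thesis"
    define O' where "O' = Om P - (\<Union>j\<in>subs - {i}. closure (subdomain P j))"
    have "open O'" unfolding O'_def using \<Omega> by (intro open_Diff closed_UN) auto
    moreover have "x \<in> O'" using x none by (auto simp: O'_def)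
    moreover have "O' \<subseteq> \<Union>(part P i)"
    proof
      fix y assume y: "y \<in> O'"
      then have "y \<in> closure (Om P)" using closure_subset by (auto simp: O'_def)
      then obtain T where T: "T \<in> mesh P" "y \<in> T" using mesh_cover by blast
      then obtain j where j: "j \<in> subs" "T \<in> part P j" using mesh_cases by metis
      then have "y \<in> closure (subdomain P j)" using element_subset_closure_subdomain T by blast
      then have "j = i" using y j by (auto simp: O'_def)
      then show "y \<in> \<Union>(part P i)" using j T by blast
    qed
    ultimately have "x \<in> interior (\<Union>(part P i))" by (auto intro: interiorI)
    then show False using x by (auto simp: subdomain_def)
  qed
  then show ?thesis using that by blast
qed

section \<open>Interior spaces and cut-off to a subdomain\<close>

lemma Vh_iff:
  "v \<in> Vh P \<longleftrightarrow> cont_pw (deg P) v \<and> (\<forall>x\<in>GamD P. v x = 0) \<and>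
    (\<forall>i j. seg_lipschitz (Om P) j (\<lambda>x. v x $ i))"
  by (simp add: Vh_def fe_space_iff)

lemma Vh_cont_pw: "v \<in> Vh P \<Longrightarrow> cont_pw (deg P) v"
  by (simp add: Vh_iff)

lemma subspace_Vh: "fld.subspace (Vh P)"
  by (simp add: Vh_def subspace_fe_space)

lemma interior_space_subset: "interior_space P i \<subseteq> Vh P"
  by (auto simp: interior_space_def)

text \<open>Disjointness of the subdomains gives zero on the open subdomain j, and continuity
  carries it to the closure.\<close>

lemma interior_space_vanishes:
  assumes v: "v \<in> interior_space P i" and ij: "i \<in> subs" "j \<in> subs" "i \<noteq> j"
    and x: "x \<in> closure (subdomain P j)"
  shows "v x = 0"
proof -
  have "v y = 0" if "y \<in> subdomain P j" for y
    using v that subdomain_disjoint[OF ij] subdomain_subset by (auto simp: interior_space_def)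
  moreover have "continuous_on (closure (subdomain P j)) v"
    using v closure_mono[OF subdomain_subset]
    by (auto simp: interior_space_def Vh_iff cont_pw_def intro: continuous_on_subset)
  ultimately show ?thesis using continuous_constant_on_closure x by blast
qed

lemma interior_space_vanishes_interface:
  assumes "v \<in> interior_space P i" "i \<in> subs" "x \<in> interface P"
  shows "v x = 0"
  using assms interior_space_vanishes unfolding interface_def by blast

lemma sum_apply_field: "(\<Sum>i\<in>I. f i :: 'd field) x = (\<Sum>i\<in>I. f i x)"
  by (induction I rule: infinite_finite_induct) auto

text \<open>The closure is taken because the polynomial condition is imposed on closed elements:
  those of part i keep w entirely.\<close>

definition cut :: "nat \<Rightarrow> 'd field \<Rightarrow> 'd field" where
  "cut i w = (\<lambda>x. if x \<in> closure (subdomain P i) then w x else 0)"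

context
  fixes w assumes w: "w \<in> Vh P" "\<And>x. x \<in> interface P \<Longrightarrow> w x = 0"
begin

lemma vanishes_between:
  "i \<in> subs \<Longrightarrow> j \<in> subs - {i} \<Longrightarrow> x \<in> closure (subdomain P i) \<Longrightarrow> x \<in> closure (subdomain P j) \<Longrightarrow> w x = 0"
  using w(2) unfolding interface_def by blast

text \<open>Two subdomain closures meet only in the interface, so a point where w is nonzero lies in
  exactly one of them.\<close>

lemma sum_cut: "(\<Sum>i\<in>subs. cut i w) = w"
proof
  fix x
  show "(\<Sum>i\<in>subs. cut i w) x = w x"
  proof (cases "w x = 0")
    case True
    then show ?thesis by (auto simp: sum_apply_field cut_def intro!: sum.neutral)
  next
    case False
    then have "x \<in> closure (Om P)" using w by (auto simp: Vh_iff cont_pw_def)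
    then obtain i where i: "i \<in> subs" "x \<in> closure (subdomain P i)" using closure_Om_subset by blast
    have "(\<Sum>j\<in>subs. cut j w x) = (\<Sum>j\<in>subs. if j = i then w x else 0)"
    proof (rule sum.cong)
      fix j assume "j \<in> subs"
      then show "cut j w x = (if j = i then w x else 0)"
        using vanishes_between[of i j x] False i by (auto simp: cut_def)
    qed simp
    then show ?thesis using i by (simp add: sum_apply_field)
  qed
qed

text \<open>On a segment joining a point of the subdomain closure to a point outside of it, \<open>w\<close> has a
  zero by connectedness, so cutting off preserves the Lipschitz bound.\<close>

lemma seg_lipschitz_cut:
  assumes i: "i \<in> subs"
  shows "seg_lipschitz (Om P) j (\<lambda>x. cut i w x $ l)"
proof -
  let ?A = "closure (subdomain P i)" and ?B = "\<Union>k\<in>subs - {i}. closure (subdomain P k)"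
  obtain M where M: "\<And>x h. closed_segment x (x + h *\<^sub>R axis j 1) \<subseteq> Om P \<Longrightarrow>
      norm (w (x + h *\<^sub>R axis j 1) $ l - w x $ l) \<le> M * \<bar>h\<bar>"
    using w unfolding Vh_iff seg_lipschitz_def by blast
  have cover: "Om P \<subseteq> ?A \<union> ?B" using closure_Om_subset closure_subset i by blast
  have one: "norm (w x $ l) \<le> M * \<bar>h\<bar>"
    if seg: "closed_segment x (x + h *\<^sub>R axis j 1) \<subseteq> Om P"
      and x: "x \<in> ?A" "x + h *\<^sub>R axis j 1 \<notin> ?A" for x h
  proof -
    let ?S = "closed_segment x (x + h *\<^sub>R axis j 1)"
    obtain z where z: "z \<in> ?S" "z \<in> ?A" "z \<in> ?B"
      by (rule closed_segment_crosses[OF _ _ order_trans[OF seg cover] x]) (auto intro: closed_UN)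
    then have wz: "w z = 0" using vanishes_between i by blast
    obtain c where c: "0 \<le> c" "c \<le> 1" "z = (1 - c) *\<^sub>R x + c *\<^sub>R (x + h *\<^sub>R axis j 1)"
      using z(1) by (auto simp: in_segment)
    then have zx: "z = x + (c * h) *\<^sub>R axis j 1" by (simp add: algebra_simps)
    have "closed_segment x z \<subseteq> ?S" using z(1) by (simp add: subset_closed_segment)
    then have "norm (w z $ l - w x $ l) \<le> M * \<bar>c * h\<bar>"
      using M[of x "c * h"] seg zx by auto
    then have le: "norm (w x $ l) \<le> M * (c * \<bar>h\<bar>)" using wz c by (simp add: abs_mult)
    show ?thesis
    \<comment> \<open>The constant may be negative; then h = 0 is the only possibility, and x would
      be both inside and outside \<open>?A\<close>.\<close>
    proof (cases "M \<ge> 0")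
      case True
      then have "M * (c * \<bar>h\<bar>) \<le> M * \<bar>h\<bar>" using c by (intro mult_left_mono) (auto intro: mult_left_le_one_le)
      then show ?thesis using le by linarith
    next
      case False
      have "0 \<le> M * \<bar>h\<bar>" by (rule order_trans[OF norm_ge_zero M[OF seg]])
      then have "h = 0" using False by (auto simp: zero_le_mult_iff)
      then show ?thesis using x by simp
    qed
  qed
  have "norm (cut i w (x + h *\<^sub>R axis j 1) $ l - cut i w x $ l) \<le> M * \<bar>h\<bar>"
    if seg: "closed_segment x (x + h *\<^sub>R axis j 1) \<subseteq> Om P" for x h
  proof -
    let ?y = "x + h *\<^sub>R axis j 1"
    have nn: "0 \<le> M * \<bar>h\<bar>" by (rule order_trans[OF norm_ge_zero M[OF seg]])
    \<comment> \<open>The same estimate read from the other end of the segment, hence the step -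
      h.\<close>
    have "norm (w ?y $ l) \<le> M * \<bar>- h\<bar>" if "?y \<in> ?A" "x \<notin> ?A"
      using one[of ?y "- h"] seg that by (simp add: closed_segment_commute)
    then show ?thesis
      using one[OF seg] M[OF seg] nn by (auto simp: cut_def norm_minus_commute)
  qed
  then show ?thesis unfolding seg_lipschitz_def by blast
qed

text \<open>w vanishes where the closure of subdomain i meets the other closures, so gluing w to
  zero along these closed sets is continuous. Each element lies entirely in one of the two sets,
  which keeps the field piecewise polynomial.\<close>

lemma cut_in_interior_space:
  assumes i: "i \<in> subs"
  shows "cut i w \<in> interior_space P i"
proof -
  let ?A = "closure (subdomain P i)" and ?B = "\<Union>k\<in>subs - {i}. closure (subdomain P k)"
  have w_cont: "continuous_on (closure (Om P)) w" and w_out: "\<And>x. x \<notin> closure (Om P) \<Longrightarrow> w x = 0"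
    and w_pw: "pw_polynomial (mesh P) (deg P) w"
    using w by (auto simp: Vh_iff cont_pw_def)
  have A: "?A \<subseteq> closure (Om P)" by (rule closure_mono[OF subdomain_subset])
  have B: "?B \<subseteq> closure (Om P)" using closure_mono[OF subdomain_subset] by blast
  have cut_B: "cut i w x = 0" if "x \<in> ?B" for x
    using that vanishes_between i by (auto simp: cut_def)
  have "continuous_on (?A \<union> ?B) (cut i w)"
    unfolding cut_def
  proof (rule continuous_on_cases)
    show "closed ?B" by (intro closed_UN) auto
    show "continuous_on ?A w" using w_cont A by (rule continuous_on_subset)
    show "\<forall>x. x \<in> ?A \<and> x \<notin> ?A \<or> x \<in> ?B \<and> x \<in> ?A \<longrightarrow> w x = 0"
      using vanishes_between i by blast
  qed auto
  moreover have "closure (Om P) = ?A \<union> ?B"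
    using closure_Om_subset A B i by blast
  ultimately have "continuous_on (closure (Om P)) (cut i w)" by simp
  moreover have "cut i w x = 0" if "x \<notin> closure (Om P)" for x
    using that A by (auto simp: cut_def)
  moreover have "pw_polynomial (mesh P) (deg P) (cut i w)"
    unfolding pw_polynomial_def
  proof (intro ballI allI)
    fix T l assume T: "T \<in> mesh P"
    then obtain k where k: "k \<in> subs" "T \<in> part P k" using mesh_cases by metis
    have Tk: "T \<subseteq> closure (subdomain P k)" by (rule element_subset_closure_subdomain[OF k])
    show "\<exists>q. polynomial_le (deg P) q \<and> (\<forall>x\<in>T. cut i w x $ l = q x)"
    proof (cases "k = i")
      case True
      then have eq: "cut i w x = w x" if "x \<in> T" for x using Tk that by (auto simp: cut_def)
      obtain q where "polynomial_le (deg P) q" "\<forall>x\<in>T. w x $ l = q x"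
        using w_pw T unfolding pw_polynomial_def by blast
      then show ?thesis by (intro exI[of _ q]) (simp add: eq)
    next
      case False
      then have "cut i w x = 0" if "x \<in> T" for x using Tk k that cut_B by blast
      then show ?thesis by (intro exI[of _ "\<lambda>_. 0"]) (simp add: polynomial_le_zero)
    qed
  qed
  moreover have "\<forall>x\<in>GamD P. cut i w x = 0" using w by (auto simp: Vh_iff cut_def)
  \<comment> \<open>The interior space prescribes zero off the open subdomain, while
    \<open>cut\<close> keeps w on its closure; the boundary points inside the domain belong to
    another closure too, where the cut-off is zero.\<close>
  moreover have "cut i w x = 0" if x: "x \<in> Om P - subdomain P i" for x
    using closure_subdomain_other[OF i, of x] x cut_B by blast
  ultimately show ?thesis
    using seg_lipschitz_cut[OF i] by (auto simp: interior_space_def Vh_iff cont_pw_def)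
qed

end

end

section \<open>Hermitian forms on spaces of fields\<close>

text \<open>A common framework for the energy form and the L2 product. \<open>hermitian\<close> is
  unconditional, because conjugation commutes with the integral whether or not the integrand is
  integrable; additivity needs integrable terms and hence membership in \<open>V\<close>.\<close>

locale hermitian_form =
  fixes V :: "('d::finite) field set" and B :: "'d field \<Rightarrow> 'd field \<Rightarrow> complex"
  assumes subspace: "fld.subspace V"
    and add_left: "v \<in> V \<Longrightarrow> w \<in> V \<Longrightarrow> u \<in> V \<Longrightarrow> B (v + w) u = B v u + B w u"
    and scale_left: "v \<in> V \<Longrightarrow> u \<in> V \<Longrightarrow> B (fscale c v) u = c * B v u"
    and hermitian: "B v u = cnj (B u v)"
    and definite: "v \<in> V \<Longrightarrow> B v v = 0 \<Longrightarrow> v = 0"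
begin

lemma add_right: "v \<in> V \<Longrightarrow> w \<in> V \<Longrightarrow> u \<in> V \<Longrightarrow> B u (v + w) = B u v + B u w"
  using add_left[of v w u] hermitian[of u "v + w"] hermitian[of u v] hermitian[of u w] by simp

lemma scale_right: "v \<in> V \<Longrightarrow> u \<in> V \<Longrightarrow> B u (fscale c v) = cnj c * B u v"
  using scale_left[of v u c] hermitian[of u "fscale c v"] hermitian[of u v] by simp

lemma in_V:
  "0 \<in> V" "v \<in> V \<Longrightarrow> w \<in> V \<Longrightarrow> v + w \<in> V" "v \<in> V \<Longrightarrow> fscale c v \<in> V"
  "v \<in> V \<Longrightarrow> w \<in> V \<Longrightarrow> v - w \<in> V" "(\<And>i. i \<in> I \<Longrightarrow> f i \<in> V) \<Longrightarrow> sum f I \<in> V"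
  using subspace fld.subspace_0 fld.subspace_add fld.subspace_scale fld.subspace_diff fld.subspace_sum
  by metis+

lemma diff_left: "v \<in> V \<Longrightarrow> w \<in> V \<Longrightarrow> u \<in> V \<Longrightarrow> B (v - w) u = B v u - B w u"
  using add_left[of "v - w" w u] in_V by simp

lemma zero_left: "u \<in> V \<Longrightarrow> B 0 u = 0"
  using scale_left[of 0 u 0] in_V(1) by (simp add: fscale_def zero_fun_def)

lemma zero_right: "u \<in> V \<Longrightarrow> B u 0 = 0"
  using zero_left[of u] hermitian[of u 0] by simp

lemma sum_left: "(\<And>i. i \<in> I \<Longrightarrow> f i \<in> V) \<Longrightarrow> u \<in> V \<Longrightarrow> B (sum f I) u = (\<Sum>i\<in>I. B (f i) u)"
  by (induction I rule: infinite_finite_induct) (auto simp: zero_left add_left in_V)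

lemma sum_right: "(\<And>i. i \<in> I \<Longrightarrow> f i \<in> V) \<Longrightarrow> u \<in> V \<Longrightarrow> B u (sum f I) = (\<Sum>i\<in>I. B u (f i))"
  by (induction I rule: infinite_finite_induct) (auto simp: zero_right add_right in_V)

lemma orthogonal_span:
  assumes "S \<subseteq> V" "u \<in> V" "\<And>s. s \<in> S \<Longrightarrow> B u s = 0" "v \<in> fld.span S"
  shows "B u v = 0"
proof -
  have "fld.subspace {v \<in> V. B u v = 0}"
    using assms(2) by (auto simp: fld.subspace_def in_V zero_right add_right scale_right)
  then have "fld.span S \<subseteq> {v \<in> V. B u v = 0}"
    using assms by (intro fld.span_minimal) auto
  then show ?thesis using assms(4) by blast
qed

text \<open>Gram-Schmidt inside an induction. The hypothesis is used for \<open>L\<close> and also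
  for \<open>B x\<close>, whose representative is the orthogonal projection of x onto the old span,
  so \<open>L\<close> stays arbitrary. It is conjugate-linear to match the second argument of
  \<open>B\<close>.\<close>

lemma riesz:
  assumes "finite S" "S \<subseteq> V"
    and "\<And>v w. v \<in> V \<Longrightarrow> w \<in> V \<Longrightarrow> L (v + w) = L v + L w"
    and "\<And>v c. v \<in> V \<Longrightarrow> L (fscale c v) = cnj c * L v"
  shows "\<exists>r\<in>fld.span S. \<forall>v\<in>fld.span S. B r v = L v"
  using assms
proof (induction S arbitrary: L rule: finite_induct)
  case empty
  have "L 0 = 0" using empty.prems(3)[OF in_V(1), of 0, unfolded fld.scale_zero_left]
    by (simp add: zero_fun_def)
  then show ?case using zero_left[OF in_V(1)] by (simp add: zero_fun_def)
next
  case (insert x S)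
  have x: "x \<in> V" and S: "S \<subseteq> V" using insert.prems(1) by auto
  have span_V: "fld.span S \<subseteq> V" by (rule fld.span_minimal[OF S subspace])
  obtain p where p: "p \<in> fld.span S" "\<And>v. v \<in> fld.span S \<Longrightarrow> B p v = B x v"
    using insert.IH[of "B x"] S x add_right scale_right by blast
  define y where "y = x - p"
  have y: "y \<in> V" using x p span_V in_V by (auto simp: y_def)
  have y_orth: "B y v = 0" if "v \<in> fld.span S" for v
    using diff_left[of x p v] that p x span_V unfolding y_def by auto
  show ?case
  proof (cases "x \<in> fld.span S")
    case True
    then show ?thesis using insert.IH[of L] insert.prems S by (simp add: fld.span_redundant)
  next
    case False
    \<comment> \<open>If y were zero, x = p would already belong to the old span.\<close>
    have "B y y \<noteq> 0" using definite[OF y] False p by (auto simp: y_def)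
    obtain r where r: "r \<in> fld.span S" "\<And>v. v \<in> fld.span S \<Longrightarrow> B r v = L v"
      using insert.IH[of L] insert.prems S by blast
    \<comment> \<open>Since y is orthogonal to the old span, the correction leaves the values there
      unchanged, and c is the coefficient that yields L y when tested with y.\<close>
    define c where "c = L y / B y y"
    have span_mono: "fld.span S \<subseteq> fld.span (insert x S)" by (intro fld.span_mono) auto
    have rV: "r \<in> V" using r span_V by auto
    have "r + fscale c y \<in> fld.span (insert x S)"
      unfolding y_def using r p span_mono
      by (intro fld.span_add fld.span_scale fld.span_diff) (auto intro: fld.span_base)
    moreover have "B (r + fscale c y) v = L v" if v: "v \<in> fld.span (insert x S)" for v
    proof -
      obtain k where k: "v - fscale k x \<in> fld.span S"
        using v fld.span_breakdown_eq by blast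
      \<comment> \<open>The decomposition v = s + k y with s in the old span: replacing x by y + p
        adds the term k p to v - k x.\<close>
      define s where "s = v - fscale k x + fscale k p"
      have s: "s \<in> fld.span S" unfolding s_def using k p by (intro fld.span_add fld.span_scale)
      have sV: "s \<in> V" using s span_V by auto
      have v_eq: "v = s + fscale k y"
        by (simp add: s_def y_def fscale_def fun_eq_iff vec_eq_iff algebra_simps)
      have "B r y = 0" using y_orth[OF r(1)] hermitian[of r y] by simp
      then have "B (r + fscale c y) v = L s + c * (cnj k * B y y)"
        unfolding v_eq using r s sV rV y y_orth[OF s]
        by (simp add: add_left add_right scale_left scale_right in_V)
      also have "\<dots> = L s + cnj k * L y"
        using \<open>B y y \<noteq> 0\<close> by (simp add: c_def)
      also have "\<dots> = L v"
        unfolding v_eq by (simp only: insert.prems(2)[OF sV in_V(3)[OF y]] insert.prems(3)[OF y])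
      finally show ?thesis .
    qed
    ultimately show ?thesis by blast
  qed
qed

end

section \<open>Elasticity form and L2 product as Hermitian forms\<close>

context partitioned_problem
begin

text \<open>Essentially bounded functions are closed under sums, products and conjugation and are
  integrable on a domain of finite measure. The integrands of both forms are built in this
  way.\<close>

definition essb :: "(real^'d \<Rightarrow> complex) \<Rightarrow> bool" where
  "essb f \<longleftrightarrow> f \<in> borel_measurable (lebesgue_on (Om P)) \<and>
    (\<exists>M. AE x in lebesgue_on (Om P). norm (f x) \<le> M)"

lemma essb_integrable: "essb f \<Longrightarrow> integrable (lebesgue_on (Om P)) f"
  unfolding essb_def using integrable_bounded by blast

lemma essb_add:
  assumes "essb f" "essb g"
  shows "essb (\<lambda>x. f x + g x)"
proof -
  obtain M N where "AE x in lebesgue_on (Om P). norm (f x) \<le> M" "AE x in lebesgue_on (Om P). norm (g x) \<le> N"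
    using assms by (auto simp: essb_def)
  then have "AE x in lebesgue_on (Om P). norm (f x + g x) \<le> M + N"
    by eventually_elim (rule norm_triangle_mono)
  then show ?thesis using assms by (auto simp: essb_def)
qed

lemma essb_mult:
  assumes "essb f" "essb g"
  shows "essb (\<lambda>x. f x * g x)"
proof -
  obtain M N where "AE x in lebesgue_on (Om P). norm (f x) \<le> M" "AE x in lebesgue_on (Om P). norm (g x) \<le> N"
    using assms by (auto simp: essb_def)
  then have "AE x in lebesgue_on (Om P). norm (f x * g x) \<le> M * N"
    by eventually_elim (auto simp: norm_mult intro: mult_mono order_trans[OF norm_ge_zero])
  then show ?thesis using assms by (auto simp: essb_def)
qed

lemma essb_const: "essb (\<lambda>x. c)"
  by (auto simp: essb_def)

lemma essb_cnj: "essb f \<Longrightarrow> essb (\<lambda>x. cnj (f x))"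
  using measurable_compose[OF _ borel_measurable_continuous_onI[OF continuous_on_cnj[OF continuous_on_id]]]
  by (auto simp: essb_def)

lemma essb_sum: "(\<And>i. i \<in> I \<Longrightarrow> essb (f i)) \<Longrightarrow> essb (\<lambda>x. \<Sum>i\<in>I. f i x)"
  by (induction I rule: infinite_finite_induct) (auto intro: essb_const essb_add)

lemma essb_of_real: "ess_bounded (lebesgue_on (Om P)) u \<Longrightarrow> essb (\<lambda>x. of_real (u x))"
  by (auto simp: essb_def ess_bounded_def)

lemma essb_coeffs: "essb (\<lambda>x. of_real (mu P x))" "essb (\<lambda>x. of_real (kap P x))"
  using setting by (auto simp: elasticity_setting_def intro: essb_of_real)

lemma Vh_pw: "v \<in> Vh P \<Longrightarrow> pw_polynomial (mesh P) (deg P) v"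
  by (simp add: Vh_iff cont_pw_def)

lemma essb_component: "v \<in> Vh P \<Longrightarrow> essb (\<lambda>x. v x $ i)"
proof -
  assume "v \<in> Vh P"
  then have v: "cont_pw (deg P) v" by (rule Vh_cont_pw)
  obtain C where "\<And>x. norm (v x) \<le> C" using cont_pw_bounded[OF v] by metis
  then have "AE x in lebesgue_on (Om P). norm (v x $ i) \<le> C"
    by (intro AE_I2 order_trans[OF Finite_Cartesian_Product.norm_nth_le])
  then show ?thesis using cont_pw_component_lebesgue_on[OF v] by (auto simp: essb_def)
qed

lemma essb_partial: "v \<in> Vh P \<Longrightarrow> essb (partial j v i)"
  unfolding essb_def using partial_measurable[OF Vh_pw] partial_AE_bounded[OF Vh_pw] by metis

lemma essb_strain: "v \<in> Vh P \<Longrightarrow> essb (\<lambda>x. strain v x i j)"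
  unfolding strain_def divide_inverse by (intro essb_mult essb_add essb_partial essb_const)

lemma essb_divergence: "v \<in> Vh P \<Longrightarrow> essb (divergence v)"
  unfolding divergence_def[abs_def] by (intro essb_sum essb_partial)

definition mu_integrand :: "'d field \<Rightarrow> 'd field \<Rightarrow> real^'d \<Rightarrow> complex" where
  "mu_integrand v w x = of_real (mu P x) * (\<Sum>i\<in>UNIV. \<Sum>j\<in>UNIV. strain v x i j * cnj (strain w x i j))"

definition kap_integrand :: "'d field \<Rightarrow> 'd field \<Rightarrow> real^'d \<Rightarrow> complex" where
  "kap_integrand v w x = of_real (kap P x) * divergence v x * cnj (divergence w x)"

lemma a_form_integrands:
  "a_form P v w = 2 * (\<integral>x. mu_integrand v w x \<partial>lebesgue_on (Om P))
    + (\<integral>x. kap_integrand v w x \<partial>lebesgue_on (Om P))"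
  by (simp add: a_form_def elasticity_form_def mu_integrand_def kap_integrand_def)

lemma essb_integrands:
  "v \<in> Vh P \<Longrightarrow> w \<in> Vh P \<Longrightarrow> essb (mu_integrand v w)"
  "v \<in> Vh P \<Longrightarrow> w \<in> Vh P \<Longrightarrow> essb (kap_integrand v w)"
  unfolding mu_integrand_def[abs_def] kap_integrand_def[abs_def]
  by (intro essb_mult essb_coeffs essb_sum essb_cnj essb_strain essb_divergence; assumption)+

text \<open>Confined to the mesh interior, where all derivatives exist; elsewhere the values of
  \<open>partial\<close> may be unspecified and need not add up.\<close>

lemma partial_add:
  assumes "v \<in> Vh P" "w \<in> Vh P" "x \<in> mesh_interior (mesh P)"
  shows "partial j (v + w) i x = partial j v i x + partial j w i x"
proof -
  have "((\<lambda>x. v x + w x) has_derivative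
      (\<lambda>h. frechet_derivative v (at x) h + frechet_derivative w (at x) h)) (at x)"
    by (intro has_derivative_add pw_polynomial_has_derivative[OF Vh_pw] assms)
  then show ?thesis by (simp add: partial_def plus_fun_def frechet_derivative_at[symmetric])
qed

lemma partial_scale:
  assumes "v \<in> Vh P" "x \<in> mesh_interior (mesh P)"
  shows "partial j (fscale c v) i x = c * partial j v i x"
proof -
  have "((\<lambda>x. fscale c v x $ k) has_derivative (\<lambda>h. c * frechet_derivative v (at x) h $ k)) (at x)" for k
    unfolding fscale_def vector_smult_component
    by (intro has_derivative_mult_right partial_component_derivative pw_polynomial_has_derivative[OF Vh_pw] assms)
  from has_derivative_vec_components[OF this]
  show ?thesis by (simp add: partial_def frechet_derivative_at[symmetric])
qed

lemma integral_cong_mesh: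
  assumes "essb f" "essb g" "\<And>x. x \<in> mesh_interior (mesh P) \<Longrightarrow> f x = g x"
  shows "integral\<^sup>L (lebesgue_on (Om P)) f = integral\<^sup>L (lebesgue_on (Om P)) g"
  using assms by (intro integral_cong_AE eventually_mono[OF mesh_interior_AE]) (auto simp: essb_def)

lemma Vh_add: "v \<in> Vh P \<Longrightarrow> w \<in> Vh P \<Longrightarrow> v + w \<in> Vh P"
  and Vh_scale: "v \<in> Vh P \<Longrightarrow> fscale c v \<in> Vh P"
  using subspace_Vh by (auto simp: fld.subspace_def)

lemma strain_add:
  assumes "v \<in> Vh P" "w \<in> Vh P" "x \<in> mesh_interior (mesh P)"
  shows "strain (v + w) x i j = strain v x i j + strain w x i j"
    and "divergence (v + w) x = divergence v x + divergence w x"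
  using partial_add[OF assms] by (simp_all add: strain_def divergence_def add_divide_distrib sum.distrib)

lemma strain_scale:
  assumes "v \<in> Vh P" "x \<in> mesh_interior (mesh P)"
  shows "strain (fscale c v) x i j = c * strain v x i j"
    and "divergence (fscale c v) x = c * divergence v x"
  using partial_scale[OF assms] by (simp_all add: strain_def divergence_def sum_distrib_left distrib_left)

lemma a_form_add:
  assumes "v \<in> Vh P" "w \<in> Vh P" "u \<in> Vh P"
  shows "a_form P (v + w) u = a_form P v u + a_form P w u"
proof -
  have "(\<integral>x. mu_integrand (v + w) u x \<partial>lebesgue_on (Om P))
      = (\<integral>x. mu_integrand v u x + mu_integrand w u x \<partial>lebesgue_on (Om P))"
    by (intro integral_cong_mesh essb_add essb_integrands Vh_add assms)
       (simp add: mu_integrand_def strain_add assms algebra_simps sum.distrib)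
  moreover have "(\<integral>x. kap_integrand (v + w) u x \<partial>lebesgue_on (Om P))
      = (\<integral>x. kap_integrand v u x + kap_integrand w u x \<partial>lebesgue_on (Om P))"
    by (intro integral_cong_mesh essb_add essb_integrands Vh_add assms)
       (simp add: kap_integrand_def strain_add assms algebra_simps)
  ultimately show ?thesis
    using assms by (simp add: a_form_integrands essb_integrable essb_integrands algebra_simps)
qed

lemma a_form_scale:
  assumes "v \<in> Vh P" "u \<in> Vh P"
  shows "a_form P (fscale c v) u = c * a_form P v u"
proof -
  have "(\<integral>x. mu_integrand (fscale c v) u x \<partial>lebesgue_on (Om P))
      = (\<integral>x. c * mu_integrand v u x \<partial>lebesgue_on (Om P))"
    by (intro integral_cong_mesh essb_mult essb_const essb_integrands Vh_scale assms)
       (simp add: mu_integrand_def strain_scale assms sum_distrib_left algebra_simps)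
  moreover have "(\<integral>x. kap_integrand (fscale c v) u x \<partial>lebesgue_on (Om P))
      = (\<integral>x. c * kap_integrand v u x \<partial>lebesgue_on (Om P))"
    by (intro integral_cong_mesh essb_mult essb_const essb_integrands Vh_scale assms)
       (simp add: kap_integrand_def strain_scale assms)
  ultimately show ?thesis by (simp add: a_form_integrands algebra_simps)
qed

lemma a_form_hermitian: "a_form P v u = cnj (a_form P u v)"
proof -
  have "mu_integrand v u x = cnj (mu_integrand u v x)" "kap_integrand v u x = cnj (kap_integrand u v x)" for x
    by (simp_all add: mu_integrand_def kap_integrand_def mult_ac)
  then show ?thesis by (simp add: a_form_integrands)
qed

lemma a_form_zero_disjoint:
  assumes "\<And>x i j. x \<in> mesh_interior (mesh P) \<Longrightarrow> partial j v i x = 0 \<or> (\<forall>k l. partial k w l x = 0)"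
    and "v \<in> Vh P" "w \<in> Vh P"
  shows "a_form P v w = 0"
proof -
  have *: "(\<forall>i j. partial j v i x = 0) \<or> (\<forall>i j. partial j w i x = 0)"
    if "x \<in> mesh_interior (mesh P)" for x
    using assms(1)[OF that] by blast
  have "(\<integral>x. mu_integrand v w x \<partial>lebesgue_on (Om P)) = (\<integral>x. 0 \<partial>lebesgue_on (Om P))"
    by (intro integral_cong_mesh essb_const essb_integrands assms)
       (use * in \<open>fastforce simp: mu_integrand_def strain_def\<close>)
  moreover have "(\<integral>x. kap_integrand v w x \<partial>lebesgue_on (Om P)) = (\<integral>x. 0 \<partial>lebesgue_on (Om P))"
    by (intro integral_cong_mesh essb_const essb_integrands assms)
       (use * in \<open>fastforce simp: kap_integrand_def divergence_def\<close>)
  ultimately show ?thesis by (simp add: a_form_integrands)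
qed

lemma ip_add:
  assumes "v \<in> Vh P" "w \<in> Vh P" "u \<in> Vh P"
  shows "ip P (v + w) u = ip P v u + ip P w u"
proof -
  have "essb (\<lambda>x. \<Sum>i\<in>UNIV. y x $ i * cnj (u x $ i))" if "y \<in> Vh P" for y
    by (intro essb_sum essb_mult essb_cnj essb_component that assms)
  then show ?thesis
    using assms by (simp add: ip_def l2_inner_def distrib_right sum.distrib essb_integrable)
qed

lemma ip_scale: "ip P (fscale c v) u = c * ip P v u"
  by (simp add: ip_def l2_inner_def fscale_def mult.assoc sum_distrib_left[symmetric])

lemma ip_hermitian: "ip P v u = cnj (ip P u v)"
proof -
  have "(\<Sum>i\<in>UNIV. v x $ i * cnj (u x $ i)) = cnj (\<Sum>i\<in>UNIV. u x $ i * cnj (v x $ i))" for x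
    by (simp add: mult.commute)
  then show ?thesis by (simp only: ip_def l2_inner_def Bochner_Integration.integral_cnj)
qed

text \<open>By continuity the zero set within the closed domain is closed, and a closed set
  containing almost all of an open set contains all of it. Outside the closure the representatives
  are zero.\<close>

lemma AE_zero_imp_zero:
  assumes v: "v \<in> Vh P" and "AE x in lebesgue_on (Om P). v x = 0"
  shows "v = 0"
proof -
  let ?C = "closure (Om P) \<inter> v -` {0}"
  have cont: "continuous_on (closure (Om P)) v" "\<And>x. x \<notin> closure (Om P) \<Longrightarrow> v x = 0"
    using v by (auto simp: Vh_iff cont_pw_def)
  have closed: "closed ?C" by (intro continuous_closed_preimage cont(1)) auto
  have "AE x in lebesgue. x \<in> Om P \<longrightarrow> v x = 0"
    using assms(2) \<Omega>_sets by (simp add: AE_restrict_space_iff)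
  then have "AE x in lebesgue. x \<in> Om P \<longrightarrow> x \<in> ?C"
    by eventually_elim (use closure_subset in auto)
  then have "x \<in> ?C" if "x \<in> Om P" for x
    using that mem_closed_if_AE_lebesgue_open[OF \<Omega>(1) closed] by blast
  then have "closure (Om P) \<subseteq> ?C" by (intro closure_minimal closed) auto
  then show ?thesis using cont(2) by (auto simp: fun_eq_iff)
qed

lemma ip_definite:
  assumes v: "v \<in> Vh P" and "ip P v v = 0"
  shows "v = 0"
proof -
  \<comment> \<open>Integrability has to come before the vanishing integral is exploited, as a
    nonintegrable function has integral 0 by convention.\<close>
  have e: "essb (\<lambda>x. \<Sum>i\<in>UNIV. v x $ i * cnj (v x $ i))"
    by (intro essb_sum essb_mult essb_cnj essb_component v)
  have eq: "(\<Sum>i\<in>UNIV. v x $ i * cnj (v x $ i)) = of_real (\<Sum>i\<in>UNIV. (norm (v x $ i))\<^sup>2)" for x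
    unfolding complex_norm_square[symmetric] by simp
  have "integrable (lebesgue_on (Om P)) (\<lambda>x. complex_of_real (\<Sum>i\<in>UNIV. (norm (v x $ i))\<^sup>2))"
    using essb_integrable[OF e] unfolding eq .
  then have int: "integrable (lebesgue_on (Om P)) (\<lambda>x. \<Sum>i\<in>UNIV. (norm (v x $ i))\<^sup>2)"
    by (rule complex_of_real_integrable_eq[THEN iffD1])
  have "(\<integral>x. (\<Sum>i\<in>UNIV. (norm (v x $ i))\<^sup>2) \<partial>lebesgue_on (Om P)) = 0"
    using assms(2) unfolding ip_def l2_inner_def eq integral_complex_of_real of_real_eq_0_iff .
  then have "AE x in lebesgue_on (Om P). (\<Sum>i\<in>UNIV. (norm (v x $ i))\<^sup>2) = 0"
    using integral_nonneg_eq_0_iff_AE[OF int] by (simp add: sum_nonneg)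
  then have "AE x in lebesgue_on (Om P). v x = 0"
    by eventually_elim (simp add: sum_nonneg_eq_0_iff vec_eq_iff)
  then show ?thesis by (rule AE_zero_imp_zero[OF v])
qed

text \<open>A vanishing integral of nonnegative terms forces |v|^2 to be zero almost everywhere;
  continuity turns this into v = 0.\<close>

lemma h1_norm_zero:
  assumes v: "v \<in> Vh P" and "h1_norm (Om P) v = 0"
  shows "v = 0"
proof -
  let ?f = "\<lambda>x. (norm (v x))\<^sup>2 + (\<Sum>i\<in>UNIV. \<Sum>j\<in>UNIV. (norm (partial j v i x))\<^sup>2)"
  have eq: "complex_of_real (?f x) = (\<Sum>i\<in>UNIV. v x $ i * cnj (v x $ i))
      + (\<Sum>i\<in>UNIV. \<Sum>j\<in>UNIV. partial j v i x * cnj (partial j v i x))" for x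
    unfolding complex_norm_square[symmetric] by (simp add: norm_vec_def L2_set_def sum_nonneg)
  have "essb (\<lambda>x. complex_of_real (?f x))"
    unfolding eq by (intro essb_add essb_sum essb_mult essb_cnj essb_component essb_partial v)
  then have int: "integrable (lebesgue_on (Om P)) ?f"
    by (rule complex_of_real_integrable_eq[THEN iffD1, OF essb_integrable])
  have nn: "0 \<le> ?f x" for x by (simp add: sum_nonneg)
  have "integral\<^sup>L (lebesgue_on (Om P)) ?f = 0"
    using assms(2) by (simp add: h1_norm_def)
  then have "AE x in lebesgue_on (Om P). ?f x = 0"
    using integral_nonneg_eq_0_iff_AE[OF int] nn by simp
  then have "AE x in lebesgue_on (Om P). v x = 0"
  proof eventually_elim
    case (elim x)
    then show ?case
      by (subst (asm) add_nonneg_eq_0_iff) (auto simp: sum_nonneg)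
  qed
  then show ?thesis by (rule AE_zero_imp_zero[OF v])
qed

lemma a_form_definite:
  assumes "form_bounded_coercive P" and v: "v \<in> Vh P" and "a_form P v v = 0"
  shows "v = 0"
proof -
  obtain c where "c > 0" "c * (h1_norm (Om P) v)\<^sup>2 \<le> Re (a_form P v v)"
    using assms(1) v by (auto simp: form_bounded_coercive_def)
  then have "(h1_norm (Om P) v)\<^sup>2 \<le> 0" using assms(3) by (simp add: mult_le_0_iff)
  then have "h1_norm (Om P) v = 0" by simp
  then show ?thesis by (rule h1_norm_zero[OF v])
qed

lemma hermitian_form_ip: "hermitian_form (Vh P) (ip P)"
  by unfold_locales (auto simp: subspace_Vh ip_add ip_scale ip_definite intro: ip_hermitian)

lemma hermitian_form_a: "form_bounded_coercive P \<Longrightarrow> hermitian_form (Vh P) (a_form P)"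
  by unfold_locales
     (auto simp: subspace_Vh a_form_add a_form_scale a_form_definite intro: a_form_hermitian)

end

section \<open>Component mode synthesis\<close>

locale cms = partitioned_problem P for P :: "('d::finite) elasticity_problem" +
  fixes \<Lambda> :: "nat \<Rightarrow> nat \<Rightarrow> real" and Z :: "nat \<Rightarrow> nat \<Rightarrow> 'd field"
  assumes coercive: "form_bounded_coercive P" and eigen: "component_eigenpairs P \<Lambda> Z"

sublocale cms \<subseteq> a: hermitian_form "Vh P" "a_form P"
  using coercive by (rule hermitian_form_a)

sublocale cms \<subseteq> l2: hermitian_form "Vh P" "ip P"
  by (rule hermitian_form_ip)

context cms
begin

lemma span_modes: "i \<in> {0..nsub P} \<Longrightarrow> fld.span (Z i ` {1..comp_dim P i}) = comp_space P i"
  using eigen by (auto simp: component_eigenpairs_def)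

lemma comp_space_pos: "i \<in> subs \<Longrightarrow> comp_space P i = interior_space P i"
  by (auto simp: comp_space_def)

text \<open>On each element interior at least one of the two fields is identically zero, so at every
  point of the mesh interior one of the two gradients vanishes.\<close>

lemma interior_spaces_orthogonal:
  assumes ij: "i \<in> subs" "j \<in> subs" "i \<noteq> j" and v: "v \<in> interior_space P i" and w: "w \<in> interior_space P j"
  shows "a_form P v w = 0"
proof (rule a_form_zero_disjoint)
  have zero: "partial l u n x = 0"
    if u: "u \<in> interior_space P k" "k \<in> subs" and T: "T \<in> part P k'" "k' \<in> subs" "k' \<noteq> k" "x \<in> interior T"
    for u k k' T x l n
  proof -
    have "u y = 0" if "y \<in> interior T" for y
      using interior_space_vanishes[OF u(1,2) T(2)] T that interior_subset_subdomain[OF T(2,1)]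
        closure_subset by blast
    then have "(u has_derivative (\<lambda>h. 0)) (at x)"
      by (intro has_derivative_transform_within_open[OF has_derivative_const[of 0] open_interior T(4)])
         simp
    then show ?thesis by (simp add: partial_def frechet_derivative_at[symmetric])
  qed
  show "partial l v n x = 0 \<or> (\<forall>k m. partial k w m x = 0)"
    if x: "x \<in> mesh_interior (mesh P)" for x l n
  proof -
    obtain T where T: "T \<in> mesh P" "x \<in> interior T" using x by (auto simp: mesh_interior_def)
    obtain k where k: "k \<in> subs" "T \<in> part P k" using mesh_cases[OF T(1)] by metis
    show ?thesis
      using zero[OF v ij(1) k(2,1) _ T(2)] zero[OF w ij(2) k(2,1) _ T(2)] ij(3) by metis
  qed
qed (use v w interior_space_subset in auto)

text \<open>The Riesz representative, in the energy form, of the functional u -> a(v, u) on the span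
  of the modes of component i.\<close>

lemma interior_projection:
  assumes i: "i \<in> subs" and v: "v \<in> Vh P"
  obtains p where "p \<in> interior_space P i" "\<And>u. u \<in> interior_space P i \<Longrightarrow> a_form P p u = a_form P v u"
proof -
  let ?S = "Z i ` {1..comp_dim P i}"
  have span: "fld.span ?S = interior_space P i"
    using span_modes[of i] comp_space_pos[OF i] i by auto
  then have "?S \<subseteq> Vh P" using fld.span_superset[of ?S] interior_space_subset by blast
  from a.riesz[OF _ this, of "a_form P v"] show ?thesis
    using that v span a.add_right a.scale_right by auto
qed

section \<open>Energy extension and decomposition of the finite element space\<close>

definition is_extension :: "'d field \<Rightarrow> (real^'d \<Rightarrow> complex^'d) \<Rightarrow> bool" where
  "is_extension w \<nu> \<longleftrightarrow> w \<in> Vh P \<and> (\<forall>i\<in>subs. \<forall>v\<in>interior_space P i. a_form P w v = 0) \<and>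
     restrict w (interface P) = \<nu>"

text \<open>Subtracting from v its energy projections onto all interior spaces works for all of them
  at once, because these spaces are mutually orthogonal. The trace is unchanged, since interior
  fields vanish on the interface.\<close>

lemma extension_exists:
  assumes v: "v \<in> Vh P"
  obtains w q where "is_extension w (restrict v (interface P))"
    "\<And>i. i \<in> subs \<Longrightarrow> q i \<in> interior_space P i" "v = w + (\<Sum>i\<in>subs. q i)"
proof -
  have "\<exists>p. \<forall>i\<in>subs. p i \<in> interior_space P i \<and>
      (\<forall>u\<in>interior_space P i. a_form P (p i) u = a_form P v u)"
    using interior_projection[OF _ v] by (intro bchoice) metis
  then obtain p where p: "\<And>i. i \<in> subs \<Longrightarrow> p i \<in> interior_space P i"
    "\<And>i u. i \<in> subs \<Longrightarrow> u \<in> interior_space P i \<Longrightarrow> a_form P (p i) u = a_form P v u"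
    by blast
  have pV: "p i \<in> Vh P" if "i \<in> subs" for i using p(1)[OF that] interior_space_subset by auto
  define w where "w = v - (\<Sum>i\<in>subs. p i)"
  have sumV: "(\<Sum>i\<in>subs. p i) \<in> Vh P" by (rule a.in_V(5)) (rule pV)
  have "w \<in> Vh P" unfolding w_def by (intro a.in_V v sumV)
  moreover have "a_form P w u = 0" if i: "i \<in> subs" and u: "u \<in> interior_space P i" for i u
  proof -
    have uV: "u \<in> Vh P" using u interior_space_subset by auto
    have "a_form P (\<Sum>j\<in>subs. p j) u = (\<Sum>j\<in>subs. a_form P (p j) u)"
      by (rule a.sum_left) (use pV uV in auto)
    also have "\<dots> = (\<Sum>j\<in>subs. if j = i then a_form P v u else 0)"
      using p i u interior_spaces_orthogonal[OF _ i _ p(1) u]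
      by (intro sum.cong) auto
    also have "\<dots> = a_form P v u" using i by simp
    finally show ?thesis unfolding w_def using v sumV uV by (simp add: a.diff_left)
  qed
  moreover have "restrict w (interface P) = restrict v (interface P)"
  proof
    fix x
    have "(\<Sum>i\<in>subs. p i) x = 0" if "x \<in> interface P"
      unfolding sum_apply_field using interior_space_vanishes_interface[OF p(1)] that
      by (intro sum.neutral) auto
    then show "restrict w (interface P) x = restrict v (interface P) x"
      by (simp add: w_def restrict_def)
  qed
  ultimately have "is_extension w (restrict v (interface P))" by (auto simp: is_extension_def)
  moreover have "v = w + (\<Sum>i\<in>subs. p i)" by (simp add: w_def)
  ultimately show ?thesis using that p(1) by blast
qed

text \<open>The difference d vanishes on the interface, hence is the sum of its cut-offs. These lie
  in the interior spaces, to which d is orthogonal, so a(d, d) = 0.\<close>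

lemma extension_unique:
  assumes "is_extension w \<nu>" "is_extension w' \<nu>"
  shows "w = w'"
proof -
  define d where "d = w - w'"
  have V: "w \<in> Vh P" "w' \<in> Vh P" using assms by (auto simp: is_extension_def)
  then have d: "d \<in> Vh P" unfolding d_def by (intro a.in_V)
  have orth: "a_form P d v = 0" if "i \<in> subs" "v \<in> interior_space P i" for i v
    using assms that V interior_space_subset unfolding d_def is_extension_def
    by (subst a.diff_left) auto
  have dz: "d x = 0" if "x \<in> interface P" for x
    using assms that unfolding d_def is_extension_def by (metis diff_self minus_apply restrict_apply')
  have cut: "cut i d \<in> interior_space P i" if "i \<in> subs" for i
    by (rule cut_in_interior_space[OF d dz that])
  have "a_form P d d = a_form P d (\<Sum>i\<in>subs. cut i d)" using sum_cut[OF d dz] by simp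
  also have "\<dots> = (\<Sum>i\<in>subs. a_form P d (cut i d))"
    by (rule a.sum_right) (use cut interior_space_subset d in auto)
  also have "\<dots> = 0" using orth cut by (intro sum.neutral) auto
  finally have "d = 0" using a.definite[OF d] by blast
  then show ?thesis by (simp add: d_def)
qed

lemma energy_extension_eq:
  assumes "is_extension w \<nu>"
  shows "energy_extension P \<nu> = w"
  unfolding energy_extension_def
  by (rule the_equality) (use assms extension_unique in \<open>auto simp: is_extension_def\<close>)

lemma comp_space_0:
  assumes "w \<in> comp_space P 0"
  shows "w \<in> Vh P" "\<And>i v. i \<in> subs \<Longrightarrow> v \<in> interior_space P i \<Longrightarrow> a_form P w v = 0"
proof -
  obtain v where v: "v \<in> Vh P" "w = energy_extension P (restrict v (interface P))"
    using assms by (auto simp: comp_space_def trace_space_def)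
  obtain u where u: "is_extension u (restrict v (interface P))" using extension_exists[OF v(1)] by metis
  then have "w = u" using v energy_extension_eq by simp
  then show "w \<in> Vh P" "\<And>i v. i \<in> subs \<Longrightarrow> v \<in> interior_space P i \<Longrightarrow> a_form P w v = 0"
    using u by (auto simp: is_extension_def)
qed

lemma comp_space_subset: "comp_space P i \<subseteq> Vh P"
  using comp_space_0(1) interior_space_subset by (cases "i = 0") (auto simp: comp_space_def)

lemma comp_spaces_orthogonal:
  assumes ij: "i \<in> {0..nsub P}" "j \<in> {0..nsub P}" "i \<noteq> j"
    and v: "v \<in> comp_space P i" and w: "w \<in> comp_space P j"
  shows "a_form P v w = 0"
proof -
  consider "i = 0" "j \<in> subs" | "j = 0" "i \<in> subs" | "i \<in> subs" "j \<in> subs"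
    using ij by fastforce
  then show ?thesis
  proof cases
    case 1
    then show ?thesis using v w comp_space_0(2) comp_space_pos by auto
  next
    case 2
    then have "a_form P w v = 0" using v w comp_space_0(2) comp_space_pos by auto
    then show ?thesis using a.hermitian[of v w] by simp
  next
    case 3
    then show ?thesis using v w ij(3) interior_spaces_orthogonal comp_space_pos by auto
  qed
qed

lemma Vh_decomposition:
  assumes v: "v \<in> Vh P"
  obtains q where "\<And>i. i \<in> {0..nsub P} \<Longrightarrow> q i \<in> comp_space P i" "v = (\<Sum>i=0..nsub P. q i)"
proof -
  obtain w q where w: "is_extension w (restrict v (interface P))"
    and q: "\<And>i. i \<in> subs \<Longrightarrow> q i \<in> interior_space P i" and eq: "v = w + (\<Sum>i\<in>subs. q i)"
    using extension_exists[OF v] by metis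
  have "w \<in> comp_space P 0"
    using energy_extension_eq[OF w] v by (auto simp: comp_space_def trace_space_def)
  then show ?thesis
    using q eq comp_space_pos
    by (intro that[of "\<lambda>i. if i = 0 then w else q i"])
       (auto simp: sum.atLeast_Suc_atMost)
qed

section \<open>Ritz projections and eigenmodes\<close>

lemma ritz_eqI:
  assumes i: "i \<in> {0..nsub P}" and w: "w \<in> Vh P" and r: "r \<in> comp_space P i"
    and orth: "\<And>v. v \<in> comp_space P i \<Longrightarrow> a_form P (w - r) v = 0"
  shows "ritz P i w = r"
  unfolding ritz_def
proof (rule the_equality)
  fix r' assume r': "r' \<in> comp_space P i \<and> (\<forall>v\<in>comp_space P i. a_form P (w - r') v = 0)"
  define d where "d = r - r'"
  have sub: "fld.subspace (comp_space P i)" using span_modes[OF i] fld.subspace_span by metis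
  then have d: "d \<in> comp_space P i" unfolding d_def using r r' by (intro fld.subspace_diff) auto
  have V: "r \<in> Vh P" "r' \<in> Vh P" "d \<in> Vh P" using r r' d comp_space_subset by auto
  have "a_form P d d = a_form P ((w - r') - (w - r)) d" by (simp add: d_def)
  also have "\<dots> = a_form P (w - r') d - a_form P (w - r) d"
    by (intro a.diff_left a.in_V w V)
  also have "\<dots> = 0" using r' d orth by simp
  finally show "r' = r" using a.definite[OF V(3)] by (simp add: d_def)
qed (use r orth in auto)

lemma mode:
  assumes "i \<in> {0..nsub P}" "j \<in> {1..comp_dim P i}"
  shows "Z i j \<in> comp_space P i" "Z i j \<in> Vh P"
    and "v \<in> comp_space P i \<Longrightarrow> a_form P (Z i j) v = of_real (\<Lambda> i j) * ip P (Z i j) v"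
    and "l \<in> {1..comp_dim P i} \<Longrightarrow> ip P (Z i j) (Z i l) = (if j = l then 1 else 0)"
  using eigen assms comp_space_subset unfolding component_eigenpairs_def by blast+

text \<open>For a normalised mode the eigenvalue is its energy a(Z, Z), which is nonnegative by
  coercivity and nonzero because Z is.\<close>

lemma eigenvalue_pos:
  assumes "i \<in> {0..nsub P}" "j \<in> {1..comp_dim P i}"
  shows "\<Lambda> i j > 0"
proof -
  have *: "a_form P (Z i j) (Z i j) = of_real (\<Lambda> i j)" "ip P (Z i j) (Z i j) = 1"
    using mode[OF assms] assms by auto
  then have "Z i j \<noteq> 0" using l2.zero_left[OF a.in_V(1)] by auto
  then have "\<Lambda> i j \<noteq> 0" using a.definite[OF mode(2)[OF assms]] * by auto
  moreover have "\<Lambda> i j \<ge> 0"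
  proof -
    obtain c where "c > 0" "Re (a_form P (Z i j) (Z i j)) \<ge> c * (h1_norm (Om P) (Z i j))\<^sup>2"
      using coercive mode(2)[OF assms] unfolding form_bounded_coercive_def by blast
    then show ?thesis using * by (metis Re_complex_of_real less_imp_le mult_nonneg_nonneg order_trans zero_le_power2)
  qed
  ultimately show ?thesis by simp
qed

text \<open>The modes of one component are also energy orthogonal, with a(Z, Z) = \<Lambda>, so the
  coefficients are Fourier coefficients in the energy product. The weights 1/\<Lambda> of the second
  bound originate here.\<close>

lemma ritz_modes:
  assumes i: "i \<in> {0..nsub P}" and w: "w \<in> Vh P"
  shows "ritz P i w = (\<Sum>j=1..comp_dim P i. fscale (a_form P w (Z i j) / of_real (\<Lambda> i j)) (Z i j))"
    (is "_ = ?r")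
proof (rule ritz_eqI[OF i w])
  show r: "?r \<in> comp_space P i"
    unfolding span_modes[OF i, symmetric] by (intro fld.span_sum fld.span_scale fld.span_base) auto
  then have rV: "?r \<in> Vh P" using comp_space_subset by auto
  fix v assume v: "v \<in> comp_space P i"
  show "a_form P (w - ?r) v = 0"
  proof (rule a.orthogonal_span)
    show "Z i ` {1..comp_dim P i} \<subseteq> Vh P" using mode(2)[OF i] by auto
    show "w - ?r \<in> Vh P" using w rV by (rule a.in_V)
    show "v \<in> fld.span (Z i ` {1..comp_dim P i})" using v span_modes[OF i] by simp
    fix s assume "s \<in> Z i ` {1..comp_dim P i}"
    then obtain l where l: "l \<in> {1..comp_dim P i}" "s = Z i l" by auto
    have "a_form P ?r (Z i l)
        = (\<Sum>j=1..comp_dim P i. a_form P (fscale (a_form P w (Z i j) / of_real (\<Lambda> i j)) (Z i j)) (Z i l))"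
      by (rule a.sum_left) (use mode(2)[OF i] l a.in_V(3) in auto)
    also have "\<dots> = (\<Sum>j=1..comp_dim P i. if j = l then a_form P w (Z i l) else 0)"
    proof (rule sum.cong)
      fix j assume j: "j \<in> {1..comp_dim P i}"
      show "a_form P (fscale (a_form P w (Z i j) / of_real (\<Lambda> i j)) (Z i j)) (Z i l)
          = (if j = l then a_form P w (Z i l) else 0)"
        using mode[OF i j] mode[OF i l(1)] l eigenvalue_pos[OF i j]
        by (simp add: a.scale_left)
    qed simp
    also have "\<dots> = a_form P w (Z i l)" using l by simp
    finally show "a_form P (w - ?r) s = 0"
      using w rV mode(2)[OF i l(1)] l by (simp add: a.diff_left)
  qed
qed

text \<open>In an orthogonal sum the projection onto a summand is the component in that
  summand.\<close>

lemma sum_ritz: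
  assumes v: "v \<in> Vh P"
  shows "v = (\<Sum>i=0..nsub P. ritz P i v)"
proof -
  obtain q where q: "\<And>i. i \<in> {0..nsub P} \<Longrightarrow> q i \<in> comp_space P i" "v = (\<Sum>i=0..nsub P. q i)"
    using Vh_decomposition[OF v] by metis
  have qV: "q i \<in> Vh P" if "i \<in> {0..nsub P}" for i using q(1)[OF that] comp_space_subset by auto
  have "ritz P i v = q i" if i: "i \<in> {0..nsub P}" for i
  proof (rule ritz_eqI[OF i v q(1)[OF i]])
    fix u assume u: "u \<in> comp_space P i"
    then have uV: "u \<in> Vh P" using comp_space_subset by auto
    have "a_form P v u = (\<Sum>j=0..nsub P. a_form P (q j) u)"
      unfolding q(2) by (rule a.sum_left) (use qV uV in auto)
    also have "\<dots> = (\<Sum>j=0..nsub P. if j = i then a_form P (q i) u else 0)"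
      using comp_spaces_orthogonal[OF _ i _ q(1) u] by (intro sum.cong) auto
    also have "\<dots> = a_form P (q i) u" using i by simp
    finally show "a_form P (v - q i) u = 0" using v qV[OF i] uV by (simp add: a.diff_left)
  qed
  then show ?thesis using q(2) by simp
qed

text \<open>The modes of all components together are a finite spanning set of \<open>Vh P\<close>.
  This provides the existence of the residual as an L2 representative.\<close>

lemma riesz_Vh:
  assumes "\<And>v w. v \<in> Vh P \<Longrightarrow> w \<in> Vh P \<Longrightarrow> L (v + w) = L v + L w"
    and "\<And>v c. v \<in> Vh P \<Longrightarrow> L (fscale c v) = cnj c * L v"
  obtains r where "r \<in> Vh P" "\<And>v. v \<in> Vh P \<Longrightarrow> ip P r v = L v"
proof -
  let ?S = "\<Union>i\<in>{0..nsub P}. Z i ` {1..comp_dim P i}"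
  have S: "?S \<subseteq> Vh P" using mode(2) by blast
  have "Vh P \<subseteq> fld.span ?S"
  proof
    fix v assume "v \<in> Vh P"
    then obtain q where q: "\<And>i. i \<in> {0..nsub P} \<Longrightarrow> q i \<in> comp_space P i" "v = (\<Sum>i=0..nsub P. q i)"
      using Vh_decomposition by metis
    have "q i \<in> fld.span ?S" if i: "i \<in> {0..nsub P}" for i
      using q(1)[OF i] span_modes[OF i] fld.span_mono[of "Z i ` {1..comp_dim P i}" ?S] i by blast
    then show "v \<in> fld.span ?S" unfolding q(2) by (rule fld.span_sum)
  qed
  moreover have "fld.span ?S \<subseteq> Vh P" using S subspace_Vh by (rule fld.span_minimal)
  moreover obtain r where "r \<in> fld.span ?S" "\<forall>v\<in>fld.span ?S. ip P r v = L v"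
    using l2.riesz[OF _ S, of L] assms by auto
  ultimately show ?thesis using that by blast
qed

end

section \<open>Error representation and the two bounds\<close>

theorem mainTheorem2:
  fixes P :: "('d::finite) elasticity_problem"
    and \<Lambda> :: "nat \<Rightarrow> nat \<Rightarrow> real" and Z :: "nat \<Rightarrow> nat \<Rightarrow> 'd field"
    and m :: "nat \<Rightarrow> nat" and D :: "'d field \<Rightarrow> 'd field"
    and \<omega> \<alpha> \<beta> :: real
    and U Um E \<psi> \<Phi> :: "'d field" and H :: "'d field \<Rightarrow> complex"
  assumes "elasticity_setting P"
    and "form_bounded_coercive P"
    and "load_bounded P"
    and "subdomain_partition P"
    and "component_eigenpairs P \<Lambda> Z"
    and "\<forall>i\<in>{0..nsub P}. m i \<le> comp_dim P i"
    and "\<alpha> \<ge> 0" and "\<beta> \<ge> 0"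
    and "rayleigh_damping P \<alpha> \<beta> D"
    and "U \<in> Vh P"
    and "\<forall>v\<in>Vh P. a_form P U v + \<i> * of_real \<omega> * ip P (D U) v - of_real (\<omega>\<^sup>2) * ip P U v
           = b_fun P v"
    and "Um \<in> reduced_space P Z m"
    and "\<forall>v\<in>reduced_space P Z m.
           a_form P Um v + \<i> * of_real \<omega> * ip P (D Um) v - of_real (\<omega>\<^sup>2) * ip P Um v
           = b_fun P v"
    and "E = U - Um"
    and "\<psi> \<in> Vh P"
    and "\<forall>v. H v = ip P v \<psi>"
    and "\<Phi> \<in> Vh P"
    and "\<forall>v\<in>Vh P. a_form P v \<Phi> + \<i> * of_real \<omega> * ip P v (D \<Phi>) - of_real (\<omega>\<^sup>2) * ip P v \<Phi>
           = H v"
  shows "cmod (H E) \<le> (\<Sum>i=0..nsub P. cmod (ip P (residual P \<omega> D Um) (ritz P i \<Phi>)))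
    \<and> cmod (H E) \<le> (\<Sum>i=0..nsub P. \<Sum>j=m i + 1..comp_dim P i.
         cmod (a_form P \<Phi> (Z i j) * ip P (residual P \<omega> D Um) (Z i j)) / \<Lambda> i j)"
proof -
  interpret cms P \<Lambda> Z
    using assms(1,2,4,5) by unfold_locales
  let ?I = "{0..nsub P}"
  let ?R = "residual P \<omega> D Um"
  \<comment> \<open>The residual functional expressed through the error, with the damping operator
    already in its weak form, so that conjugate-linearity is inherited from the two forms.\<close>
  define L where "L v = a_form P E v + \<i> * of_real \<omega> * (of_real \<alpha> * a_form P E v + of_real \<beta> * ip P E v)
      - of_real (\<omega>\<^sup>2) * ip P E v" for v
  have damp: "ip P (D v) w = of_real \<alpha> * a_form P v w + of_real \<beta> * ip P v w"
    "ip P v (D w) = of_real \<alpha> * a_form P v w + of_real \<beta> * ip P v w"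
    if "v \<in> Vh P" "w \<in> Vh P" for v w
    using assms(9) that unfolding rayleigh_damping_def by blast+
  have U: "U \<in> Vh P" and \<Phi>: "\<Phi> \<in> Vh P" by fact+
  have m: "j \<in> {1..comp_dim P i}" if "i \<in> ?I" "j \<in> {1..m i}" for i j
    using assms(6) that by fastforce
  have reduced_subset: "reduced_space P Z m \<subseteq> Vh P"
  proof
    fix v assume "v \<in> reduced_space P Z m"
    then obtain w where w: "v = (\<Sum>i=0..nsub P. w i)" "\<forall>i\<in>?I. w i \<in> fld.span (Z i ` {1..m i})"
      by (auto simp: reduced_space_def)
    have "fld.span (Z i ` {1..m i}) \<subseteq> Vh P" if "i \<in> ?I" for i
      using mode(2)[OF that m[OF that]] by (intro fld.span_minimal subspace_Vh) auto
    then show "v \<in> Vh P" unfolding w(1) using w(2) by (intro a.in_V(5)) blast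
  qed
  then have Um: "Um \<in> Vh P" using assms(12) by blast
  have E: "E \<in> Vh P" unfolding assms(14) by (intro a.in_V U Um)
  \<comment> \<open>The equation for U, inserted for the load, turns the residual of Um into the
    form of the full problem at E.\<close>
  have residual_eq: "b_fun P v - a_form P Um v - \<i> * of_real \<omega> * ip P (D Um) v
      + of_real (\<omega>\<^sup>2) * ip P Um v = L v" if v: "v \<in> Vh P" for v
  proof -
    have "b_fun P v = a_form P U v + \<i> * of_real \<omega> * ip P (D U) v - of_real (\<omega>\<^sup>2) * ip P U v"
      using assms(11) v by simp
    then show ?thesis
      unfolding L_def assms(14) using v U Um
      by (simp add: damp a.diff_left l2.diff_left algebra_simps)
  qed
  have "L (v + w) = L v + L w" if "v \<in> Vh P" "w \<in> Vh P" for v w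
    using that E by (simp add: L_def a.add_right l2.add_right algebra_simps)
  moreover have "L (fscale c v) = cnj c * L v" if "v \<in> Vh P" for v c
    using that E by (simp add: L_def a.scale_right l2.scale_right algebra_simps)
  ultimately obtain R where R: "R \<in> Vh P" "\<And>v. v \<in> Vh P \<Longrightarrow> ip P R v = L v"
    using riesz_Vh[of L] by blast
  \<comment> \<open>Two fields with the defining property of the residual differ by a field whose L2
    product with itself is zero.\<close>
  have R_eq: "?R = R"
    unfolding residual_def
  proof (rule the_equality)
    fix r assume r: "r \<in> Vh P \<and> (\<forall>v\<in>Vh P. ip P r v = b_fun P v - a_form P Um v
      - \<i> * of_real \<omega> * ip P (D Um) v + of_real (\<omega>\<^sup>2) * ip P Um v)"
    then have "r - R \<in> Vh P" using R(1) by (intro a.in_V) auto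
    moreover from this have "ip P (r - R) (r - R) = 0"
      using r R residual_eq by (subst l2.diff_left) auto
    ultimately show "r = R" using l2.definite by fastforce
  qed (use R residual_eq in auto)
  have ritz_V: "ritz P i \<Phi> \<in> Vh P" if i: "i \<in> ?I" for i
    unfolding ritz_modes[OF i \<Phi>] by (intro a.in_V(3,5) mode(2)[OF i])
  \<comment> \<open>The dual problem is tested with E. The damping term has the operator on \<Phi>,
    but its weak form is the same as the one in \<open>L\<close>.\<close>
  have "H E = a_form P E \<Phi> + \<i> * of_real \<omega> * ip P E (D \<Phi>) - of_real (\<omega>\<^sup>2) * ip P E \<Phi>"
    using assms(18) E by simp
  also have "\<dots> = ip P R \<Phi>" using R(2)[OF \<Phi>] E \<Phi> by (simp add: L_def damp)
  also have "\<dots> = ip P R (\<Sum>i=0..nsub P. ritz P i \<Phi>)" using sum_ritz[OF \<Phi>] by simp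
  also have "\<dots> = (\<Sum>i=0..nsub P. ip P R (ritz P i \<Phi>))"
    using ritz_V R(1) by (intro l2.sum_right)
  finally have "H E = (\<Sum>i=0..nsub P. ip P R (ritz P i \<Phi>))" .
  then have first: "cmod (H E) \<le> (\<Sum>i=0..nsub P. cmod (ip P R (ritz P i \<Phi>)))"
    by (simp add: norm_sum)
  \<comment> \<open>A retained mode is a test field of the reduced problem, as the family with a
    single nonzero component, and there the reduced equation says that the residual
    vanishes.\<close>
  have galerkin: "ip P R (Z i j) = 0" if i: "i \<in> ?I" and j: "j \<in> {1..m i}" for i j
  proof -
    have "Z i j \<in> reduced_space P Z m"
      unfolding reduced_space_def
    proof (intro CollectI exI conjI ballI)
      show "Z i j = (\<Sum>k=0..nsub P. if k = i then Z i j else 0)" using i by simp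
      show "(if k = i then Z i j else 0) \<in> fld.span (Z k ` {1..m k})" for k
        using j by (auto intro: fld.span_base fld.span_zero)
    qed
    then show ?thesis
      using assms(13) R(2)[OF mode(2)[OF i m[OF i j]]] residual_eq[OF mode(2)[OF i m[OF i j]]]
      by (simp add: algebra_simps)
  qed
  have second: "cmod (ip P R (ritz P i \<Phi>))
      \<le> (\<Sum>j=m i + 1..comp_dim P i. cmod (a_form P \<Phi> (Z i j) * ip P R (Z i j)) / \<Lambda> i j)"
    if i: "i \<in> ?I" for i
  proof -
    let ?c = "\<lambda>j. a_form P \<Phi> (Z i j) / of_real (\<Lambda> i j)"
    have "ip P R (ritz P i \<Phi>) = (\<Sum>j=1..comp_dim P i. ip P R (fscale (?c j) (Z i j)))"
      unfolding ritz_modes[OF i \<Phi>] by (intro l2.sum_right a.in_V(3) mode(2)[OF i] R(1))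
    \<comment> \<open>The coefficients sit in the conjugate-linear argument; the conjugation
      disappears in the modulus.\<close>
    also have "\<dots> = (\<Sum>j=1..comp_dim P i. cnj (?c j) * ip P R (Z i j))"
      by (intro sum.cong refl l2.scale_right mode(2)[OF i] R(1))
    \<comment> \<open>The indices up to m i drop out by Galerkin orthogonality.\<close>
    also have "\<dots> = (\<Sum>j=m i + 1..comp_dim P i. cnj (?c j) * ip P R (Z i j))"
      by (intro sum.mono_neutral_right) (use galerkin[OF i] in auto)
    also have "cmod \<dots> \<le> (\<Sum>j=m i + 1..comp_dim P i. cmod (cnj (?c j) * ip P R (Z i j)))"
      by (rule norm_sum)
    also have "\<dots> = (\<Sum>j=m i + 1..comp_dim P i. cmod (a_form P \<Phi> (Z i j) * ip P R (Z i j)) / \<Lambda> i j)"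
    proof (rule sum.cong)
      fix j assume "j \<in> {m i + 1..comp_dim P i}"
      then have "\<Lambda> i j > 0" by (intro eigenvalue_pos[OF i]) auto
      then show "cmod (cnj (?c j) * ip P R (Z i j)) = cmod (a_form P \<Phi> (Z i j) * ip P R (Z i j)) / \<Lambda> i j"
        by (simp add: norm_mult norm_divide)
    qed simp
    finally show ?thesis .
  qed
  show ?thesis
    unfolding R_eq using first order_trans[OF first sum_mono[OF second]] by blast
qed

end
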